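(* Let $m\ge 1$ and $\lambda\ge 0$. Then, for every nonnegative integer $n$, $$\mathcal{N}\left(\mathcal{P}_{n,m},L_{2,(1-|x|^2)^{\lambda-1/2}}(\mathfrak{B}^m)\right)=\left(\frac{(2\lambda+2n+m)\,\Gamma(2\lambda+n+m)}{2^{2\lambda+m-1}\pi^{(m-1)/2}(2\lambda+m)\,\Gamma(\lambda+1/2)\,\Gamma(\lambda+m/2)\,n!}\right)^{1/2},$$ and $$\mathcal{N}_0\left(B_{\mathfrak{B}^m}\cap L_{2,|t|^{2\lambda}}(\mathbb{R}^m),\,L_{2,|t|^{2\lambda}}(\mathbb{R}^m)\right)=\left(\frac{\Gamma(m/2)}{2^{2\lambda+m-1}\pi^{m/2}(2\lambda+m)\,\Gamma^2(\lambda+m/2)}\right)^{1/2}.$$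
   Context: $|x|$ is the Euclidean norm on $\mathbb{R}^m$ and $\mathfrak{B}^m=\{t\in\mathbb{R}^m:|t|\le1\}$ is the closed unit ball. For a measurable $\Omega\subseteq\mathbb{R}^m$ and a locally integrable weight $W:\Omega\to[0,\infty]$, $L_{r,W}(\Omega)$, $0<r<\infty$, is the space of measurable $F:\Omega\to\mathbb{C}$ with $\|F\|_{L_{r,W}(\Omega)}:=\left(\int_\Omega|F(x)|^rW(x)\,dx\right)^{1/r}<\infty$; $\|F\|_{L_\infty(\Omega)}:=\operatorname{ess\,sup}_{x\in\Omega}|F(x)|$. The weight in the subscript is written as a function of the variable ($x\in\mathfrak{B}^m$ or $t\in\mathbb{R}^m$). For a subspace $B$ of $L_{p,W}(\Omega)$ ($\Omega$ closed), $$\mathcal{N}_{0}(B,L_{p,W}(\Omega)):=\sup_{h\in B\setminus\{0\}}\frac{|h(0)|}{\|h\|_{L_{p,W}(\Omega)}},\qquad \mathcal{N}(B,L_{p,W}(\Omega)):=\sup_{h\in B\setminus\{0\}}\frac{\|h\|_{L_\infty(\Omega)}}{\|h\|_{L_{p,W}(\Omega)}}.$$ $\mathcal{P}_{n,m}$ is the set of all polynomials with complex coefficients in $m$ variables of total degree at most $n$. For $z\in\mathbb{C}^m$ let $\|z\|^*:=\sup_{t\in\mathfrak{B}^m}\left|\sum_{j=1}^mt_jz_j\right|$. $B_{\mathfrak{B}^m}$ is the set of all entire functions $f:\mathbb{C}^m\to\mathbb{C}$ such that for every $\varepsilon>0$ there is a constant $C_0(\varepsilon,f)>0$ with $|f(z)|\le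 C_0(\varepsilon,f)\exp\left((1+\varepsilon)\|z\|^*\right)$ for all $z\in\mathbb{C}^m$. Functions of this class are identified with their restrictions to $\mathbb{R}^m$ when intersected with weighted spaces. *)

theory Defs
  imports "HOL-Probability.Essential_Supremum"
begin

text \<open>
  The norm takes values in \<^typ>\<open>ennreal\<close>; it is \<open>\<infinity>\<close> exactly when the integral
  is. (There is no power function on \<^typ>\<open>ennreal\<close>, hence the case distinction.)
\<close>

definition wnorm :: "real \<Rightarrow> ('a::euclidean_space \<Rightarrow> ennreal) \<Rightarrow> 'a set \<Rightarrow> ('a \<Rightarrow> complex) \<Rightarrow> ennreal"
  where "wnorm r W \<Omega> F =
    (let I = (\<integral>\<^sup>+x. ennreal (cmod (F x) powr r) * W x \<partial>lebesgue_on \<Omega>)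
     in if I = \<infinity> then \<infinity> else ennreal (enn2real I powr (1 / r)))"

definition wspace :: "real \<Rightarrow> ('a::euclidean_space \<Rightarrow> ennreal) \<Rightarrow> 'a set \<Rightarrow> ('a \<Rightarrow> complex) set"
  where "wspace r W \<Omega> = {F. F \<in> borel_measurable (lebesgue_on \<Omega>) \<and> wnorm r W \<Omega> F < \<infinity>}"

definition linf_norm :: "'a::euclidean_space set \<Rightarrow> ('a \<Rightarrow> complex) \<Rightarrow> ennreal"
  where "linf_norm \<Omega> F = esssup (lebesgue_on \<Omega>) (\<lambda>x. ennreal (cmod (F x)))"

text \<open>
  Functions on \<open>\<Omega>\<close> are represented by functions on the whole space, so the zero element
  that is removed from \<open>B\<close> is any function vanishing on \<open>\<Omega>\<close>. The suprema are taken
  in \<^typ>\<open>ennreal\<close>, so an unbounded set of quotients gives \<open>\<infinity>\<close>. Both constants are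
  meant for subspaces \<open>B\<close> of \<open>wspace p W \<Omega>\<close>.
\<close>

definition nikolskii0 ::
  "('a::euclidean_space \<Rightarrow> complex) set \<Rightarrow> real \<Rightarrow> ('a \<Rightarrow> ennreal) \<Rightarrow> 'a set \<Rightarrow> ennreal"
  where "nikolskii0 B p W \<Omega> =
    (SUP h\<in>{h\<in>B. \<exists>x\<in>\<Omega>. h x \<noteq> 0}. ennreal (cmod (h 0)) / wnorm p W \<Omega> h)"

definition nikolskii ::
  "('a::euclidean_space \<Rightarrow> complex) set \<Rightarrow> real \<Rightarrow> ('a \<Rightarrow> ennreal) \<Rightarrow> 'a set \<Rightarrow> ennreal"
  where "nikolskii B p W \<Omega> =
    (SUP h\<in>{h\<in>B. \<exists>x\<in>\<Omega>. h x \<noteq> 0}. linf_norm \<Omega> h / wnorm p W \<Omega> h)"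

definition multiindices :: "nat \<Rightarrow> ('m::finite \<Rightarrow> nat) set"
  where "multiindices n = {\<alpha>. (\<Sum>i\<in>UNIV. \<alpha> i) \<le> n}"

lemma finite_multiindices: "finite (multiindices n :: ('m::finite \<Rightarrow> nat) set)"
proof (rule finite_subset)
  show "(multiindices n :: ('m \<Rightarrow> nat) set) \<subseteq> PiE UNIV (\<lambda>_. {..n})"
  proof
    fix \<alpha> :: "'m \<Rightarrow> nat"
    assume "\<alpha> \<in> multiindices n"
    then have sum_le: "(\<Sum>i\<in>UNIV. \<alpha> i) \<le> n"
      by (simp add: multiindices_def)
    have "\<alpha> i \<le> n" for i
    proof -
      have "\<alpha> i \<le> (\<Sum>i\<in>UNIV. \<alpha> i)"
        by (rule member_le_sum) simp_all
      then show ?thesis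
        using sum_le by linarith
    qed
    then show "\<alpha> \<in> PiE UNIV (\<lambda>_. {..n})"
      by (intro PiE_I) auto
  qed
  show "finite (PiE (UNIV :: 'm set) (\<lambda>_. {..n}))"
    by (rule finite_PiE) simp_all
qed

definition polys :: "nat \<Rightarrow> (real ^ 'm \<Rightarrow> complex) set"
  where "polys n = {P. \<exists>c :: ('m \<Rightarrow> nat) \<Rightarrow> complex.
    \<forall>x. P x = (\<Sum>\<alpha>\<in>multiindices n. c \<alpha> * (\<Prod>i\<in>UNIV. complex_of_real (x $ i) ^ \<alpha> i))}"

definition dual_norm :: "complex ^ 'm \<Rightarrow> real"
  where "dual_norm z =
    (SUP t\<in>cball (0 :: real ^ 'm) 1. cmod (\<Sum>j\<in>UNIV. complex_of_real (t $ j) * z $ j))"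

text \<open>
  Holomorphy in several variables: at every point the Frechet derivative exists and is
  complex linear.
\<close>

definition entire :: "(complex ^ 'm \<Rightarrow> complex) \<Rightarrow> bool"
  where "entire f \<longleftrightarrow>
    (\<forall>z. \<exists>a :: complex ^ 'm. (f has_derivative (\<lambda>h. \<Sum>j\<in>UNIV. a $ j * h $ j)) (at z))"

definition exp_type_ball :: "(complex ^ 'm \<Rightarrow> complex) set"
  where "exp_type_ball = {f. entire f \<and>
    (\<forall>\<epsilon>>0. \<exists>C>0. \<forall>z. cmod (f z) \<le> C * exp ((1 + \<epsilon>) * dual_norm z))}"

definition restrict_real :: "(complex ^ 'm \<Rightarrow> complex) \<Rightarrow> real ^ 'm \<Rightarrow> complex"
  where "restrict_real f = (\<lambda>t. f (\<chi> i. complex_of_real (t $ i)))"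

text \<open>
  \<^const>\<open>powr\<close> has value \<open>0\<close> at base \<open>0\<close> for every exponent. This departs from the
  convention \<open>0\<^sup>0 = 1\<close>, and from the value \<open>\<infinity>\<close> for a negative exponent, only on the unit
  sphere (first weight) and at the origin (second weight), which are null sets and do not affect
  the integrals. The values of the first weight outside the closed unit ball are never used.
\<close>

definition gegenbauer_weight :: "real \<Rightarrow> real ^ 'm \<Rightarrow> ennreal"
  where "gegenbauer_weight lam x = ennreal ((1 - (norm x)\<^sup>2) powr (lam - 1/2))"

definition power_weight :: "real \<Rightarrow> real ^ 'm \<Rightarrow> ennreal"
  where "power_weight lam t = ennreal (norm t powr (2 * lam))"

end

theory Submission
  imports Defs "HOL-Complex_Analysis.Complex_Analysis" "HOL-Real_Asymp.Real_Asymp"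
begin

text \<open>
  Both constants are values of a reproducing kernel. If a function \<open>Q\<close> in a space of functions,
  normalised by \<open>Q = 1\<close> at a point \<open>a\<close>, satisfies \<open>\<integral> Q P w = c P(a)\<close> for every \<open>P\<close> of the space, then
  \<open>c \<bar>P(a)\<bar>\<^sup>2 \<le> \<integral> \<bar>P\<bar>\<^sup>2 w\<close>, with equality for \<open>P = Q\<close> (\<open>bessel_inequality_one_vector\<close>). Everything is
  reduced to one explicit kernel of this kind: the polynomial of degree \<open>n\<close> that reproduces the value
  at \<open>0\<close> for the Jacobi weight \<open>y powr (p - 1) * (1 - y) powr (q - 1)\<close> on the unit interval
  (\<open>jacobi_kernel_reproducing\<close>). Its mass \<open>c\<close> is a quotient of Gamma values, found by finite
  differences.

  For polynomials on the ball of \<open>\<real>\<^sup>m\<close> and \<open>lam > 0\<close>, the weight with exponent \<open>lam - 1/2\<close> is a multiple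
  of the marginal of the weight with exponent \<open>lam - 1\<close> on the ball of \<open>\<real> \<times> \<real>\<^sup>m\<close>. A point \<open>x\<close> of the small
  ball lifts to the point \<open>(sqrt (1 - \<bar>x\<bar>\<^sup>2), x)\<close> of the unit sphere, and there the kernel is zonal: after
  a reflection that moves the point to the pole, integrating out all the other coordinates leaves a
  polynomial in the axial coordinate and a Jacobi weight with \<open>p = q = lam + m/2\<close>
  (\<open>zonal_reproducing\<close>). So interior and boundary points satisfy the same inequality
  (\<open>polys_ball_bound\<close>), and on the boundary it is attained by a function of one coordinate
  (\<open>nn_integral_zonal_coordinate\<close>). The case \<open>lam = 0\<close>, where the lifted weight is not integrable, follows
  by letting \<open>lam\<close> tend to \<open>0\<close>.

  For entire functions, put \<open>\<nu> = lam + m/2\<close>. The lower bound comes from a radial function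
  (\<open>bessel_radial\<close>, a multiple of \<open>J\<^sub>\<nu>(\<bar>t\<bar>) / \<bar>t\<bar>\<^sup>\<nu>\<close>). It is the limit of the Jacobi kernels with \<open>p = \<nu>\<close>,
  \<open>q = 1\<close> under the substitution \<open>y = r\<^sup>2 / (2 n)\<^sup>2\<close>, and Fatou's lemma bounds its norm by the limit of
  their norms. For the upper bound, the even part of \<open>f\<close> along each direction is an even entire
  function of one variable of exponential type at most \<open>1\<close>. The inequality for such a function \<open>F\<close>
  (\<open>half_line_bound\<close>) is the limit of the polynomial inequality on \<open>[0, R]\<close>: the integrability of \<open>F\<close>
  and the Phragmen-Lindelof principle bound \<open>F\<close> by a linear factor times \<open>exp (B \<bar>Im z\<bar>)\<close>, for each
  \<open>B > 1\<close> (\<open>paley_wiener_growth\<close>); hence \<open>F\<close> is exponentially small off the polynomials in \<open>x\<^sup>2\<close> of degree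
  \<open>n\<close> on \<open>[0, \<kappa> n]\<close> whenever \<open>\<kappa> < 2\<close> (\<open>even_entire_polynomial_approximation\<close>), and \<open>\<kappa>\<close> may tend to \<open>2\<close>.
  Averaging over directions by means of polar coordinates
  (\<open>nn_integral_polar\<close>) gives the inequality on \<open>\<real>\<^sup>m\<close>.
\<close>

section \<open>Alternating binomial sums and the Jacobi reproducing kernel\<close>

lemma alternating_choose_sum_Suc:
  fixes f :: "nat \<Rightarrow> 'a::comm_ring_1"
  shows "(\<Sum>j\<le>Suc n. (-1) ^ j * of_nat (Suc n choose j) * f j) =
         (\<Sum>j\<le>n. (-1) ^ j * of_nat (n choose j) * (f j - f (Suc j)))"
proof -
  have *: "(\<Sum>j\<le>n. (-1) ^ j * of_nat (n choose Suc j) * f (Suc j)) =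
        f 0 - (\<Sum>j\<le>n. (-1) ^ j * of_nat (n choose j) * f j)"
  proof -
    have "(\<Sum>j\<le>n. (-1) ^ j * of_nat (n choose j) * f j) =
          (\<Sum>j\<le>Suc n. (-1) ^ j * of_nat (n choose j) * f j)"
      by (simp add: binomial_eq_0)
    also have "\<dots> = f 0 - (\<Sum>j\<le>n. (-1) ^ j * of_nat (n choose Suc j) * f (Suc j))"
      by (subst sum.atMost_Suc_shift) (simp add: sum_negf)
    finally show ?thesis by simp
  qed
  have "(\<Sum>j\<le>Suc n. (-1) ^ j * of_nat (Suc n choose j) * f j) =
        f 0 - (\<Sum>j\<le>n. (-1) ^ j * of_nat (n choose j) * f (Suc j))
            - (\<Sum>j\<le>n. (-1) ^ j * of_nat (n choose Suc j) * f (Suc j))"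
    by (subst sum.atMost_Suc_shift)
       (simp add: algebra_simps sum.distrib sum_negf sum_subtractf)
  then show ?thesis unfolding *
    by (simp add: algebra_simps sum_subtractf)
qed

text \<open>
  Up to sign, the sum is an \<open>n\<close>-th finite difference, and each difference lowers the degree.
\<close>
lemma alternating_choose_sum_poly:
  fixes p :: "'a::idom poly"
  assumes "degree p < n"
  shows "(\<Sum>j\<le>n. (-1) ^ j * of_nat (n choose j) * poly p (of_nat j)) = 0"
  using assms
proof (induction n arbitrary: p)
  case (Suc n)
  define q where "q = p - pcompose p [:1, 1:]"
  have q: "poly p (of_nat j) - poly p (of_nat (Suc j)) = poly q (of_nat j)" for j
    by (simp add: q_def poly_pcompose add_ac)
  show ?case
  proof (cases "degree p = 0")
    case True
    then obtain c where "p = [:c:]" by (rule degree_eq_zeroE)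
    then have "q = 0" by (simp add: q_def pcompose_const)
    then show ?thesis
      by (subst alternating_choose_sum_Suc) (simp only: q, simp)
  next
    case False
    have "degree (pcompose p [:1, 1:]) = degree p"
      by (simp add: degree_pcompose)
    moreover have "lead_coeff (pcompose p [:1, 1:]) = lead_coeff p"
      by (subst lead_coeff_comp) auto
    ultimately have "degree q < degree p"
      unfolding q_def using False
      by (intro degree_lessI) (auto simp: le_less coeff_eq_0)
    with Suc.prems have "degree q < n" by simp
    from Suc.IH[OF this] show ?thesis
      by (subst alternating_choose_sum_Suc) (simp only: q)
  qed
qed simp

text \<open>
  The same sum for the function that is not a polynomial, \<open>j \<mapsto> 1 / (c + j)\<close>. It produces the mass of
  the kernel below.
\<close>
lemma alternating_choose_sum_inverse:
  fixes c :: real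
  assumes "c > 0"
  shows "(\<Sum>j\<le>n. (-1) ^ j * of_nat (n choose j) * (1 / (c + of_nat j))) =
         fact n / pochhammer c (Suc n)"
  using assms
proof (induction n arbitrary: c)
  case (Suc n)
  have P: "pochhammer c (Suc n) > 0" "pochhammer (c + 1) (Suc n) > 0"
    using Suc.prems by (auto intro!: pochhammer_pos)
  have e1: "pochhammer c (Suc (Suc n)) = c * pochhammer (c + 1) (Suc n)"
    by (rule pochhammer_rec)
  have e2: "pochhammer c (Suc (Suc n)) = pochhammer c (Suc n) * (c + 1 + real n)"
    by (subst pochhammer_Suc) (simp add: algebra_simps)
  have "(\<Sum>j\<le>Suc n. (-1) ^ j * of_nat (Suc n choose j) * (1 / (c + of_nat j))) =
     (\<Sum>j\<le>n. (-1) ^ j * of_nat (n choose j) * (1 / (c + of_nat j))) -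
     (\<Sum>j\<le>n. (-1) ^ j * of_nat (n choose j) * (1 / ((c + 1) + of_nat j)))"
    by (subst alternating_choose_sum_Suc) (simp add: algebra_simps sum_subtractf)
  also have "\<dots> = fact n / pochhammer c (Suc n) - fact n / pochhammer (c + 1) (Suc n)"
    using Suc.IH[of c] Suc.IH[of "c + 1"] Suc.prems by simp
  also have "\<dots> = fact n * (c + 1 + real n) / pochhammer c (Suc (Suc n))
                - fact n * c / pochhammer c (Suc (Suc n))"
  proof -
    have "1 / pochhammer c (Suc n) = (c + 1 + real n) / pochhammer c (Suc (Suc n))"
      unfolding e2 using P Suc.prems by simp
    moreover have "1 / pochhammer (c + 1) (Suc n) = c / pochhammer c (Suc (Suc n))"
      unfolding e1 using P Suc.prems by simp
    ultimately show ?thesis by (metis mult.right_neutral times_divide_eq_right)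
  qed
  also have "\<dots> = fact (Suc n) / pochhammer c (Suc (Suc n))"
    by (simp add: field_simps diff_divide_distrib [symmetric] del: pochhammer_Suc)
  finally show ?case .
qed simp

definition jacobi_weight :: "real \<Rightarrow> real \<Rightarrow> real \<Rightarrow> real"
  where "jacobi_weight p q y = indicator {0<..<1} y * (y powr (p - 1) * (1 - y) powr (q - 1))"

text \<open>
  Up to normalisation, the Jacobi polynomial on \<open>[0, 1]\<close> for the weight \<open>y powr p * (1 - y) powr (q - 1)\<close>.
  The exponent of \<open>y\<close> is one more than that of the weight whose value at \<open>0\<close> is to be reproduced, since
  the kernel must be orthogonal to all multiples of \<open>y\<close> of degree at most \<open>n\<close>.
\<close>
definition jacobi_kernel :: "real \<Rightarrow> real \<Rightarrow> nat \<Rightarrow> real poly"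
  where "jacobi_kernel p q n =
    (\<Sum>j\<le>n. monom ((-1) ^ j * of_nat (n choose j) *
       (pochhammer (n + p + q) j / pochhammer (p + 1) j)) j)"

definition jacobi_mass :: "real \<Rightarrow> real \<Rightarrow> nat \<Rightarrow> real"
  where "jacobi_mass p q n =
     Gamma (q + n) * Gamma (p + 1) * Gamma p * fact n / (Gamma (n + p + q) * Gamma (p + n + 1))"

lemma jacobi_weight_nonneg: "jacobi_weight p q y \<ge> 0"
  by (simp add: jacobi_weight_def)

lemma jacobi_weight_measurable [measurable]: "jacobi_weight p q \<in> borel_measurable borel"
  unfolding jacobi_weight_def[abs_def] by measurable

lemma jacobi_mass_pos: "p > 0 \<Longrightarrow> q > 0 \<Longrightarrow> jacobi_mass p q n > 0"
  unfolding jacobi_mass_def by (intro divide_pos_pos mult_pos_pos Gamma_real_pos) auto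

lemma jacobi_kernel_0: "poly (jacobi_kernel p q n) 0 = 1"
  by (simp add: jacobi_kernel_def poly_sum poly_monom sum.atMost_shift)

lemma degree_jacobi_kernel: "degree (jacobi_kernel p q n) \<le> n"
  unfolding jacobi_kernel_def by (intro degree_sum_le) (auto intro: order_trans[OF degree_monom_le])

lemma jacobi_moment:
  assumes "p > 0" "q > 0"
  shows "has_bochner_integral lborel (\<lambda>y. jacobi_weight p q y * y ^ k) (Beta (p + k) q)"
proof -
  have pk: "p + real k > 0" using assms by simp
  have eq: "jacobi_weight p q y * y ^ k =
        indicator {0<..<1} y *\<^sub>R (y powr (p + k - 1) * (1 - y) powr (q - 1))" for y
  proof (cases "y \<in> {0<..<1}")
    case True
    then show ?thesis
      by (simp add: jacobi_weight_def powr_add powr_diff powr_realpow)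
  qed (simp add: jacobi_weight_def)
  have I: "set_integrable lborel {0<..<1} (\<lambda>t. t powr (p + k - 1) * (1 - t) powr (q - 1))"
    by (rule set_integrable_subset[OF integrable_Beta[OF pk assms(2)]]) auto
  have "(LINT y:{0<..<1}|lborel. (y powr (p + k - 1) * (1 - y) powr (q - 1))) = Beta (p + k) q"
    using has_integral_Beta_real[OF pk assms(2), unfolded has_integral_Icc_iff_Ioo]
    by (subst set_borel_integral_eq_integral(2)[OF I]) (simp add: has_integral_iff)
  with I show ?thesis
    unfolding has_bochner_integral_iff eq set_integrable_def set_lebesgue_integral_def by simp
qed

lemma poly_pochhammer_shift:
  obtains r :: "real poly" where "degree r \<le> k" "\<And>x. poly r x = pochhammer (a + x) k"
proof
  let ?r = "\<Prod>i<k. [:a + real i, 1:]"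
  show "degree ?r \<le> k"
    using degree_prod_sum_le[of "{..<k}" "\<lambda>i. [:a + real i, 1:]"] by simp
  show "poly ?r x = pochhammer (a + x) k" for x
    by (simp add: poly_prod pochhammer_prod lessThan_atLeast0 add_ac)
qed

lemma Gamma_real_plus1: "(x::real) > 0 \<Longrightarrow> Gamma (x + 1) = x * Gamma x"
  by (rule Gamma_plus1) (auto elim!: nonpos_Ints_cases)

text \<open>
  After the Gamma factors are cancelled, the summand is an alternating binomial coefficient times
  \<open>r j * \<Gamma> (p + k + j) / \<Gamma> (p + 1 + j)\<close> with a polynomial \<open>r\<close> of degree \<open>n - k\<close>. For \<open>k > 0\<close> the quotient
  is a polynomial of degree \<open>k - 1\<close>, so the total degree is below \<open>n\<close> and the sum vanishes. For \<open>k = 0\<close> the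
  quotient is \<open>1 / (p + j)\<close>, and only the remainder of \<open>r\<close> on division by \<open>p + j\<close> contributes.
\<close>
lemma jacobi_kernel_moment_sum:
  assumes p: "p > 0" and q: "q > (0::real)" and k: "k \<le> n"
  shows "(\<Sum>j\<le>n. (-1) ^ j * of_nat (n choose j) *
           (pochhammer (n + p + q) j / pochhammer (p + 1) j) * Beta (p + real (j + k)) q) =
         (if k = 0 then jacobi_mass p q n else 0)"
proof -
  let ?sum = "\<lambda>f. \<Sum>j\<le>n. (-1) ^ j * of_nat (n choose j) * f (real j)"
  define C where "C = Gamma (p + 1) * Gamma q / Gamma (n + p + q)"
  obtain r :: "real poly" where r: "degree r \<le> n - k" "\<And>x. poly r x = pochhammer (p + q + k + x) (n - k)"
    using poly_pochhammer_shift[of "n - k" "p + q + k"] by metis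
  have tm: "pochhammer (n + p + q) j / pochhammer (p + 1) j * Beta (p + real (j + k)) q =
        C * (poly r (real j) * (Gamma (p + k + j) / Gamma (p + 1 + j)))" for j
  proof -
    have a1: "pochhammer (n + p + q) j = Gamma (n + p + q + j) / Gamma (n + p + q)"
      using p q by (intro pochhammer_Gamma) (auto elim!: nonpos_Ints_cases)
    have a2: "pochhammer (p + 1) j = Gamma (p + 1 + j) / Gamma (p + 1)"
      using p q by (intro pochhammer_Gamma) (auto elim!: nonpos_Ints_cases)
    have a3: "poly r (real j) = Gamma (n + p + q + j) / Gamma (p + q + k + j)"
      unfolding r(2) using p q k
      by (subst pochhammer_Gamma) (auto elim!: nonpos_Ints_cases simp: of_nat_diff algebra_simps)
    have a4: "Beta (p + real (j + k)) q = Gamma (p + k + j) * Gamma q / Gamma (p + q + k + j)"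
      by (simp add: Beta_def algebra_simps)
    show ?thesis unfolding a1 a2 a3 a4 C_def by (simp add: mult_ac)
  qed
  have sum: "(\<Sum>j\<le>n. (-1) ^ j * of_nat (n choose j) *
           (pochhammer (n + p + q) j / pochhammer (p + 1) j) * Beta (p + real (j + k)) q) =
      C * ?sum (\<lambda>x. poly r x * (Gamma (p + k + x) / Gamma (p + 1 + x)))"
    unfolding sum_distrib_left mult.assoc tm by (simp add: mult_ac)
  show ?thesis
  proof (cases "k = 0")
    case False
    obtain r2 :: "real poly" where r2: "degree r2 \<le> k - 1" "\<And>x. poly r2 x = pochhammer (p + 1 + x) (k - 1)"
      using poly_pochhammer_shift[of "k - 1" "p + 1"] by metis
    have "degree (r * r2) \<le> degree r + degree r2" by (rule degree_mult_le)
    also have "\<dots> < n" using r(1) r2(1) k False by linarith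
    finally have deg: "degree (r * r2) < n" .
    have "Gamma (p + k + real j) / Gamma (p + 1 + real j) = poly r2 (real j)" for j
      unfolding r2(2) using p False
      by (subst pochhammer_Gamma) (auto elim!: nonpos_Ints_cases simp: of_nat_diff algebra_simps)
    then show ?thesis
      unfolding sum using alternating_choose_sum_poly[OF deg] False by simp
  next
    case True
    define t where "t = synthetic_div r (- p)"
    have rt: "poly r x = pochhammer q n + (p + x) * poly t x" for x
    proof -
      have "poly r x = poly ([:p, 1:] * t + [:poly r (-p):]) x"
        unfolding t_def using synthetic_div_correct'[of "-p" r] by simp
      also have "\<dots> = pochhammer q n + (p + x) * poly t x"
        using True by (simp add: r(2) algebra_simps)
      finally show ?thesis .
    qed
    have zero: "?sum (poly t) = 0"
    proof (cases "degree r = 0")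
      case True
      then have "t = 0" by (simp add: t_def synthetic_div_eq_0_iff)
      then show ?thesis by simp
    next
      case False
      then have "degree t < n" using r(1) by (simp add: t_def degree_synthetic_div)
      from alternating_choose_sum_poly[OF this] show ?thesis by simp
    qed
    have quot: "poly r (real j) * (Gamma (p + k + real j) / Gamma (p + 1 + real j)) =
        pochhammer q n * (1 / (p + real j)) + poly t (real j)" for j
    proof -
      have "Gamma (p + real j) > 0" using p by (intro Gamma_real_pos) simp
      moreover have "Gamma (p + 1 + real j) = (p + real j) * Gamma (p + real j)"
        using Gamma_real_plus1[of "p + j"] p by (simp add: add_ac)
      ultimately have "Gamma (p + k + real j) / Gamma (p + 1 + real j) = 1 / (p + real j)"
        using True less_imp_neq[of 0 "Gamma (p + real j)"] by simp
      then show ?thesis unfolding rt using p by (simp add: field_simps)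
    qed
    have "?sum (\<lambda>x. poly r x * (Gamma (p + k + x) / Gamma (p + 1 + x))) =
        pochhammer q n * ?sum (\<lambda>x. 1 / (p + x)) + ?sum (poly t)"
      unfolding quot by (simp add: algebra_simps sum.distrib sum_distrib_left)
    also have "\<dots> = pochhammer q n * (fact n / pochhammer p (Suc n))"
      unfolding zero alternating_choose_sum_inverse[OF p] by simp
    also have "C * \<dots> = jacobi_mass p q n"
    proof -
      have a1: "pochhammer q n = Gamma (q + n) / Gamma q"
        using p q by (intro pochhammer_Gamma) (auto elim!: nonpos_Ints_cases)
      have a2: "pochhammer p (Suc n) = Gamma (p + n + 1) / Gamma p"
        using p q by (subst pochhammer_Gamma) (auto elim!: nonpos_Ints_cases simp: add_ac)
      have pos: "Gamma q > 0" "Gamma p > 0" "Gamma (p + n + 1) > 0" "Gamma (n + p + q) > 0"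
        using p q by (auto intro!: Gamma_real_pos)
      show ?thesis unfolding jacobi_mass_def C_def a1 a2 using pos by (simp add: field_simps)
    qed
    finally show ?thesis using True sum by simp
  qed
qed

lemma jacobi_kernel_moment:
  assumes p: "p > 0" and q: "q > (0::real)" and k: "k \<le> n"
  shows "has_bochner_integral lborel (\<lambda>y. poly (jacobi_kernel p q n) y * jacobi_weight p q y * y ^ k)
         (if k = 0 then jacobi_mass p q n else 0)"
proof -
  let ?a = "\<lambda>j. (-1) ^ j * of_nat (n choose j) * (pochhammer (n + p + q) j / pochhammer (p + 1) j)"
  have "has_bochner_integral lborel (\<lambda>y. \<Sum>j\<le>n. ?a j * (jacobi_weight p q y * y ^ (j + k)))
          (\<Sum>j\<le>n. ?a j * Beta (p + real (j + k)) q)"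
    by (intro has_bochner_integral_sum has_bochner_integral_mult_right jacobi_moment p q)
  also have "(\<Sum>j\<le>n. ?a j * Beta (p + real (j + k)) q) = (if k = 0 then jacobi_mass p q n else 0)"
    by (rule jacobi_kernel_moment_sum[OF assms])
  also have "(\<lambda>y. \<Sum>j\<le>n. ?a j * (jacobi_weight p q y * y ^ (j + k))) =
      (\<lambda>y. poly (jacobi_kernel p q n) y * jacobi_weight p q y * y ^ k)"
    by (simp add: jacobi_kernel_def poly_sum poly_monom sum_distrib_right sum_distrib_left
          power_add mult_ac fun_eq_iff)
  finally show ?thesis .
qed

lemma poly_eq_sum_coeff:
  fixes P :: "'a::comm_semiring_1 poly"
  assumes "degree P \<le> n"
  shows "poly P x = (\<Sum>i\<le>n. coeff P i * x ^ i)"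
  unfolding poly_altdef using assms
  by (intro sum.mono_neutral_left) (auto simp: coeff_eq_0)

lemma jacobi_kernel_reproducing:
  assumes p: "p > 0" and q: "q > (0::real)" and "degree P \<le> n"
  shows "has_bochner_integral lborel
     (\<lambda>y. complex_of_real (poly (jacobi_kernel p q n) y * jacobi_weight p q y) * poly P (of_real y))
     (of_real (jacobi_mass p q n) * poly P 0)"
proof -
  let ?Q = "\<lambda>y. poly (jacobi_kernel p q n) y * jacobi_weight p q y"
  have "has_bochner_integral lborel (\<lambda>y. \<Sum>k\<le>n. coeff P k * complex_of_real (?Q y * y ^ k))
     (\<Sum>k\<le>n. coeff P k * complex_of_real (if k = 0 then jacobi_mass p q n else 0))"
    using jacobi_kernel_moment[OF p q]
    by (intro has_bochner_integral_sum has_bochner_integral_mult_right has_bochner_integral_of_real)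
       auto
  also have "(\<Sum>k\<le>n. coeff P k * complex_of_real (if k = 0 then jacobi_mass p q n else 0)) =
     of_real (jacobi_mass p q n) * poly P 0"
    by (simp add: sum.atMost_shift poly_0_coeff_0)
  also have "(\<lambda>y. \<Sum>k\<le>n. coeff P k * complex_of_real (?Q y * y ^ k)) =
     (\<lambda>y. of_real (?Q y) * poly P (of_real y))"
    using assms(3)
    by (simp add: poly_eq_sum_coeff [of P n] sum_distrib_left mult_ac fun_eq_iff)
  finally show ?thesis .
qed

lemma jacobi_kernel_reproducing_real:
  assumes p: "p > 0" and q: "q > (0::real)" and "degree P \<le> n"
  shows "has_bochner_integral lborel
     (\<lambda>y. poly (jacobi_kernel p q n) y * jacobi_weight p q y * poly P y)
     (jacobi_mass p q n * poly P 0)"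
proof -
  let ?Q = "\<lambda>y. poly (jacobi_kernel p q n) y * jacobi_weight p q y"
  have "has_bochner_integral lborel (\<lambda>y. \<Sum>k\<le>n. coeff P k * (?Q y * y ^ k))
     (\<Sum>k\<le>n. coeff P k * (if k = 0 then jacobi_mass p q n else 0))"
    using jacobi_kernel_moment[OF p q]
    by (intro has_bochner_integral_sum has_bochner_integral_mult_right) auto
  also have "(\<Sum>k\<le>n. coeff P k * (if k = 0 then jacobi_mass p q n else 0)) =
     jacobi_mass p q n * poly P 0"
    by (simp add: sum.atMost_shift poly_0_coeff_0)
  also have "(\<lambda>y. \<Sum>k\<le>n. coeff P k * (?Q y * y ^ k)) = (\<lambda>y. ?Q y * poly P y)"
    using assms(3)
    by (simp add: poly_eq_sum_coeff [of P n] sum_distrib_left mult_ac fun_eq_iff)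
  finally show ?thesis .
qed

text \<open>
  The integral of \<open>\<bar>P - a Q\<bar>\<^sup>2 w\<close> is nonnegative, and its cross term is known by the reproducing property.
\<close>
lemma bessel_inequality_one_vector:
  fixes Q w :: "'a \<Rightarrow> real" and P :: "'a \<Rightarrow> complex"
  assumes w: "\<And>x. w x \<ge> 0"
    and QQ: "has_bochner_integral M (\<lambda>x. Q x * w x * Q x) c"
    and QP: "has_bochner_integral M (\<lambda>x. of_real (Q x * w x) * P x) (of_real c * a)"
    and [measurable]: "P \<in> borel_measurable M" "w \<in> borel_measurable M"
  shows "ennreal (c * (cmod a)\<^sup>2) \<le> (\<integral>\<^sup>+x. ennreal ((cmod (P x))\<^sup>2 * w x) \<partial>M)"
proof (cases "integrable M (\<lambda>x. (cmod (P x))\<^sup>2 * w x)")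
  case False
  have "(\<integral>\<^sup>+x. ennreal ((cmod (P x))\<^sup>2 * w x) \<partial>M) = \<infinity>"
  proof (rule ccontr)
    assume "(\<integral>\<^sup>+x. ennreal ((cmod (P x))\<^sup>2 * w x) \<partial>M) \<noteq> \<infinity>"
    then have "integrable M (\<lambda>x. (cmod (P x))\<^sup>2 * w x)"
      by (intro integrableI_nonneg) (auto simp: w top.not_eq_extremum)
    with False show False by simp
  qed
  then show ?thesis by simp
next
  case True
  define I where "I = (\<integral>x. (cmod (P x))\<^sup>2 * w x \<partial>M)"
  have R: "has_bochner_integral M (\<lambda>x. Re (cnj a * (of_real (Q x * w x) * P x)))
        (Re (cnj a * (of_real c * a)))"
    by (intro has_bochner_integral_Re has_bochner_integral_mult_right QP)
  have "has_bochner_integral M (\<lambda>x. (cmod (P x))\<^sup>2 * w x -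
           2 * Re (cnj a * (of_real (Q x * w x) * P x)) + (cmod a)\<^sup>2 * (Q x * w x * Q x))
         (I - 2 * Re (cnj a * (of_real c * a)) + (cmod a)\<^sup>2 * c)"
    unfolding I_def
    by (intro has_bochner_integral_add has_bochner_integral_diff has_bochner_integral_mult_right R QQ
         has_bochner_integral_integrable True)
  moreover have "(cmod (P x))\<^sup>2 * w x -
           2 * Re (cnj a * (of_real (Q x * w x) * P x)) + (cmod a)\<^sup>2 * (Q x * w x * Q x) =
         (cmod (P x - a * of_real (Q x)))\<^sup>2 * w x" for x
    unfolding cmod_power2 by (simp add: power2_eq_square algebra_simps)
  ultimately have "has_bochner_integral M (\<lambda>x. (cmod (P x - a * of_real (Q x)))\<^sup>2 * w x)
         (I - 2 * Re (cnj a * (of_real c * a)) + (cmod a)\<^sup>2 * c)"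
    by simp
  then have "I - 2 * Re (cnj a * (of_real c * a)) + (cmod a)\<^sup>2 * c =
      (\<integral>x. (cmod (P x - a * of_real (Q x)))\<^sup>2 * w x \<partial>M)"
    by (rule has_bochner_integral_integral_eq[symmetric])
  moreover have "(\<integral>x. (cmod (P x - a * of_real (Q x)))\<^sup>2 * w x \<partial>M) \<ge> 0"
    by (intro Bochner_Integration.integral_nonneg mult_nonneg_nonneg w zero_le_power2)
  ultimately have "0 \<le> I - 2 * Re (cnj a * (of_real c * a)) + (cmod a)\<^sup>2 * c" by linarith
  moreover have "Re (cnj a * (of_real c * a)) = c * (cmod a)\<^sup>2"
    unfolding cmod_power2 by (simp add: power2_eq_square algebra_simps)
  ultimately have "c * (cmod a)\<^sup>2 \<le> I" by (simp add: mult.commute)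
  then have "ennreal (c * (cmod a)\<^sup>2) \<le> ennreal I" by (rule ennreal_leI)
  also have "ennreal I = (\<integral>\<^sup>+x. ennreal ((cmod (P x))\<^sup>2 * w x) \<partial>M)"
    unfolding I_def by (rule nn_integral_eq_integral[symmetric]) (use True w in auto)
  finally show ?thesis .
qed

section \<open>Lebesgue measure under isometries and in polar coordinates\<close>

lemma nn_integral_lborel_translate:
  fixes h :: "'a::euclidean_space \<Rightarrow> ennreal"
  assumes [measurable]: "h \<in> borel_measurable borel"
  shows "(\<integral>\<^sup>+x. h (a + x) \<partial>lborel) = (\<integral>\<^sup>+x. h x \<partial>lborel)"
proof -
  have "(\<integral>\<^sup>+x. h x \<partial>lborel) = (\<integral>\<^sup>+x. h x \<partial>distr lborel borel ((+) a))"
    by (simp only: lborel_distr_plus)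
  also have "\<dots> = (\<integral>\<^sup>+x. h (a + x) \<partial>lborel)"
    by (rule nn_integral_distr) auto
  finally show ?thesis by simp
qed

text \<open>
  Uniqueness of translation invariant measures: the image measure is translation invariant, so
  integrating \<open>indicator A (f x) * indicator B (y - f x)\<close> in both orders shows that it is proportional to
  Lebesgue measure, and the unit ball \<open>B\<close>, which \<open>f\<close> preserves, fixes the factor.
\<close>
lemma lborel_distr_isometry:
  fixes f :: "'a::euclidean_space \<Rightarrow> 'a"
  assumes lin: "linear f" and iso: "\<And>x. norm (f x) = norm x"
  shows "distr lborel borel f = lborel"
proof (rule measure_eqI)
  have [measurable]: "f \<in> borel_measurable borel"
    using lin by (intro borel_measurable_continuous_onI linear_continuous_on)
                 (simp add: linear_conv_bounded_linear)
  have "inj f"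
    by (rule linear_injective_0[OF lin, THEN iffD2]) (metis iso norm_eq_zero)
  then have "surj f" using lin linear_injective_imp_surjective by blast
  then obtain g where g: "\<And>y. f (g y) = y" by (metis surjD)
  have [measurable]: "cball (0::'a) 1 \<in> sets borel" by simp
  fix A assume "A \<in> sets (distr lborel borel f)"
  then have A[measurable]: "A \<in> sets borel" by simp
  let ?B = "cball (0::'a) 1"
  let ?h = "\<lambda>x y. indicator A (f x) * indicator ?B (y - f x) :: ennreal"
  have "emeasure (distr lborel borel f) A * emeasure lborel ?B =
        (\<integral>\<^sup>+x. indicator A (f x) * emeasure lborel ?B \<partial>lborel)"
  proof -
    have "emeasure (distr lborel borel f) A = (\<integral>\<^sup>+x. indicator A (f x) \<partial>lborel)"
      by (subst nn_integral_indicator[symmetric], simp, subst nn_integral_distr) auto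
    then show ?thesis by (simp add: nn_integral_multc)
  qed
  also have "\<dots> = (\<integral>\<^sup>+x. (\<integral>\<^sup>+y. ?h x y \<partial>lborel) \<partial>lborel)"
  proof (rule nn_integral_cong)
    fix x
    have "(\<integral>\<^sup>+y. indicator ?B (y - f x) \<partial>lborel) = (\<integral>\<^sup>+y. indicator ?B (- f x + y) \<partial>lborel)"
      by simp
    also have "\<dots> = emeasure lborel ?B"
      by (subst nn_integral_lborel_translate) (auto intro!: borel_measurable_indicator)
    finally have eq: "(\<integral>\<^sup>+y. indicator ?B (y - f x) \<partial>lborel) = emeasure lborel ?B" .
    have "(\<integral>\<^sup>+y. ?h x y \<partial>lborel) =
        indicator A (f x) * (\<integral>\<^sup>+y. indicator ?B (y - f x) \<partial>lborel)"
      by (rule nn_integral_cmult) measurable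
    then show "indicator A (f x) * emeasure lborel ?B = (\<integral>\<^sup>+y. ?h x y \<partial>lborel)"
      by (simp only: eq)
  qed
  also have "\<dots> = (\<integral>\<^sup>+y. (\<integral>\<^sup>+x. ?h x y \<partial>lborel) \<partial>lborel)"
    by (rule lborel_pair.Fubini') measurable
  also have "\<dots> = (\<integral>\<^sup>+y. (\<integral>\<^sup>+x. indicator A (y + f x) * indicator ?B x \<partial>lborel) \<partial>lborel)"
  proof (rule nn_integral_cong)
    fix y
    have "(\<integral>\<^sup>+x. ?h x y \<partial>lborel) = (\<integral>\<^sup>+x. ?h (g y + x) y \<partial>lborel)"
      by (rule nn_integral_lborel_translate[symmetric]) measurable
    then show "(\<integral>\<^sup>+x. ?h x y \<partial>lborel) =
               (\<integral>\<^sup>+x. indicator A (y + f x) * indicator ?B x \<partial>lborel)"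
      by (simp add: linear_add[OF lin] g indicator_def iso)
  qed
  also have "\<dots> = (\<integral>\<^sup>+x. (\<integral>\<^sup>+y. indicator A (y + f x) * indicator ?B x \<partial>lborel) \<partial>lborel)"
    by (rule lborel_pair.Fubini'[symmetric]) measurable
  also have "\<dots> = (\<integral>\<^sup>+x. emeasure lborel A * indicator ?B x \<partial>lborel)"
  proof (rule nn_integral_cong)
    fix x
    have "(\<integral>\<^sup>+y. indicator A (y + f x) \<partial>lborel) = (\<integral>\<^sup>+y. indicator A (f x + y) \<partial>lborel)"
      by (simp add: add.commute)
    also have "\<dots> = emeasure lborel A"
      by (subst nn_integral_lborel_translate) auto
    finally show "(\<integral>\<^sup>+y. indicator A (y + f x) * indicator ?B x \<partial>lborel) =
         emeasure lborel A * indicator ?B x"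
      by (simp add: nn_integral_multc)
  qed
  also have "\<dots> = emeasure lborel A * emeasure lborel ?B"
    by (simp add: nn_integral_cmult)
  finally have eq: "emeasure (distr lborel borel f) A * emeasure lborel ?B = emeasure lborel A * emeasure lborel ?B" .
  have "emeasure lborel ?B = ennreal (unit_ball_vol DIM('a))"
    by (subst emeasure_cball) auto
  moreover have "unit_ball_vol (real DIM('a)) > 0" by simp
  ultimately have "emeasure lborel ?B \<noteq> 0" "emeasure lborel ?B \<noteq> \<infinity>"
    by (simp_all del: unit_ball_vol_pos)
  with eq show "emeasure (distr lborel borel f) A = emeasure lborel A"
    by (metis ennreal_mult_cancel_left infinity_ennreal_def mult.commute)
qed simp

lemma nn_integral_lborel_scale:
  fixes h :: "'a::euclidean_space \<Rightarrow> ennreal"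
  assumes [measurable]: "h \<in> borel_measurable borel" and "c > 0"
  shows "(\<integral>\<^sup>+x. h x \<partial>lborel) = ennreal (c ^ DIM('a)) * (\<integral>\<^sup>+x. h (c *\<^sub>R x) \<partial>lborel)"
  using assms(2)
  by (subst lborel_affine[of c 0])
     (simp_all add: nn_integral_density nn_integral_distr nn_integral_cmult)

lemma integral_lborel_scale:
  fixes h :: "'a::euclidean_space \<Rightarrow> 'b::{banach, second_countable_topology}"
  assumes [measurable]: "h \<in> borel_measurable borel" and "c > 0"
  shows "(\<integral>x. h x \<partial>lborel) = (c ^ DIM('a)) *\<^sub>R (\<integral>x. h (c *\<^sub>R x) \<partial>lborel)"
  using assms(2)
  by (subst lborel_affine[of c 0])
     (simp_all add: integral_density integral_distr)

lemma nn_integral_power_tail: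
  assumes "a > 0" "n > 0"
  shows "(\<integral>\<^sup>+x. ennreal (inverse (x ^ Suc n)) * indicator {a..} x \<partial>lborel) = ennreal (inverse (real n * a ^ n))"
proof -
  have "(\<integral>\<^sup>+x. ennreal (inverse (x ^ Suc n)) * indicator {a..} x \<partial>lborel) =
        ennreal (0 - (- inverse (real n * a ^ n)))"
  proof (rule nn_integral_FTC_atLeast)
    show "DERIV (\<lambda>x. - inverse (real n * x ^ n)) x :> inverse (x ^ Suc n)" if "a \<le> x" for x
    proof -
      from that assms have "x > 0" by simp
      have "DERIV (\<lambda>x. inverse (x ^ n)) x :> - (inverse (x ^ n) * (real n * x ^ (n - 1)) * inverse (x ^ n))"
        using \<open>x > 0\<close> by (auto intro!: derivative_eq_intros)
      then have "DERIV (\<lambda>x. - inverse (real n) * inverse (x ^ n)) x :>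
           - inverse (real n) * (- (inverse (x ^ n) * (real n * x ^ (n - 1)) * inverse (x ^ n)))"
        by (rule DERIV_cmult)
      also have "- inverse (real n) * (- (inverse (x ^ n) * (real n * x ^ (n - 1)) * inverse (x ^ n))) =
           inverse (x ^ Suc n)"
        using assms(2) \<open>x > 0\<close> by (cases n) (simp_all add: divide_simps)
      finally show ?thesis by simp
    qed
    show "((\<lambda>x. - inverse (real n * x ^ n)) \<longlongrightarrow> 0) at_top"
      using assms(2) by real_asymp
  qed (use assms in auto)
  then show ?thesis by simp
qed

text \<open>
  Polar coordinates with the sphere parametrised by the directions of the points of the unit ball.
  Substituting \<open>r = norm u * \<rho>\<close> and then \<open>v = \<rho> u\<close> leaves for each \<open>v\<close> the
  elementary integral of \<open>\<rho> powr (- DIM - 1)\<close> over \<open>\<rho> > norm v\<close>.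
\<close>
lemma nn_integral_polar:
  fixes G :: "'a::euclidean_space \<Rightarrow> ennreal"
  assumes [measurable]: "G \<in> borel_measurable borel"
  shows "(\<integral>\<^sup>+x. G x \<partial>lborel) =
    of_nat DIM('a) * (\<integral>\<^sup>+r. ennreal (r ^ (DIM('a) - 1)) * indicator {0<..} r *
        (\<integral>\<^sup>+u. indicator (ball 0 1) u * G ((r / norm u) *\<^sub>R u) \<partial>lborel) \<partial>lborel)"
proof -
  let ?n = "DIM('a)"
  obtain k where k: "?n = Suc k" using DIM_positive[where 'a='a] gr0_conv_Suc by blast
  let ?B = "ball (0::'a) 1"
  let ?P = "\<lambda>r. ennreal (r ^ k) * indicator {0<..} r"
  let ?Q = "\<lambda>v::'a. ennreal (norm v ^ ?n)"
  let ?tail = "\<lambda>\<rho> v. ennreal (inverse (\<rho> ^ Suc ?n)) * indicator {0<..} (\<rho> - norm (v::'a))"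
  have [measurable]: "?B \<in> sets borel" by simp
  have "(\<integral>\<^sup>+r. ?P r * (\<integral>\<^sup>+u. indicator ?B u * G ((r / norm u) *\<^sub>R u) \<partial>lborel) \<partial>lborel) =
     (\<integral>\<^sup>+r. (\<integral>\<^sup>+u. ?P r * (indicator ?B u * G ((r / norm u) *\<^sub>R u)) \<partial>lborel) \<partial>lborel)"
    by (intro nn_integral_cong nn_integral_cmult[symmetric]) measurable
  also have "\<dots> = (\<integral>\<^sup>+u. (\<integral>\<^sup>+r. ?P r * (indicator ?B u * G ((r / norm u) *\<^sub>R u)) \<partial>lborel) \<partial>lborel)"
    by (rule lborel_pair.Fubini') measurable
  \<comment> \<open>Substitute \<open>r = norm u * \<rho>\<close> for fixed \<open>u\<close>.\<close>
  also have "\<dots> = (\<integral>\<^sup>+u. (\<integral>\<^sup>+\<rho>. ?Q u * (?P \<rho> * (indicator ?B u * G (\<rho> *\<^sub>R u))) \<partial>lborel) \<partial>lborel)"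
  proof (rule nn_integral_cong_AE)
    \<comment> \<open>The direction of \<open>0\<close> is undefined.\<close>
    have "AE u in lborel. (u::'a) \<noteq> 0" by (rule AE_lborel_singleton)
    then show "AE u in lborel. (\<integral>\<^sup>+r. ?P r * (indicator ?B u * G ((r / norm u) *\<^sub>R u)) \<partial>lborel) =
       (\<integral>\<^sup>+\<rho>. ?Q u * (?P \<rho> * (indicator ?B u * G (\<rho> *\<^sub>R u))) \<partial>lborel)"
    proof eventually_elim
      case (elim u)
      let ?r = "\<lambda>\<rho>. 0 + norm u * \<rho>"
      have "(\<integral>\<^sup>+r. ?P r * (indicator ?B u * G ((r / norm u) *\<^sub>R u)) \<partial>lborel) =
        ennreal \<bar>norm u\<bar> * (\<integral>\<^sup>+\<rho>. ?P (?r \<rho>) * (indicator ?B u * G ((?r \<rho> / norm u) *\<^sub>R u)) \<partial>lborel)"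
        using elim by (intro nn_integral_real_affine) auto
      also have "\<dots> = (\<integral>\<^sup>+\<rho>. ennreal \<bar>norm u\<bar> * (?P (?r \<rho>) * (indicator ?B u * G ((?r \<rho> / norm u) *\<^sub>R u))) \<partial>lborel)"
        by (rule nn_integral_cmult[symmetric]) measurable
      also have "\<dots> = (\<integral>\<^sup>+\<rho>. ?Q u * (?P \<rho> * (indicator ?B u * G (\<rho> *\<^sub>R u))) \<partial>lborel)"
        using elim
        by (intro nn_integral_cong)
           (auto simp: k power_mult_distrib ennreal_mult' mult_ac zero_less_mult_iff
                 split: split_indicator)
      finally show ?case .
    qed
  qed
  also have "\<dots> = (\<integral>\<^sup>+\<rho>. (\<integral>\<^sup>+u. ?Q u * (?P \<rho> * (indicator ?B u * G (\<rho> *\<^sub>R u))) \<partial>lborel) \<partial>lborel)"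
    by (rule lborel_pair.Fubini') measurable
  \<comment> \<open>Substitute \<open>v = \<rho> u\<close> for fixed \<open>\<rho>\<close>; the condition \<open>norm u < 1\<close> becomes \<open>norm v < \<rho>\<close>.\<close>
  also have "\<dots> = (\<integral>\<^sup>+\<rho>. (\<integral>\<^sup>+v. ?Q v * G v * ?tail \<rho> v \<partial>lborel) \<partial>lborel)"
  proof (rule nn_integral_cong)
    fix \<rho> :: real
    show "(\<integral>\<^sup>+u. ?Q u * (?P \<rho> * (indicator ?B u * G (\<rho> *\<^sub>R u))) \<partial>lborel) =
       (\<integral>\<^sup>+v. ?Q v * G v * ?tail \<rho> v \<partial>lborel)"
    proof (cases "\<rho> > 0")
      case True
      have "(\<integral>\<^sup>+v. ?Q v * G v * ?tail \<rho> v \<partial>lborel) =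
        ennreal (\<rho> ^ ?n) * (\<integral>\<^sup>+v. ?Q (\<rho> *\<^sub>R v) * G (\<rho> *\<^sub>R v) * ?tail \<rho> (\<rho> *\<^sub>R v) \<partial>lborel)"
        using True by (intro nn_integral_lborel_scale) measurable
      also have "\<dots> = (\<integral>\<^sup>+v. ennreal (\<rho> ^ ?n) * (?Q (\<rho> *\<^sub>R v) * G (\<rho> *\<^sub>R v) * ?tail \<rho> (\<rho> *\<^sub>R v)) \<partial>lborel)"
        by (rule nn_integral_cmult[symmetric]) measurable
      also have "\<dots> = (\<integral>\<^sup>+u. ?Q u * (?P \<rho> * (indicator ?B u * G (\<rho> *\<^sub>R u))) \<partial>lborel)"
      proof (rule nn_integral_cong)
        fix u :: 'a
        have ind: "indicator {0<..} (\<rho> - norm (\<rho> *\<^sub>R u)) = (indicator ?B u :: ennreal)"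
          using True by (auto simp: indicator_def)
        have "ennreal (\<rho> ^ ?n) * (?Q (\<rho> *\<^sub>R u) * ennreal (inverse (\<rho> ^ Suc ?n))) = ?Q u * ennreal (\<rho> ^ k)"
          using True
          by (simp add: ennreal_mult'[symmetric] ennreal_mult[symmetric] k power_mult_distrib field_simps)
        then have "ennreal (\<rho> ^ ?n) * (?Q (\<rho> *\<^sub>R u) * ennreal (inverse (\<rho> ^ Suc ?n))) * (G (\<rho> *\<^sub>R u) * indicator ?B u) =
              ?Q u * ennreal (\<rho> ^ k) * (G (\<rho> *\<^sub>R u) * indicator ?B u)"
          by simp
        then show "ennreal (\<rho> ^ ?n) * (?Q (\<rho> *\<^sub>R u) * G (\<rho> *\<^sub>R u) * ?tail \<rho> (\<rho> *\<^sub>R u)) =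
            ?Q u * (?P \<rho> * (indicator ?B u * G (\<rho> *\<^sub>R u)))"
          unfolding ind using True by (simp add: mult_ac)
      qed
      finally show ?thesis ..
    next
      case False
      then have "indicator {0<..} (\<rho> - norm v) = (0::ennreal)" for v :: 'a
        using norm_ge_zero[of v] by (auto simp: indicator_def simp del: norm_ge_zero)
      with False show ?thesis by simp
    qed
  qed
  also have "\<dots> = (\<integral>\<^sup>+v. (\<integral>\<^sup>+\<rho>. ?Q v * G v * ?tail \<rho> v \<partial>lborel) \<partial>lborel)"
    by (rule lborel_pair.Fubini') measurable
  also have "\<dots> = (\<integral>\<^sup>+v. G v * ennreal (inverse (real ?n)) \<partial>lborel)"
  proof (rule nn_integral_cong_AE)
    have "AE u in lborel. (u::'a) \<noteq> 0" by (rule AE_lborel_singleton)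
    then show "AE v in lborel. (\<integral>\<^sup>+\<rho>. ?Q v * G v * ?tail \<rho> v \<partial>lborel) = G v * ennreal (inverse (real ?n))"
    proof eventually_elim
      case (elim v)
      have "(\<integral>\<^sup>+\<rho>. ?Q v * G v * ?tail \<rho> v \<partial>lborel) = ?Q v * G v * (\<integral>\<^sup>+\<rho>. ?tail \<rho> v \<partial>lborel)"
        by (rule nn_integral_cmult) measurable
      also have "(\<integral>\<^sup>+\<rho>. ?tail \<rho> v \<partial>lborel) =
        (\<integral>\<^sup>+\<rho>. (ennreal (inverse (\<rho> ^ Suc ?n)) * indicator {norm v..} \<rho>) \<partial>lborel)"
      proof (rule nn_integral_cong_AE)
        have "AE \<rho> in lborel. \<rho> \<noteq> norm v" by (rule AE_lborel_singleton)
        then show "AE \<rho> in lborel. ?tail \<rho> v = ennreal (inverse (\<rho> ^ Suc ?n)) * indicator {norm v..} \<rho>"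
          by eventually_elim (auto simp: indicator_def)
      qed
      also have "\<dots> = ennreal (inverse (real ?n * norm v ^ ?n))"
        using elim by (intro nn_integral_power_tail) auto
      also have "?Q v * G v * \<dots> = G v * (?Q v * ennreal (inverse (real ?n * norm v ^ ?n)))"
        by (simp add: mult_ac)
      also have "?Q v * ennreal (inverse (real ?n * norm v ^ ?n)) = ennreal (inverse (real ?n))"
        using elim by (simp add: ennreal_mult[symmetric])
      finally show ?case .
    qed
  qed
  also have "\<dots> = (\<integral>\<^sup>+v. G v \<partial>lborel) * ennreal (inverse (real ?n))"
    by (rule nn_integral_multc) measurable
  finally have "(\<integral>\<^sup>+r. ?P r * (\<integral>\<^sup>+u. indicator ?B u * G ((r / norm u) *\<^sub>R u) \<partial>lborel) \<partial>lborel) =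
      (\<integral>\<^sup>+v. G v \<partial>lborel) * ennreal (inverse (real ?n))" .
  moreover have "of_nat ?n * ((\<integral>\<^sup>+v. G v \<partial>lborel) * ennreal (inverse (real ?n))) = (\<integral>\<^sup>+v. G v \<partial>lborel)"
  proof -
    have "of_nat ?n * ennreal (inverse (real ?n)) = 1"
      by (simp add: ennreal_of_nat_eq_real_of_nat ennreal_mult[symmetric])
    then have "(\<integral>\<^sup>+v. G v \<partial>lborel) * (of_nat ?n * ennreal (inverse (real ?n))) = (\<integral>\<^sup>+v. G v \<partial>lborel)"
      by simp
    then show ?thesis by (simp add: mult_ac)
  qed
  ultimately show ?thesis by (simp add: k)
qed

lemma nn_integral_radial:
  fixes g :: "real \<Rightarrow> ennreal"
  assumes [measurable]: "g \<in> borel_measurable borel"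
  shows "(\<integral>\<^sup>+x. g (norm (x::'a::euclidean_space)) \<partial>lborel) =
    ennreal (DIM('a) * unit_ball_vol DIM('a)) *
      (\<integral>\<^sup>+r. ennreal (r ^ (DIM('a) - 1)) * indicator {0<..} r * g r \<partial>lborel)"
proof -
  have "(\<integral>\<^sup>+r. ennreal (r ^ (DIM('a) - 1)) * indicator {0<..} r *
        (\<integral>\<^sup>+u. indicator (ball (0::'a) 1) u * g (norm ((r / norm u) *\<^sub>R u)) \<partial>lborel) \<partial>lborel) =
     (\<integral>\<^sup>+r. ennreal (unit_ball_vol DIM('a)) * (ennreal (r ^ (DIM('a) - 1)) * indicator {0<..} r * g r) \<partial>lborel)"
  proof (rule nn_integral_cong)
    fix r :: real
    show "ennreal (r ^ (DIM('a) - 1)) * indicator {0<..} r *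
        (\<integral>\<^sup>+u. indicator (ball (0::'a) 1) u * g (norm ((r / norm u) *\<^sub>R u)) \<partial>lborel) =
      ennreal (unit_ball_vol DIM('a)) * (ennreal (r ^ (DIM('a) - 1)) * indicator {0<..} r * g r)"
    proof (cases "r > 0")
      case True
      have "(\<integral>\<^sup>+u. indicator (ball (0::'a) 1) u * g (norm ((r / norm u) *\<^sub>R u)) \<partial>lborel) =
        (\<integral>\<^sup>+u. indicator (ball (0::'a) 1) u * g r \<partial>lborel)"
      proof (rule nn_integral_cong_AE)
        have "AE u in lborel. (u::'a) \<noteq> 0" by (rule AE_lborel_singleton)
        then show "AE u in lborel. indicator (ball (0::'a) 1) u * g (norm ((r / norm u) *\<^sub>R u)) =
             indicator (ball (0::'a) 1) u * g r"
          by eventually_elim (use True in auto)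
      qed
      also have "\<dots> = ennreal (unit_ball_vol DIM('a)) * g r"
        by (subst nn_integral_multc) (auto simp: emeasure_ball intro!: borel_measurable_indicator)
      finally show ?thesis by (simp add: mult_ac)
    qed auto
  qed
  also have "\<dots> = ennreal (unit_ball_vol DIM('a)) *
     (\<integral>\<^sup>+r. (ennreal (r ^ (DIM('a) - 1)) * indicator {0<..} r * g r) \<partial>lborel)"
    by (rule nn_integral_cmult) measurable
  finally show ?thesis
    by (subst nn_integral_polar) (auto simp: ennreal_mult' ennreal_of_nat_eq_real_of_nat mult_ac)
qed

text \<open>
  The substitution \<open>y = r\<^sup>2 / R\<^sup>2\<close>. It serves the radial integrals over the ball and, with \<open>q = 1\<close> and
  large \<open>R\<close>, the passage from the interval to the half line.
\<close>
lemma nn_integral_jacobi_radial: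
  fixes h :: "real \<Rightarrow> ennreal"
  assumes [measurable]: "h \<in> borel_measurable borel" and R: "R > 0"
  shows "(\<integral>\<^sup>+r. h (r\<^sup>2 / R\<^sup>2) * ennreal (indicator {0<..<R} r * (r powr (2 * p - 1) * (1 - r\<^sup>2 / R\<^sup>2) powr (q - 1))) \<partial>lborel)
    = ennreal (R powr (2 * p) / 2) * (\<integral>\<^sup>+y. h y * ennreal (jacobi_weight p q y) \<partial>lborel)"
proof -
  let ?f = "\<lambda>y. h y * ennreal (jacobi_weight p q y)"
  let ?g = "\<lambda>r. r\<^sup>2 / R\<^sup>2"
  have "(\<integral>\<^sup>+y. ?f y \<partial>lborel) = (\<integral>\<^sup>+y. ?f y * indicator {?g 0..?g R} y \<partial>lborel)"
    using R by (intro nn_integral_cong) (auto simp: jacobi_weight_def indicator_def)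
  also have "\<dots> = (\<integral>\<^sup>+r. ?f (?g r) * ennreal (2 * r / R\<^sup>2) * indicator {0..R} r \<partial>lborel)"
    using R
    by (intro nn_integral_substitution_aux) (auto intro!: derivative_eq_intros continuous_intros simp: power4_eq_xxxx power2_eq_square)
  finally have "ennreal (R powr (2 * p) / 2) * (\<integral>\<^sup>+y. ?f y \<partial>lborel) =
     (\<integral>\<^sup>+r. ennreal (R powr (2 * p) / 2) * (?f (?g r) * ennreal (2 * r / R\<^sup>2) * indicator {0..R} r) \<partial>lborel)"
    by (simp add: nn_integral_cmult)
  also have "\<dots> = (\<integral>\<^sup>+r. h (r\<^sup>2 / R\<^sup>2) * ennreal (indicator {0<..<R} r * (r powr (2 * p - 1) * (1 - r\<^sup>2 / R\<^sup>2) powr (q - 1))) \<partial>lborel)"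
  proof (rule nn_integral_cong)
    fix r :: real
    have iff: "r\<^sup>2 / R\<^sup>2 < 1 \<longleftrightarrow> r < R" if "r > 0"
      using that R by (simp add: divide_less_eq)
        (metis less_imp_le power2_less_imp_less power_strict_mono zero_less_numeral)
    show "ennreal (R powr (2 * p) / 2) * (?f (?g r) * ennreal (2 * r / R\<^sup>2) * indicator {0..R} r) =
       h (r\<^sup>2 / R\<^sup>2) * ennreal (indicator {0<..<R} r * (r powr (2 * p - 1) * (1 - r\<^sup>2 / R\<^sup>2) powr (q - 1)))"
    proof (cases "0 < r \<and> r < R")
      case True
      have e: "(r\<^sup>2 / R\<^sup>2) powr (p - 1) = r powr (2 * p - 2) / R powr (2 * p - 2)"
        using True by (simp add: powr_divide powr_power powr_mult_base power2_eq_square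
           powr_mult powr_add[symmetric])
      have e2: "r powr (2 * p - 2) * r = r powr (2 * p - 1)"
        using True powr_add[of r "2 * p - 2" 1] by simp
      have e3: "R powr (2 * p - 2) * R\<^sup>2 = R powr (2 * p)"
        using True powr_add[of R "2 * p - 2" 2] by simp
      have "R powr (2 * p) / 2 * (jacobi_weight p q (r\<^sup>2 / R\<^sup>2) * (2 * r / R\<^sup>2)) =
         (r powr (2 * p - 1) * (1 - r\<^sup>2 / R\<^sup>2) powr (q - 1))"
      proof -
        have "R powr (2 * p) / 2 * (jacobi_weight p q (r\<^sup>2 / R\<^sup>2) * (2 * r / R\<^sup>2)) =
           R powr (2 * p) / (R powr (2 * p - 2) * R\<^sup>2) * ((r powr (2 * p - 2) * r) * (1 - r\<^sup>2 / R\<^sup>2) powr (q - 1))"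
          using True iff unfolding jacobi_weight_def e by simp
        then show ?thesis unfolding e2 e3 using R by simp
      qed
      then have "ennreal (R powr (2 * p) / 2) * (ennreal (jacobi_weight p q (r\<^sup>2 / R\<^sup>2)) * ennreal (2 * r / R\<^sup>2)) =
        ennreal (r powr (2 * p - 1) * (1 - r\<^sup>2 / R\<^sup>2) powr (q - 1))"
        using True by (simp add: ennreal_mult[symmetric] jacobi_weight_nonneg)
      then have "h (r\<^sup>2 / R\<^sup>2) * (ennreal (R powr (2 * p) / 2) * (ennreal (jacobi_weight p q (r\<^sup>2 / R\<^sup>2)) * ennreal (2 * r / R\<^sup>2))) =
        h (r\<^sup>2 / R\<^sup>2) * ennreal (r powr (2 * p - 1) * (1 - r\<^sup>2 / R\<^sup>2) powr (q - 1))"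
        by (rule arg_cong)
      then show ?thesis using True by (simp add: mult_ac)
    next
      case False
      then have "r \<le> 0 \<or> r \<ge> R" by auto
      then show ?thesis
      proof
        assume "r \<le> 0" then show ?thesis using R by (cases "r = 0") (auto simp: jacobi_weight_def)
      next
        assume "r \<ge> R"
        then have "\<not> r\<^sup>2 / R\<^sup>2 < 1" using iff R by simp
        with \<open>r \<ge> R\<close> show ?thesis by (simp add: jacobi_weight_def)
      qed
    qed
  qed
  finally show ?thesis ..
qed

lemma nn_integral_jacobi_weight:
  assumes "p > 0" "q > 0"
  shows "(\<integral>\<^sup>+y. ennreal (jacobi_weight p q y) \<partial>lborel) = ennreal (Beta p q)"
  using jacobi_moment[OF assms, of 0] jacobi_weight_nonneg
  by (simp add: has_bochner_integral_iff nn_integral_eq_integral)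

definition ball_weight :: "real \<Rightarrow> 'a::real_normed_vector \<Rightarrow> real"
  where "ball_weight a x = indicator (ball 0 1) x * (1 - (norm x)\<^sup>2) powr a"

text \<open>
  The total mass of \<open>ball_weight a\<close> in dimension \<open>d\<close>.
\<close>
definition ball_mass :: "real \<Rightarrow> real \<Rightarrow> real"
  where "ball_mass d a = pi powr (d / 2) * Gamma (a + 1) / Gamma (a + 1 + d / 2)"

lemma ball_weight_nonneg: "ball_weight a x \<ge> 0"
  by (simp add: ball_weight_def)

lemma ball_mass_pos: "d \<ge> 0 \<Longrightarrow> a > -1 \<Longrightarrow> ball_mass d a > 0"
  unfolding ball_mass_def by (intro divide_pos_pos mult_pos_pos Gamma_real_pos) auto

lemma ball_weight_measurable [measurable]:
  "ball_weight a \<in> borel_measurable (borel :: 'a::euclidean_space measure)"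
proof -
  have [measurable]: "ball (0::'a) 1 \<in> sets borel" by simp
  show ?thesis unfolding ball_weight_def[abs_def] by measurable
qed

lemma nn_integral_ball_weight:
  assumes "a > -1"
  shows "(\<integral>\<^sup>+x. ennreal (ball_weight a (x::'a::euclidean_space)) \<partial>lborel) = ennreal (ball_mass DIM('a) a)"
proof -
  let ?n = "real DIM('a)"
  have n: "?n > 0" by simp
  define g :: "real \<Rightarrow> ennreal" where "g r = ennreal (indicator {..<1} r * (1 - r\<^sup>2) powr a)" for r
  have [measurable]: "g \<in> borel_measurable borel" unfolding g_def[abs_def] by measurable
  have "(\<integral>\<^sup>+x. ennreal (ball_weight a (x::'a)) \<partial>lborel) = (\<integral>\<^sup>+x. g (norm (x::'a)) \<partial>lborel)"
    by (intro nn_integral_cong) (auto simp: ball_weight_def g_def indicator_def)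
  also have "\<dots> = ennreal (?n * unit_ball_vol ?n) *
      (\<integral>\<^sup>+r. ennreal (r ^ (DIM('a) - 1)) * indicator {0<..} r * g r \<partial>lborel)"
    by (rule nn_integral_radial) measurable
  also have "(\<integral>\<^sup>+r. ennreal (r ^ (DIM('a) - 1)) * indicator {0<..} r * g r \<partial>lborel) =
     (\<integral>\<^sup>+r. 1 * ennreal (indicator {0<..<1} r * (r powr (2 * (?n / 2) - 1) * (1 - r\<^sup>2 / 1\<^sup>2) powr (a + 1 - 1))) \<partial>lborel)"
  proof (rule nn_integral_cong)
    fix r :: real
    have "r ^ (DIM('a) - 1) = r powr (?n - 1)" if "r > 0"
      using that powr_realpow[of r "DIM('a) - 1"] DIM_positive[where 'a='a]
      by (simp add: of_nat_diff Suc_le_eq)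
    then show "ennreal (r ^ (DIM('a) - 1)) * indicator {0<..} r * g r =
       1 * ennreal (indicator {0<..<1} r * (r powr (2 * (?n / 2) - 1) * (1 - r\<^sup>2 / 1\<^sup>2) powr (a + 1 - 1)))"
      by (auto simp: g_def indicator_def ennreal_mult)
  qed
  also have "\<dots> = ennreal (1 powr (2 * (?n / 2)) / 2) * (\<integral>\<^sup>+y. 1 * ennreal (jacobi_weight (?n / 2) (a + 1) y) \<partial>lborel)"
    by (rule nn_integral_jacobi_radial) auto
  also have "\<dots> = ennreal (Beta (?n / 2) (a + 1) / 2)"
  proof -
    have "(\<integral>\<^sup>+y. 1 * ennreal (jacobi_weight (?n / 2) (a + 1) y) \<partial>lborel) = ennreal (Beta (?n / 2) (a + 1))"
      using nn_integral_jacobi_weight[of "?n / 2" "a + 1"] assms n by simp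
    then show ?thesis by (simp only:) (subst ennreal_mult'[symmetric], auto)
  qed
  also have "ennreal (?n * unit_ball_vol ?n) * \<dots> = ennreal (?n * unit_ball_vol ?n * (Beta (?n / 2) (a + 1) / 2))"
    by (simp add: ennreal_mult'[symmetric])
  also have "?n * unit_ball_vol ?n * (Beta (?n / 2) (a + 1) / 2) = ball_mass ?n a"
  proof -
    have "Gamma (?n / 2) > 0" using n by (intro Gamma_real_pos) simp
    moreover have g: "Gamma (?n / 2 + 1) = ?n / 2 * Gamma (?n / 2)"
      using n by (intro Gamma_real_plus1) simp
    ultimately show ?thesis using n less_imp_neq[of 0 "Gamma (?n / 2)"]
      unfolding ball_mass_def unit_ball_vol_def Beta_def g by (simp add: add_ac)
  qed
  finally show ?thesis .
qed

section \<open>Slices of the weighted ball\<close>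

lemma nn_integral_isometry:
  fixes f :: "'a::euclidean_space \<Rightarrow> 'a" and h :: "'a \<Rightarrow> ennreal"
  assumes "linear f" "\<And>x. norm (f x) = norm x" and [measurable]: "h \<in> borel_measurable borel"
  shows "(\<integral>\<^sup>+x. h (f x) \<partial>lborel) = (\<integral>\<^sup>+x. h x \<partial>lborel)"
proof -
  have [measurable]: "f \<in> borel_measurable borel"
    using assms(1) by (intro borel_measurable_continuous_onI linear_continuous_on)
                 (simp add: linear_conv_bounded_linear)
  have "(\<integral>\<^sup>+x. h x \<partial>lborel) = (\<integral>\<^sup>+x. h x \<partial>distr lborel borel f)"
    by (simp only: lborel_distr_isometry[OF assms(1,2)])
  then show ?thesis by (simp add: nn_integral_distr)
qed

lemma has_bochner_integral_isometry:
  fixes f :: "'a::euclidean_space \<Rightarrow> 'a" and h :: "'a \<Rightarrow> complex"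
  assumes "linear f" "\<And>x. norm (f x) = norm x" and [measurable]: "h \<in> borel_measurable borel"
    and "has_bochner_integral lborel (\<lambda>x. h (f x)) c"
  shows "has_bochner_integral lborel h c"
proof -
  have [measurable]: "f \<in> borel_measurable borel"
    using assms(1) by (intro borel_measurable_continuous_onI linear_continuous_on)
                 (simp add: linear_conv_bounded_linear)
  have "has_bochner_integral (distr lborel borel f) h c"
    using assms(4) by (simp add: has_bochner_integral_iff integrable_distr_eq integral_distr)
  then show ?thesis
    by (simp only: lborel_distr_isometry[OF assms(1,2)])
qed

lemma householder_reflection:
  fixes e X :: "'a::real_inner"
  assumes "norm e = 1" "norm X = 1"
  obtains R :: "'a \<Rightarrow> 'a" where "linear R" "\<And>Y. norm (R Y) = norm Y" "R e = X"
    "\<And>Y Z. R Y \<bullet> R Z = Y \<bullet> Z"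
proof
  define v where "v = e - X"
  \<comment> \<open>For \<open>v = 0\<close> division by zero makes \<open>R\<close> the identity.\<close>
  define R where "R Y = Y - (2 * (Y \<bullet> v) / (v \<bullet> v)) *\<^sub>R v" for Y
  show "linear R"
    unfolding R_def
    by (intro linearI)
       (simp_all add: inner_add_left distrib_left add_divide_distrib scaleR_left_distrib scaleR_right_diff_distrib)
  show inn: "R Y \<bullet> R Z = Y \<bullet> Z" for Y Z
  proof (cases "v = 0")
    case False
    then have k: "v \<bullet> v \<noteq> 0" by simp
    have "R Y \<bullet> R Z = Y \<bullet> Z - 2 * (Z \<bullet> v) / (v \<bullet> v) * (Y \<bullet> v)
        - 2 * (Y \<bullet> v) / (v \<bullet> v) * (v \<bullet> Z)
        + 2 * (Y \<bullet> v) / (v \<bullet> v) * (2 * (Z \<bullet> v) / (v \<bullet> v)) * (v \<bullet> v)"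
      by (simp add: R_def inner_diff_left inner_diff_right)
    also have "\<dots> = Y \<bullet> Z"
      unfolding inner_commute[of v Z] using k by simp
    finally show ?thesis .
  qed (simp add: R_def)
  then show "norm (R Y) = norm Y" for Y by (simp add: norm_eq_sqrt_inner)
  have ee: "e \<bullet> e = 1" "X \<bullet> X = 1" using assms by (simp_all add: dot_square_norm)
  have vv: "v \<bullet> v = 2 * (e \<bullet> v)"
    using ee by (simp add: v_def inner_simps inner_commute)
  show "R e = X"
  proof (cases "v = 0")
    case True
    then show ?thesis by (simp add: R_def v_def)
  next
    case False
    then have "2 * (e \<bullet> v) / (v \<bullet> v) = 1" by (simp add: vv[symmetric])
    then have "R e = e - 1 *\<^sub>R v" by (simp only: R_def)
    then show ?thesis by (simp add: v_def)
  qed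
qed

lemma ball_weight_slice:
  fixes s :: "'b::euclidean_space" and u :: "'a::euclidean_space"
  assumes "norm s < 1"
  shows "ball_weight a (s, sqrt (1 - (norm s)\<^sup>2) *\<^sub>R u) = (1 - (norm s)\<^sup>2) powr a * ball_weight a u"
proof -
  have pos: "1 - (norm s)\<^sup>2 > 0" using assms by (simp add: abs_square_less_1)
  have n: "(norm (s, sqrt (1 - (norm s)\<^sup>2) *\<^sub>R u))\<^sup>2 = (norm s)\<^sup>2 + (1 - (norm s)\<^sup>2) * (norm u)\<^sup>2"
    using pos by (simp add: norm_Pair power_mult_distrib)
  have e: "1 - (norm (s, sqrt (1 - (norm s)\<^sup>2) *\<^sub>R u))\<^sup>2 = (1 - (norm s)\<^sup>2) * (1 - (norm u)\<^sup>2)"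
    unfolding n by (simp add: algebra_simps)
  have i1: "x \<in> ball 0 1 \<longleftrightarrow> 1 - (norm x)\<^sup>2 > 0" for x :: "'c::real_normed_vector"
    by (simp add: abs_square_less_1)
  have "(s, sqrt (1 - (norm s)\<^sup>2) *\<^sub>R u) \<in> ball 0 1 \<longleftrightarrow> u \<in> ball 0 1"
    unfolding i1 e using pos by (simp add: zero_less_mult_iff)
  moreover have "((1 - (norm s)\<^sup>2) * (1 - (norm u)\<^sup>2)) powr a = (1 - (norm s)\<^sup>2) powr a * (1 - (norm u)\<^sup>2) powr a"
    if "u \<in> ball 0 1" using pos that i1[of u] by (intro powr_mult)
  ultimately show ?thesis
    unfolding ball_weight_def e by (auto simp: indicator_def)
qed

lemma ball_weight_slice_outside:
  fixes s :: "'b::euclidean_space" and z :: "'a::euclidean_space"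
  assumes "\<not> norm s < 1"
  shows "ball_weight a (s, z) = 0"
  using assms norm_fst_le[of s z] by (auto simp: ball_weight_def)

text \<open>
  The slice of the ball at height \<open>s\<close> is a ball of radius \<open>sqrt (1 - (norm s)\<^sup>2)\<close>, on which the weight is a
  rescaled copy of itself. Integrating it out therefore raises the exponent by half the dimension.
\<close>
lemma nn_integral_ball_weight_slice:
  fixes s :: "'b::euclidean_space"
  assumes "a > -1"
  shows "(\<integral>\<^sup>+z. ennreal (ball_weight a (s, z::'a::euclidean_space)) \<partial>lborel) =
     ennreal (ball_mass DIM('a) a * ball_weight (a + DIM('a) / 2) s)"
proof (cases "norm s < 1")
  case False
  then show ?thesis by (simp add: ball_weight_slice_outside) (simp add: ball_weight_def)
next
  case True
  define c where "c = sqrt (1 - (norm s)\<^sup>2)"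
  have pos: "1 - (norm s)\<^sup>2 > 0" using True by (simp add: abs_square_less_1)
  then have c: "c > 0" by (simp add: c_def)
  have "(\<integral>\<^sup>+z. ennreal (ball_weight a (s, z::'a::euclidean_space)) \<partial>lborel) =
     ennreal (c ^ DIM('a)) * (\<integral>\<^sup>+z. ennreal (ball_weight a (s, c *\<^sub>R z::'a::euclidean_space)) \<partial>lborel)"
    using c by (intro nn_integral_lborel_scale) measurable
  also have "\<dots> = ennreal (c ^ DIM('a)) * (\<integral>\<^sup>+z. ennreal ((1 - (norm s)\<^sup>2) powr a) * ennreal (ball_weight a (z::'a::euclidean_space)) \<partial>lborel)"
    unfolding c_def ball_weight_slice[OF True] by (simp add: ennreal_mult')
  also have "\<dots> = ennreal (c ^ DIM('a) * (1 - (norm s)\<^sup>2) powr a * ball_mass DIM('a) a)"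
    using c ball_mass_pos[of "DIM('a)", OF _ assms]
    by (subst nn_integral_cmult, measurable)
      (simp add: nn_integral_ball_weight[OF assms] ennreal_mult mult_ac)
  also have "c ^ DIM('a) * (1 - (norm s)\<^sup>2) powr a * ball_mass DIM('a) a = ball_mass DIM('a) a * ball_weight (a + DIM('a) / 2) s"
  proof -
    have "c ^ DIM('a) = (1 - (norm s)\<^sup>2) powr (DIM('a) / 2)"
      using pos c by (simp add: c_def powr_half_sqrt[symmetric] powr_realpow[symmetric] powr_powr)
    then show ?thesis using True by (simp add: ball_weight_def powr_add mult_ac)
  qed
  finally show ?thesis .
qed

lemma ball_weight_swap: "ball_weight a (x, y) = ball_weight a (y, x)"
  by (simp add: ball_weight_def indicator_def norm_Pair add.commute dist_norm)

lemma ball_weight_measurable_pair [measurable]: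
  "ball_weight a \<in> borel_measurable
     (borel \<Otimes>\<^sub>M borel :: ('a::euclidean_space \<times> 'b::euclidean_space) measure)"
  by (simp add: borel_prod)

lemma nn_integral_ball_weight_fst:
  fixes F :: "'b::euclidean_space \<Rightarrow> ennreal"
  assumes a: "a > -1" and [measurable]: "F \<in> borel_measurable borel"
  shows "(\<integral>\<^sup>+Y. F (fst Y) * ennreal (ball_weight a (Y :: 'b \<times> 'a::euclidean_space)) \<partial>lborel) =
     ennreal (ball_mass DIM('a) a) * (\<integral>\<^sup>+s. F s * ennreal (ball_weight (a + DIM('a) / 2) s) \<partial>lborel)"
proof -
  have "(\<integral>\<^sup>+Y. F (fst Y) * ennreal (ball_weight a (Y :: 'b \<times> 'a)) \<partial>lborel) =
     (\<integral>\<^sup>+Y. F (fst Y) * ennreal (ball_weight a (Y :: 'b \<times> 'a)) \<partial>(lborel \<Otimes>\<^sub>M lborel))"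
    by (simp only: lborel_prod)
  also have "\<dots> = (\<integral>\<^sup>+s. (\<integral>\<^sup>+z. F (fst (s, z)) * ennreal (ball_weight a (s, z::'a)) \<partial>lborel) \<partial>lborel)"
    by (rule lborel.nn_integral_fst[symmetric]) measurable
  also have "\<dots> = (\<integral>\<^sup>+s. ennreal (ball_mass DIM('a) a) * (F s * ennreal (ball_weight (a + DIM('a) / 2) s)) \<partial>lborel)"
  proof (rule nn_integral_cong)
    fix s :: 'b
    have "(\<integral>\<^sup>+z. F (fst (s, z)) * ennreal (ball_weight a (s, z::'a)) \<partial>lborel) =
       F s * (\<integral>\<^sup>+z. ennreal (ball_weight a (s, z::'a)) \<partial>lborel)"
      unfolding fst_conv by (rule nn_integral_cmult) measurable
    then show "(\<integral>\<^sup>+z. F (fst (s, z)) * ennreal (ball_weight a (s, z::'a)) \<partial>lborel) =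
       ennreal (ball_mass DIM('a) a) * (F s * ennreal (ball_weight (a + DIM('a) / 2) s))"
      unfolding nn_integral_ball_weight_slice[OF a]
      by (simp add: ennreal_mult'' ball_weight_nonneg mult_ac)
  qed
  also have "\<dots> = ennreal (ball_mass DIM('a) a) * (\<integral>\<^sup>+s. F s * ennreal (ball_weight (a + DIM('a) / 2) s) \<partial>lborel)"
    by (rule nn_integral_cmult) measurable
  finally show ?thesis .
qed

lemma nn_integral_ball_weight_snd:
  fixes F :: "'b::euclidean_space \<Rightarrow> ennreal"
  assumes a: "a > -1" and [measurable]: "F \<in> borel_measurable borel"
  shows "(\<integral>\<^sup>+Y. F (snd Y) * ennreal (ball_weight a (Y :: 'a::euclidean_space \<times> 'b)) \<partial>lborel) =
     ennreal (ball_mass DIM('a) a) * (\<integral>\<^sup>+s. F s * ennreal (ball_weight (a + DIM('a) / 2) s) \<partial>lborel)"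
proof -
  have "(\<integral>\<^sup>+Y. F (snd Y) * ennreal (ball_weight a (Y :: 'a \<times> 'b)) \<partial>lborel) =
     (\<integral>\<^sup>+Y. F (snd Y) * ennreal (ball_weight a (Y :: 'a \<times> 'b)) \<partial>(lborel \<Otimes>\<^sub>M lborel))"
    by (simp only: lborel_prod)
  also have "\<dots> = (\<integral>\<^sup>+s. (\<integral>\<^sup>+z. F (snd (s, z)) * ennreal (ball_weight a (s::'a, z)) \<partial>lborel) \<partial>lborel)"
    by (rule lborel.nn_integral_fst[symmetric]) measurable
  also have "\<dots> = (\<integral>\<^sup>+z. (\<integral>\<^sup>+s. F (snd (s, z)) * ennreal (ball_weight a (s::'a, z)) \<partial>lborel) \<partial>lborel)"
    by (rule lborel_pair.Fubini'[symmetric]) measurable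
  also have "\<dots> = (\<integral>\<^sup>+z. (\<integral>\<^sup>+s. F (fst (z, s)) * ennreal (ball_weight a (z, s::'a)) \<partial>lborel) \<partial>lborel)"
    unfolding fst_conv snd_conv
    by (intro nn_integral_cong arg_cong2[where f = "(*)"] arg_cong[where f = ennreal] ball_weight_swap refl)
  also have "\<dots> = (\<integral>\<^sup>+Y. F (fst Y) * ennreal (ball_weight a (Y :: 'b \<times> 'a)) \<partial>(lborel \<Otimes>\<^sub>M lborel))"
    by (rule lborel.nn_integral_fst) measurable
  also have "\<dots> = (\<integral>\<^sup>+Y. F (fst Y) * ennreal (ball_weight a (Y :: 'b \<times> 'a)) \<partial>lborel)"
    by (simp only: lborel_prod)
  also note nn_integral_ball_weight_fst[OF a assms(2)]
  finally show ?thesis .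
qed

text \<open>
  Besides the weight, scaling produces the factor \<open>(1 - (norm s)\<^sup>2) powr (j/2)\<close>. It is a polynomial of
  degree \<open>j\<close> when \<open>j\<close> is even, and for odd \<open>j\<close> the integral vanishes by symmetry; so integrating out
  keeps polynomials within their degree.
\<close>
lemma integral_homogeneous_slice:
  fixes h :: "'a::euclidean_space \<Rightarrow> complex" and s :: "'b::euclidean_space"
  assumes h: "continuous_on UNIV h" and hom: "\<And>t z. h (t *\<^sub>R z) = of_real t ^ j * h z"
  shows "(\<integral>z. of_real (ball_weight a (s, z)) * h z \<partial>lborel) =
     (if even j then of_real (ball_weight (a + DIM('a) / 2) s * (1 - (norm s)\<^sup>2) ^ (j div 2)) else 0) *
     (\<integral>z. of_real (ball_weight a z) * h z \<partial>lborel)"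
proof (cases "norm s < 1")
  case False
  then show ?thesis by (simp add: ball_weight_slice_outside) (simp add: ball_weight_def)
next
  case True
  have [measurable]: "h \<in> borel_measurable borel"
    using h by (rule borel_measurable_continuous_onI)
  define c where "c = sqrt (1 - (norm s)\<^sup>2)"
  have pos: "1 - (norm s)\<^sup>2 > 0" using True by (simp add: abs_square_less_1)
  then have c: "c > 0" by (simp add: c_def)
  define H where "H = (\<integral>z. of_real (ball_weight a z) * h z \<partial>lborel)"
  have "(\<integral>z. of_real (ball_weight a (s, z)) * h z \<partial>lborel) =
     (c ^ DIM('a)) *\<^sub>R (\<integral>z. of_real (ball_weight a (s, c *\<^sub>R z)) * h (c *\<^sub>R z) \<partial>lborel)"
    using c by (intro integral_lborel_scale) measurable
  also have "(\<integral>z. of_real (ball_weight a (s, c *\<^sub>R z)) * h (c *\<^sub>R z) \<partial>lborel) =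
     (\<integral>z. of_real ((1 - (norm s)\<^sup>2) powr a * c ^ j) * (of_real (ball_weight a z) * h z) \<partial>lborel)"
    unfolding c_def ball_weight_slice[OF True] hom by (simp add: mult_ac)
  also have "\<dots> = of_real ((1 - (norm s)\<^sup>2) powr a * c ^ j) * H"
    unfolding H_def by (rule integral_mult_right_zero)
  finally have eq: "(\<integral>z. of_real (ball_weight a (s, z)) * h z \<partial>lborel) =
     of_real (c ^ DIM('a) * (1 - (norm s)\<^sup>2) powr a * c ^ j) * H"
    by (simp add: scaleR_conv_of_real mult_ac)
  have cm: "c ^ DIM('a) * (1 - (norm s)\<^sup>2) powr a = ball_weight (a + DIM('a) / 2) s"
  proof -
    have "c ^ DIM('a) = (1 - (norm s)\<^sup>2) powr (DIM('a) / 2)"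
      using pos c by (simp add: c_def powr_half_sqrt[symmetric] powr_realpow[symmetric] powr_powr)
    then show ?thesis using True by (simp add: ball_weight_def powr_add mult_ac)
  qed
  show ?thesis
  proof (cases "even j")
    case True
    then have "c ^ j = (1 - (norm s)\<^sup>2) ^ (j div 2)"
      using pos by (auto elim!: evenE simp: power_mult c_def)
    with True eq show ?thesis unfolding cm H_def by simp
  next
    case False
    \<comment> \<open>The reflection \<open>z \<mapsto> - z\<close> changes the sign of the integrand.\<close>
    have "H = (\<integral>z. of_real (ball_weight a (- z)) * h (- z) \<partial>lborel)"
    proof -
      have "H = (\<integral>z. of_real (ball_weight a z) * h z \<partial>distr lborel borel uminus)"
        unfolding H_def
        by (subst lborel_distr_isometry[of uminus]) (auto intro: linearI)
      also have "\<dots> = (\<integral>z. of_real (ball_weight a (- z)) * h (- z) \<partial>lborel)"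
        by (rule integral_distr) measurable
      finally show ?thesis .
    qed
    also have "\<dots> = - H"
    proof -
      have "h (- z) = - h z" for z using hom[of "-1" z] False by simp
      moreover have "ball_weight a (- z) = ball_weight a z" for z :: 'a
        by (simp add: ball_weight_def indicator_def)
      ultimately show ?thesis by (simp add: H_def)
    qed
    finally have "H = 0" by simp
    with eq False show ?thesis by simp
  qed
qed

section \<open>The zonal reproducing kernel\<close>

text \<open>
  Complex polynomial functions of degree at most \<open>n\<close> on a space without distinguished coordinates: this
  form is stable under linear substitutions, in particular under reflections.
\<close>
inductive polyfun :: "nat \<Rightarrow> ('b::real_vector \<Rightarrow> complex) \<Rightarrow> bool" where
  const: "polyfun n (\<lambda>x. c)"
| linear_mult: "linear l \<Longrightarrow> polyfun n f \<Longrightarrow> polyfun (Suc n) (\<lambda>x. of_real (l x) * f x)"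
| add: "polyfun n f \<Longrightarrow> polyfun n g \<Longrightarrow> polyfun n (\<lambda>x. f x + g x)"

lemma polyfun_mono_Suc: "polyfun n f \<Longrightarrow> polyfun (Suc n) f"
  by (induction rule: polyfun.induct) (auto intro: polyfun.intros)

lemma polyfun_mono:
  assumes "polyfun n f" "n \<le> k" shows "polyfun k f"
  using assms(2) by (induction rule: dec_induct) (auto intro: assms(1) polyfun_mono_Suc)

lemma polyfun_compose_linear: "polyfun n f \<Longrightarrow> linear L \<Longrightarrow> polyfun n (\<lambda>x. f (L x))"
proof (induction rule: polyfun.induct)
  case (linear_mult l n f)
  then show ?case
    using polyfun.linear_mult[of "l \<circ> L" n "\<lambda>x. f (L x)"] linear_compose[of L l] by simp
qed (auto intro: polyfun.intros)

lemma polyfun_cmult: "polyfun n f \<Longrightarrow> polyfun n (\<lambda>x. c * f x)"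
proof (induction rule: polyfun.induct)
  case (linear_mult l n f)
  then show ?case
    using polyfun.linear_mult[of l n "\<lambda>x. c * f x"] by (simp add: mult.left_commute)
qed (auto simp: distrib_left intro: polyfun.intros)

lemma polyfun_continuous:
  fixes f :: "'b::euclidean_space \<Rightarrow> complex"
  shows "polyfun n f \<Longrightarrow> continuous_on UNIV f"
proof (induction rule: polyfun.induct)
  case (linear_mult l n f)
  have "continuous_on UNIV l"
    using linear_mult.hyps(1) by (intro linear_continuous_on) (simp add: linear_conv_bounded_linear)
  with linear_mult.IH show ?case by (intro continuous_intros)
qed (auto intro!: continuous_intros)

lemma polyfun_power_mult:
  assumes "linear l" "polyfun n f"
  shows "polyfun (k + n) (\<lambda>x. of_real (l x) ^ k * f x)"
  using assms by (induction k) (auto dest: polyfun.linear_mult simp: mult.assoc)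

lemma polyfun_sum:
  "finite A \<Longrightarrow> (\<And>i. i \<in> A \<Longrightarrow> polyfun n (f i)) \<Longrightarrow> polyfun n (\<lambda>x. \<Sum>i\<in>A. f i x)"
  by (induction A rule: finite_induct) (auto intro: polyfun.intros)

lemma polyfun_monomial:
  fixes \<alpha> :: "'m::finite \<Rightarrow> nat"
  shows "finite A \<Longrightarrow> polyfun (\<Sum>i\<in>A. \<alpha> i) (\<lambda>x::real^'m. \<Prod>i\<in>A. complex_of_real (x $ i) ^ \<alpha> i)"
proof (induction A rule: finite_induct)
  case (insert i A)
  then show ?case
    using polyfun_power_mult[of "\<lambda>x::real^'m. x $ i" _ _ "\<alpha> i"]
    by (simp add: linear_iff)
qed (auto intro: polyfun.const)

lemma polyfun_polys: "P \<in> polys n \<Longrightarrow> polyfun n P"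
proof -
  assume "P \<in> polys n"
  then obtain c where P: "\<And>x. P x = (\<Sum>\<alpha>\<in>multiindices n. c \<alpha> * (\<Prod>i\<in>UNIV. complex_of_real (x $ i) ^ \<alpha> i))"
    by (auto simp: polys_def)
  have "polyfun n (\<lambda>x. \<Sum>\<alpha>\<in>multiindices n. c \<alpha> * (\<Prod>i\<in>UNIV. complex_of_real (x $ i) ^ \<alpha> i))"
    by (intro polyfun_sum finite_multiindices polyfun_cmult polyfun_mono[OF polyfun_monomial])
       (auto simp: multiindices_def)
  moreover have "P = (\<lambda>x. \<Sum>\<alpha>\<in>multiindices n. c \<alpha> * (\<Prod>i\<in>UNIV. complex_of_real (x $ i) ^ \<alpha> i))"
    using P by auto
  ultimately show ?thesis by simp
qed

text \<open>
  Polynomials expanded in powers of the axial coordinate, with homogeneous coefficients in the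
  remaining ones. Homogeneity makes the integral over a slice computable by scaling.
\<close>
inductive sliced :: "nat \<Rightarrow> (real \<times> 'a::euclidean_space \<Rightarrow> complex) \<Rightarrow> bool" where
  base: "k + j \<le> n \<Longrightarrow> continuous_on UNIV h \<Longrightarrow> (\<And>t z. h (t *\<^sub>R z) = of_real t ^ j * h z)
     \<Longrightarrow> sliced n (\<lambda>Y. of_real (fst Y) ^ k * h (snd Y))"
| add: "sliced n f \<Longrightarrow> sliced n g \<Longrightarrow> sliced n (\<lambda>x. f x + g x)"

lemma sliced_fst_mult: "sliced n f \<Longrightarrow> sliced (Suc n) (\<lambda>Y. of_real (c * fst Y) * f Y)"
proof (induction rule: sliced.induct)
  case (base k j n h)
  have "sliced (Suc n) (\<lambda>Y. of_real (fst Y) ^ Suc k * (of_real c * h (snd Y)))"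
    using base by (intro sliced.base[where j = j]) (auto intro!: continuous_intros)
  then show ?case by (simp add: mult_ac)
qed (auto simp: distrib_left intro: sliced.add)

lemma sliced_snd_mult:
  assumes "linear l" shows "sliced n f \<Longrightarrow> sliced (Suc n) (\<lambda>Y. of_real (l (snd Y)) * f Y)"
proof (induction rule: sliced.induct)
  case (base k j n h)
  have "continuous_on UNIV (\<lambda>z. of_real (l z) * h z)"
  proof -
    have "continuous_on UNIV l"
      using assms by (intro linear_continuous_on) (simp add: linear_conv_bounded_linear)
    with base show ?thesis by (intro continuous_intros)
  qed
  then have "sliced (Suc n) (\<lambda>Y. of_real (fst Y) ^ k * (of_real (l (snd Y)) * h (snd Y)))"
    using base assms by (intro sliced.base[where j = "Suc j"]) (auto simp: linear_scale)
  then show ?case by (simp add: mult_ac)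
qed (auto simp: distrib_left intro: sliced.add)

lemma polyfun_sliced: "polyfun n f \<Longrightarrow> sliced n f"
proof (induction rule: polyfun.induct)
  case (const n c)
  show ?case using sliced.base[of 0 0 n "\<lambda>_. c"] by simp
next
  case (linear_mult l n f)
  have l: "l Y = l (1, 0) * fst Y + l (0, snd Y)" for Y
  proof -
    have "l Y = l (fst Y *\<^sub>R (1, 0) + (0, snd Y))" by simp
    also have "\<dots> = fst Y * l (1, 0) + l (0, snd Y)"
      using linear_mult.hyps(1) by (simp only: linear_add linear_scale real_scaleR_def)
    finally show ?thesis by simp
  qed
  have "linear (\<lambda>z. l (0, z))"
  proof (rule linearI)
    show "l (0, x + y) = l (0, x) + l (0, y)" for x y
      using linear_add[OF linear_mult.hyps(1), of "(0, x)" "(0, y)"] by simp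
    show "l (0, r *\<^sub>R x) = r *\<^sub>R l (0, x)" for r x
      using linear_scale[OF linear_mult.hyps(1), of r "(0, x)"] by simp
  qed
  then have "sliced (Suc n) (\<lambda>Y. of_real (l (1, 0) * fst Y) * f Y + of_real (l (0, snd Y)) * f Y)"
    by (intro sliced.add sliced_fst_mult sliced_snd_mult linear_mult.IH)
  also have "(\<lambda>Y. of_real (l (1, 0) * fst Y) * f Y + of_real (l (0, snd Y)) * f Y) = (\<lambda>Y. of_real (l Y) * f Y)"
    by (subst (3) l) (simp add: distrib_right)
  finally show ?case .
next
  case (add n f g)
  then show ?case by (intro sliced.add)
qed

text \<open>
  The Jacobi kernel transported from \<open>[0, 1]\<close> to \<open>[-1, 1]\<close>, so that it reproduces the value at \<open>1\<close>.
\<close>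
definition zonal :: "real \<Rightarrow> nat \<Rightarrow> real \<Rightarrow> real"
  where "zonal p n s = poly (jacobi_kernel p p n) ((1 - s) / 2)"

definition zonal_mass :: "real \<Rightarrow> nat \<Rightarrow> real"
  where "zonal_mass p n = 2 * 4 powr (p - 1) * jacobi_mass p p n"

lemma zonal_1: "zonal p n 1 = 1"
  by (simp add: zonal_def jacobi_kernel_0)

lemma continuous_on_zonal [continuous_intros]:
  "continuous_on A f \<Longrightarrow> continuous_on A (\<lambda>x. zonal p n (f x))"
  unfolding zonal_def by (intro continuous_intros) auto

lemma zonal_measurable [measurable]: "zonal p n \<in> borel_measurable borel"
  by (intro borel_measurable_continuous_onI continuous_intros)

text \<open>
  On the line the ball is the interval from \<open>-1\<close> to \<open>1\<close>, and \<open>1 - s\<^sup>2 = 4 y (1 - y)\<close> for \<open>s = 1 - 2 y\<close>.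
\<close>
lemma ball_weight_real_eq_jacobi:
  "ball_weight (p - 1) (1 - 2 * y :: real) = 4 powr (p - 1) * jacobi_weight p p y"
proof (cases "0 < y \<and> y < 1")
  case True
  have "1 - (1 - 2 * y)\<^sup>2 = 4 * (y * (1 - y))" by (simp add: power2_eq_square algebra_simps)
  with True show ?thesis
    by (simp add: ball_weight_def jacobi_weight_def dist_norm abs_less_iff powr_mult)
qed (auto simp: ball_weight_def jacobi_weight_def dist_norm abs_less_iff)

lemma zonal_reproducing_line:
  fixes r :: "complex poly"
  assumes p: "p > 0" and "degree r \<le> n"
  shows "has_bochner_integral lborel
     (\<lambda>s. of_real (zonal p n s * ball_weight (p - 1) s) * poly r (of_real s))
     (of_real (zonal_mass p n) * poly r 1)"
proof -
  let ?r = "pcompose r [:1, -2:]"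
  have "has_bochner_integral lborel
     (\<lambda>y. of_real (poly (jacobi_kernel p p n) y * jacobi_weight p p y) * poly ?r (of_real y))
     (of_real (jacobi_mass p p n) * poly ?r 0)"
    using assms by (intro jacobi_kernel_reproducing) (auto simp: degree_pcompose)
  then have "has_bochner_integral lborel
     (\<lambda>y. of_real (4 powr (p - 1)) * (of_real (poly (jacobi_kernel p p n) y * jacobi_weight p p y) * poly ?r (of_real y)))
     (of_real (4 powr (p - 1)) * (of_real (jacobi_mass p p n) * poly ?r 0))"
    by (rule has_bochner_integral_mult_right)
  also have "(\<lambda>y. of_real (4 powr (p - 1)) * (of_real (poly (jacobi_kernel p p n) y * jacobi_weight p p y) * poly ?r (of_real y))) =
    (\<lambda>y. of_real (zonal p n (1 + (- 2) * y) * ball_weight (p - 1) (1 + (-2) * y)) * poly r (of_real (1 + (-2) * y)))"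
    using ball_weight_real_eq_jacobi[of p] by (simp add: zonal_def poly_pcompose mult_ac fun_eq_iff)
  finally have *: "has_bochner_integral lborel
     (\<lambda>y. of_real (zonal p n (1 + (- 2) * y) * ball_weight (p - 1) (1 + (-2) * y)) * poly r (of_real (1 + (-2) * y)))
     (of_real (4 powr (p - 1)) * (of_real (jacobi_mass p p n) * poly ?r 0))" .
  show ?thesis
    unfolding has_bochner_integral_iff
  proof
    show "integrable lborel (\<lambda>s. of_real (zonal p n s * ball_weight (p - 1) s) * poly r (of_real s))"
      using * lborel_integrable_real_affine_iff[of "-2" "\<lambda>s. of_real (zonal p n s * ball_weight (p - 1) s) * poly r (of_real s)" 1]
      by (simp add: has_bochner_integral_iff)
    show "(\<integral>s. of_real (zonal p n s * ball_weight (p - 1) s) * poly r (of_real s) \<partial>lborel) = of_real (zonal_mass p n) * poly r 1"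
      using *
      by (subst lborel_integral_real_affine[of "-2" _ 1])
         (simp_all add: has_bochner_integral_iff zonal_mass_def poly_pcompose scaleR_conv_of_real)
  qed
qed

lemma integrable_ball_weight:
  assumes "a > -1"
  shows "integrable lborel (ball_weight a :: 'a::euclidean_space \<Rightarrow> real)"
  using nn_integral_ball_weight[OF assms, where 'a='a]
  by (intro integrableI_nonneg) (auto simp: ball_weight_nonneg)

lemma integrable_continuous_ball_weight:
  fixes f :: "'a::euclidean_space \<Rightarrow> complex"
  assumes "a > -1" "continuous_on UNIV f"
  shows "integrable lborel (\<lambda>Y. of_real (ball_weight a Y) * f Y)"
proof -
  have [measurable]: "f \<in> borel_measurable borel"
    using assms(2) by (rule borel_measurable_continuous_onI)
  have "compact (f ` cball 0 1)"
    by (intro compact_continuous_image continuous_on_subset[OF assms(2)]) auto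
  then obtain K where K: "\<And>Y. Y \<in> cball 0 1 \<Longrightarrow> norm (f Y) \<le> K"
    by (meson bounded_iff compact_imp_bounded image_eqI)
  show ?thesis
  proof (rule Bochner_Integration.integrable_bound)
    show "integrable lborel (\<lambda>Y. K * ball_weight a (Y::'a))"
      by (intro integrable_mult_right integrable_ball_weight assms)
    show "AE Y in lborel. norm (of_real (ball_weight a Y) * f Y) \<le> norm (K * ball_weight a Y)"
    proof (intro AE_I2)
      fix Y :: 'a
      show "norm (of_real (ball_weight a Y) * f Y) \<le> norm (K * ball_weight a Y)"
      proof (cases "Y \<in> ball 0 1")
        case True
        then have "norm (f Y) \<le> \<bar>K\<bar>" using K[of Y] by auto
        then show ?thesis
          by (simp add: norm_mult abs_mult mult.commute mult_right_mono)
      qed (simp add: ball_weight_def)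
    qed
  qed measurable
qed

text \<open>
  For \<open>g = s ^ k * h z\<close> with \<open>h\<close> homogeneous of degree \<open>j\<close>, integrating over \<open>z\<close> leaves a multiple of
  \<open>s ^ k * (1 - s\<^sup>2) ^ (j div 2)\<close>, of degree at most \<open>n\<close>, and the kernel evaluates it at \<open>s = 1\<close>. There it
  vanishes unless \<open>j = 0\<close>, as does \<open>g\<close> at the pole.
\<close>
lemma zonal_reproducing_sliced:
  fixes g :: "real \<times> 'a::euclidean_space \<Rightarrow> complex"
  defines "d \<equiv> real DIM('a)"
  assumes a: "a > -1" and p: "p = a + d / 2 + 1" and "sliced n g"
  shows "has_bochner_integral lborel (\<lambda>Y. of_real (zonal p n (fst Y) * ball_weight a Y) * g Y)
           (of_real (ball_mass d a * zonal_mass p n) * g (1, 0))"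
  using assms(4)
proof (induction rule: sliced.induct)
  case (base k j n h)
  have ppos: "p > 0" using a p by (simp add: d_def add_nonneg_pos)
  have [measurable]: "h \<in> borel_measurable borel"
    using base by (intro borel_measurable_continuous_onI)
  let ?G = "\<lambda>Y. of_real (zonal p n (fst Y) * ball_weight a Y) * (of_real (fst Y) ^ k * h (snd Y))"
  have int: "integrable lborel ?G"
  proof -
    have "continuous_on UNIV (\<lambda>Y. of_real (zonal p n (fst Y)) * (of_real (fst Y) ^ k * h (snd Y)))"
      by (intro continuous_intros continuous_on_compose2[OF base(2)]) auto
    from integrable_continuous_ball_weight[OF a this] show ?thesis by (simp add: mult_ac)
  qed
  define H where "H = (\<integral>z. of_real (ball_weight a z) * h z \<partial>lborel)"
  define r :: "complex poly" where
    "r = (if even j then smult H (monom 1 k * [:1, 0, -1:] ^ (j div 2)) else 0)"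
  have rdeg: "degree r \<le> n"
  proof (cases "even j")
    case True
    have "degree (monom 1 k * [:1, 0, -1::complex:] ^ (j div 2)) \<le> k + 2 * (j div 2)"
      by (rule order_trans[OF degree_mult_le])
         (intro add_mono degree_monom_le order_trans[OF degree_power_le], simp)
    also have "\<dots> \<le> n" using base True by simp
    finally show ?thesis using True by (simp add: r_def)
  qed (simp add: r_def)
  have inner: "(\<integral>z. ?G (s, z) \<partial>lborel) = of_real (zonal p n s * ball_weight (p - 1) s) * poly r (of_real s)" for s
  proof -
    have "(\<integral>z. ?G (s, z) \<partial>lborel) =
       (\<integral>z. (of_real (zonal p n s) * of_real s ^ k) * (of_real (ball_weight a (s, z)) * h z) \<partial>lborel)"
      by (simp add: mult_ac)
    also have "\<dots> = (of_real (zonal p n s) * of_real s ^ k) * (\<integral>z. of_real (ball_weight a (s, z)) * h z \<partial>lborel)"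
      by (rule integral_mult_right_zero)
    also have "\<dots> = of_real (zonal p n s * ball_weight (p - 1) s) * poly r (of_real s)"
      unfolding integral_homogeneous_slice[OF base(2,3)] H_def[symmetric] p d_def
      by (simp add: r_def poly_monom power2_eq_square algebra_simps)
    finally show ?thesis .
  qed
  have r1: "of_real (ball_mass d a) * (of_real 1 ^ k * h 0) = poly r 1"
  proof (cases "j = 0")
    case True
    have h: "h z = h 0" for z using base(3)[of 0 z] True by simp
    have "H = (\<integral>z. of_real (ball_weight a (z::'a)) * h 0 \<partial>lborel)"
      unfolding H_def by (subst h) simp
    also have "\<dots> = (\<integral>z. of_real (ball_weight a (z::'a)) \<partial>lborel) * h 0"
      by (rule integral_mult_left_zero)
    also have "(\<integral>z. complex_of_real (ball_weight a (z::'a)) \<partial>lborel) = of_real (\<integral>z. ball_weight a (z::'a) \<partial>lborel)"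
      by (rule integral_complex_of_real)
    also have "(\<integral>z. ball_weight a (z::'a) \<partial>lborel) = ball_mass d a"
      unfolding d_def using ball_mass_pos[of "DIM('a)", OF _ a]
      by (subst integral_eq_nn_integral) (auto simp: nn_integral_ball_weight[OF a] ball_weight_nonneg)
    finally show ?thesis using True by (simp add: r_def poly_monom)
  next
    case False
    then have "h 0 = 0" using base(3)[of 0 0] by (simp add: power_0_left)
    moreover have "poly r 1 = 0" using False by (auto simp: r_def elim!: evenE)
    ultimately show ?thesis by simp
  qed
  show ?case
    unfolding has_bochner_integral_iff
  proof
    show "integrable lborel ?G" by (rule int)
    have "integral\<^sup>L lborel ?G = integral\<^sup>L (lborel \<Otimes>\<^sub>M lborel) ?G" by (simp only: lborel_prod)
    also have "\<dots> = (\<integral>s. (\<integral>z. ?G (s, z) \<partial>lborel) \<partial>lborel)"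
      using int by (intro lborel_pair.integral_fst'[symmetric]) (simp only: lborel_prod)
    also have "\<dots> = of_real (zonal_mass p n) * poly r 1"
      unfolding inner using zonal_reproducing_line[OF ppos rdeg] by (simp add: has_bochner_integral_iff)
    finally show "integral\<^sup>L lborel ?G = of_real (ball_mass d a * zonal_mass p n) * (of_real (fst (1, 0::'a)) ^ k * h (snd (1::real, 0)))"
      unfolding r1[symmetric] by (simp add: mult_ac)
  qed
next
  case (add n f g)
  then show ?case
    using has_bochner_integral_add[OF add.IH] by (simp add: distrib_left)
qed

text \<open>
  A reflection that moves the pole to \<open>X\<close> preserves the measure, the weight and the polynomials.
\<close>
lemma zonal_reproducing:
  fixes g :: "real \<times> 'a::euclidean_space \<Rightarrow> complex"
  assumes a: "a > -1" and p: "p = a + real DIM('a) / 2 + 1" and g: "polyfun n g" and X: "norm X = 1"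
  shows "has_bochner_integral lborel (\<lambda>Y. of_real (zonal p n (X \<bullet> Y) * ball_weight a Y) * g Y)
           (of_real (ball_mass DIM('a) a * zonal_mass p n) * g X)"
proof -
  have e1: "norm (1 :: real, 0 :: 'a) = 1" by (simp add: norm_Pair)
  obtain R :: "real \<times> 'a \<Rightarrow> real \<times> 'a" where R: "linear R" "\<And>Y. norm (R Y) = norm Y" "R (1, 0) = X" "\<And>Y Z. R Y \<bullet> R Z = Y \<bullet> Z"
    by (rule householder_reflection[OF e1 X], rule that, assumption+)
  have [measurable]: "g \<in> borel_measurable borel"
    by (intro borel_measurable_continuous_onI polyfun_continuous[OF g])
  have XR: "X \<bullet> R Y = fst Y" for Y
    unfolding R(3)[symmetric] R(4) by (cases Y) simp
  have bw: "ball_weight a (R Y) = ball_weight a Y" for Y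
    by (simp add: ball_weight_def indicator_def R(2))
  have "has_bochner_integral lborel (\<lambda>Y. of_real (zonal p n (fst Y) * ball_weight a Y) * g (R Y))
           (of_real (ball_mass DIM('a) a * zonal_mass p n) * g (R (1, 0)))"
    by (rule zonal_reproducing_sliced[OF a]) (use p polyfun_sliced polyfun_compose_linear[OF g R(1)] in auto)
  then have "has_bochner_integral lborel
      (\<lambda>Y. of_real (zonal p n (X \<bullet> R Y) * ball_weight a (R Y)) * g (R Y))
      (of_real (ball_mass DIM('a) a * zonal_mass p n) * g X)"
    by (simp only: XR bw R(3))
  then show ?thesis
    by (rule has_bochner_integral_isometry[OF R(1,2), rotated]) measurable
qed

lemma nn_integral_zonal:
  fixes F :: "real \<Rightarrow> ennreal"
  assumes a: "a > -1" and X: "norm (X :: real \<times> 'a::euclidean_space) = 1" and [measurable]: "F \<in> borel_measurable borel"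
  shows "(\<integral>\<^sup>+Y. F (X \<bullet> Y) * ennreal (ball_weight a Y) \<partial>lborel) =
     ennreal (ball_mass DIM('a) a) * (\<integral>\<^sup>+s. F s * ennreal (ball_weight (a + DIM('a) / 2) s) \<partial>lborel)"
proof -
  have e1: "norm (1 :: real, 0 :: 'a) = 1" by (simp add: norm_Pair)
  obtain R :: "real \<times> 'a \<Rightarrow> real \<times> 'a" where R: "linear R" "\<And>Y. norm (R Y) = norm Y" "R (1, 0) = X" "\<And>Y Z. R Y \<bullet> R Z = Y \<bullet> Z"
    by (rule householder_reflection[OF e1 X], rule that, assumption+)
  have XR: "X \<bullet> R Y = fst Y" for Y
    unfolding R(3)[symmetric] R(4) by (cases Y) simp
  have bw: "ball_weight a (R Y) = ball_weight a Y" for Y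
    by (simp add: ball_weight_def indicator_def R(2))
  have "(\<integral>\<^sup>+Y. F (X \<bullet> Y) * ennreal (ball_weight a Y) \<partial>lborel) =
     (\<integral>\<^sup>+Y. F (X \<bullet> R Y) * ennreal (ball_weight a (R Y)) \<partial>lborel)"
    by (intro nn_integral_isometry[OF R(1,2), symmetric]) measurable
  also have "\<dots> = (\<integral>\<^sup>+Y. F (fst Y) * ennreal (ball_weight a (Y :: real \<times> 'a)) \<partial>lborel)"
    by (simp only: XR bw)
  also note nn_integral_ball_weight_fst[OF a assms(3)]
  finally show ?thesis .
qed

section \<open>Polynomials on the weighted ball\<close>

lemma ball_weight_antimono: "a \<le> b \<Longrightarrow> ball_weight b x \<le> ball_weight a x"
  by (auto simp: ball_weight_def indicator_def intro!: powr_mono' power_le_one)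

lemma polyfun_poly_linear:
  fixes q :: "real poly"
  assumes l: "linear l" and q: "degree q \<le> n"
  shows "polyfun n (\<lambda>Y. complex_of_real (poly q (l Y)))"
proof -
  have "polyfun n (\<lambda>Y. \<Sum>k\<le>n. complex_of_real (coeff q k) * (complex_of_real (l Y) ^ k * 1))"
    by (intro polyfun_sum polyfun_cmult polyfun_mono[OF polyfun_power_mult[OF l polyfun.const[of 0]]])
       (auto intro: le_add_same_cancel1)
  then show ?thesis by (simp add: poly_eq_sum_coeff[OF q])
qed

lemma poly_map_of_real: "poly (map_poly complex_of_real q) (of_real s) = of_real (poly q s)"
  by (induction q) (auto simp: map_poly_pCons)

definition zonal_poly :: "real \<Rightarrow> nat \<Rightarrow> real poly"
  where "zonal_poly p n = pcompose (jacobi_kernel p p n) [:1/2, -1/2:]"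

lemma poly_zonal_poly: "poly (zonal_poly p n) s = zonal p n s"
  by (simp add: zonal_poly_def zonal_def poly_pcompose diff_divide_distrib)

lemma degree_zonal_poly: "degree (zonal_poly p n) \<le> n"
  using degree_jacobi_kernel[of p p n] by (simp add: zonal_poly_def degree_pcompose)

lemma polyfun_zonal: "polyfun n (\<lambda>Y. complex_of_real (zonal p n (X \<bullet> Y)))"
proof -
  have "linear (\<lambda>Y. X \<bullet> Y)" by (intro linearI) (simp_all add: inner_add_right)
  from polyfun_poly_linear[OF this degree_zonal_poly] show ?thesis
    by (simp add: poly_zonal_poly)
qed

lemma zonal_mass_nn_integral:
  assumes "p > 0"
  shows "(\<integral>\<^sup>+s. ennreal ((zonal p n s)\<^sup>2) * ennreal (ball_weight (p - 1) s) \<partial>lborel) = ennreal (zonal_mass p n)"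
proof -
  let ?r = "map_poly complex_of_real (zonal_poly p n)"
  have r: "poly ?r (of_real s) = of_real (zonal p n s)" for s
    unfolding poly_zonal_poly[symmetric] by (rule poly_map_of_real)
  have "degree ?r \<le> n"
    using degree_zonal_poly by (simp add: degree_map_poly)
  from has_bochner_integral_Re[OF zonal_reproducing_line[OF assms this]]
  have "has_bochner_integral lborel (\<lambda>s. (zonal p n s)\<^sup>2 * ball_weight (p - 1) s) (zonal_mass p n)"
    using r[of 1] by (simp add: r zonal_1 power2_eq_square mult_ac del: of_real_mult flip: of_real_mult)
  then have "(\<integral>\<^sup>+s. ennreal ((zonal p n s)\<^sup>2 * ball_weight (p - 1) s) \<partial>lborel) = ennreal (zonal_mass p n)"
    by (simp add: has_bochner_integral_iff nn_integral_eq_integral ball_weight_nonneg)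
  then show ?thesis by (simp add: ennreal_mult ball_weight_nonneg)
qed

lemma zonal_mass_pos: "p > 0 \<Longrightarrow> zonal_mass p n > 0"
  by (simp add: zonal_mass_def jacobi_mass_pos)

text \<open>
  The kernel \<open>Y \<mapsto> zonal p n (X \<bullet> Y)\<close> is itself a polynomial of degree at most \<open>n\<close> with value \<open>1\<close> at \<open>X\<close>, so
  the reproducing property applied to it gives its own norm.
\<close>
theorem polyfun_sphere_bound:
  fixes g :: "real \<times> 'a::euclidean_space \<Rightarrow> complex"
  assumes a: "a > -1" and g: "polyfun n g" and X: "norm X = 1"
  shows "ennreal (ball_mass DIM('a) a * zonal_mass (a + real DIM('a) / 2 + 1) n * (cmod (g X))\<^sup>2) \<le>
     (\<integral>\<^sup>+Y. ennreal ((cmod (g Y))\<^sup>2 * ball_weight a Y) \<partial>lborel)"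
proof (rule bessel_inequality_one_vector)
  let ?p = "a + real DIM('a) / 2 + 1"
  have "(\<lambda>Y. complex_of_real (zonal ?p n (X \<bullet> Y) * ball_weight a Y) * complex_of_real (zonal ?p n (X \<bullet> Y))) =
      (\<lambda>Y. complex_of_real (zonal ?p n (X \<bullet> Y) * ball_weight a Y * zonal ?p n (X \<bullet> Y)))"
    by simp
  with has_bochner_integral_Re[OF zonal_reproducing[OF a refl polyfun_zonal[of n ?p X] X]]
  show "has_bochner_integral lborel (\<lambda>Y. zonal ?p n (X \<bullet> Y) * ball_weight a Y * zonal ?p n (X \<bullet> Y))
     (ball_mass DIM('a) a * zonal_mass ?p n)"
    using X by (simp add: dot_square_norm zonal_1 del: of_real_mult flip: of_real_mult)
  show "has_bochner_integral lborel (\<lambda>Y. complex_of_real (zonal ?p n (X \<bullet> Y) * ball_weight a Y) * g Y)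
     (complex_of_real (ball_mass DIM('a) a * zonal_mass ?p n) * g X)"
    by (rule zonal_reproducing[OF a refl g X])
  show "g \<in> borel_measurable lborel"
    using polyfun_continuous[OF g] by (simp add: borel_measurable_continuous_onI)
qed (auto simp: ball_weight_nonneg)

text \<open>
  The reciprocal of the square of the Nikolskii constant for polynomials.
\<close>
definition gegenbauer_mass :: "real \<Rightarrow> real \<Rightarrow> nat \<Rightarrow> real"
  where "gegenbauer_mass m lam n =
    pi powr ((m - 1) / 2) * Gamma (lam + 1/2) / Gamma (lam + m / 2) * zonal_mass (lam + m / 2) n"

lemma ball_mass_ratio:
  assumes "lam > 0" "m \<ge> 0"
  shows "ball_mass m (lam - 1) = ball_mass 1 (lam - 1) * (pi powr ((m - 1) / 2) * Gamma (lam + 1/2) / Gamma (lam + m / 2))"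
proof -
  have "Gamma lam > 0" "Gamma (lam + m / 2) > 0" "Gamma (lam + 1/2) > 0" using assms by (auto intro!: Gamma_real_pos)
  moreover have "pi powr (m / 2) = pi powr (1 / 2) * pi powr ((m - 1) / 2)"
    by (simp add: powr_add[symmetric] add_divide_distrib[symmetric])
  ultimately show ?thesis
    by (simp add: ball_mass_def)
qed

text \<open>
  The point is lifted to the unit sphere of \<open>\<real> \<times> \<real>\<^sup>m\<close>, and the bound there is integrated over the extra
  coordinate.
\<close>
lemma polys_ball_bound_pos:
  fixes P :: "real ^ 'm \<Rightarrow> complex"
  assumes P: "P \<in> polys n" and lam: "lam > 0" and x: "norm x \<le> 1"
  shows "ennreal (gegenbauer_mass CARD('m) lam n * (cmod (P x))\<^sup>2) \<le>
     (\<integral>\<^sup>+y. ennreal ((cmod (P y))\<^sup>2) * ennreal (ball_weight (lam - 1/2) y) \<partial>lborel)"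
proof -
  define X where "X = (sqrt (1 - (norm x)\<^sup>2), x)"
  have X: "norm X = 1" using x by (simp add: X_def norm_Pair abs_square_le_1)
  have [measurable]: "P \<in> borel_measurable borel"
    using polyfun_continuous[OF polyfun_polys[OF P]] by (rule borel_measurable_continuous_onI)
  have m: "real DIM(real ^ 'm) = real CARD('m)" by simp
  have B: "ball_mass 1 (lam - 1) > 0" using lam by (intro ball_mass_pos) auto
  have "linear (snd :: real \<times> (real ^ 'm) \<Rightarrow> _)" by (simp add: linear_iff)
  from polyfun_compose_linear[OF polyfun_polys[OF P] this]
  have "ennreal (ball_mass CARD('m) (lam - 1) * zonal_mass (lam - 1 + real CARD('m) / 2 + 1) n * (cmod (P (snd X)))\<^sup>2) \<le>
     (\<integral>\<^sup>+Y. ennreal ((cmod (P (snd Y)))\<^sup>2 * ball_weight (lam - 1) (Y :: real \<times> (real ^ 'm))) \<partial>lborel)"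
    using polyfun_sphere_bound[of "lam - 1" n "\<lambda>Y. P (snd Y)" X] X lam by simp
  also have "ball_mass CARD('m) (lam - 1) * zonal_mass (lam - 1 + real CARD('m) / 2 + 1) n * (cmod (P (snd X)))\<^sup>2 =
     ball_mass 1 (lam - 1) * (gegenbauer_mass CARD('m) lam n * (cmod (P x))\<^sup>2)"
    unfolding ball_mass_ratio[OF lam, of "real CARD('m)", OF of_nat_0_le_iff]
    by (simp add: X_def gegenbauer_mass_def)
  also have "(\<integral>\<^sup>+Y. ennreal ((cmod (P (snd Y)))\<^sup>2 * ball_weight (lam - 1) (Y :: real \<times> (real ^ 'm))) \<partial>lborel) =
     (\<integral>\<^sup>+Y. ennreal ((cmod (P (snd Y)))\<^sup>2) * ennreal (ball_weight (lam - 1) (Y :: real \<times> (real ^ 'm))) \<partial>lborel)"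
    by (simp add: ennreal_mult ball_weight_nonneg)
  also have "\<dots> = ennreal (ball_mass 1 (lam - 1)) *
     (\<integral>\<^sup>+y. ennreal ((cmod (P y))\<^sup>2) * ennreal (ball_weight (lam - 1/2) y) \<partial>lborel)"
    using nn_integral_ball_weight_snd[of "lam - 1" "\<lambda>y. ennreal ((cmod (P y))\<^sup>2)", where 'a=real] lam by simp
  finally have "ennreal (ball_mass 1 (lam - 1)) * ennreal (gegenbauer_mass CARD('m) lam n * (cmod (P x))\<^sup>2) \<le>
     ennreal (ball_mass 1 (lam - 1)) * (\<integral>\<^sup>+y. ennreal ((cmod (P y))\<^sup>2) * ennreal (ball_weight (lam - 1/2) y) \<partial>lborel)"
    using B by (subst ennreal_mult'[symmetric]) auto
  then show ?thesis using B by (subst (asm) ennreal_mult_le_mult_iff) auto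
qed

lemma gegenbauer_mass_tendsto_0:
  assumes "m > 0"
  shows "(\<lambda>k. gegenbauer_mass m (inverse (real (Suc k))) n) \<longlonglongrightarrow> gegenbauer_mass m 0 n"
proof -
  have l: "(\<lambda>k. inverse (real (Suc k))) \<longlonglongrightarrow> 0" by (rule LIMSEQ_inverse_real_of_nat)
  show ?thesis
    unfolding gegenbauer_mass_def zonal_mass_def jacobi_mass_def
    using assms
    by (intro tendsto_intros l) (auto elim!: nonpos_Ints_cases simp: Gamma_eq_zero_iff)
qed

text \<open>
  The weights increase as \<open>lam\<close> decreases to \<open>0\<close>, and the constants converge.
\<close>
lemma polys_ball_bound:
  fixes P :: "real ^ 'm \<Rightarrow> complex"
  assumes P: "P \<in> polys n" and lam: "lam \<ge> 0" and x: "norm x \<le> 1"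
  shows "ennreal (gegenbauer_mass CARD('m) lam n * (cmod (P x))\<^sup>2) \<le>
     (\<integral>\<^sup>+y. ennreal ((cmod (P y))\<^sup>2) * ennreal (ball_weight (lam - 1/2) y) \<partial>lborel)"
proof (cases "lam = 0")
  case False
  then show ?thesis using polys_ball_bound_pos[OF P _ x] lam by simp
next
  case True
  show ?thesis unfolding True
  proof (rule tendsto_upperbound)
    show "(\<lambda>k. ennreal (gegenbauer_mass CARD('m) (inverse (real (Suc k))) n * (cmod (P x))\<^sup>2)) \<longlonglongrightarrow>
        ennreal (gegenbauer_mass CARD('m) 0 n * (cmod (P x))\<^sup>2)"
      by (intro tendsto_intros gegenbauer_mass_tendsto_0) auto
    show "\<forall>\<^sub>F k in sequentially. ennreal (gegenbauer_mass CARD('m) (inverse (real (Suc k))) n * (cmod (P x))\<^sup>2) \<le>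
       (\<integral>\<^sup>+y. ennreal ((cmod (P y))\<^sup>2) * ennreal (ball_weight (0 - 1/2) y) \<partial>lborel)"
    proof (intro always_eventually allI)
      fix k
      have "ennreal (gegenbauer_mass CARD('m) (inverse (real (Suc k))) n * (cmod (P x))\<^sup>2) \<le>
          (\<integral>\<^sup>+y. ennreal ((cmod (P y))\<^sup>2) * ennreal (ball_weight (inverse (real (Suc k)) - 1/2) y) \<partial>lborel)"
        by (rule polys_ball_bound_pos[OF P _ x]) simp
      also have "\<dots> \<le> (\<integral>\<^sup>+y. ennreal ((cmod (P y))\<^sup>2) * ennreal (ball_weight (0 - 1/2) y) \<partial>lborel)"
        by (intro nn_integral_mono mult_left_mono ennreal_leI ball_weight_antimono) auto
      finally show "ennreal (gegenbauer_mass CARD('m) (inverse (real (Suc k))) n * (cmod (P x))\<^sup>2) \<le>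
       (\<integral>\<^sup>+y. ennreal ((cmod (P y))\<^sup>2) * ennreal (ball_weight (0 - 1/2) y) \<partial>lborel)" .
    qed
  qed simp
qed

text \<open>
  Up to constants, both sides are integrals over the ball of \<open>\<real> \<times> \<real>\<^sup>m\<close>: on the left the extra coordinate is integrated out,
  on the right all coordinates but the \<open>i\<close>-th.
\<close>
lemma nn_integral_coordinate_ball_weight:
  fixes F :: "real \<Rightarrow> ennreal" and i :: "'m::finite"
  assumes lam: "lam > 0" and [measurable]: "F \<in> borel_measurable borel"
  defines "m \<equiv> real CARD('m)"
  shows "(\<integral>\<^sup>+x. F (x $ i) * ennreal (ball_weight (lam - 1/2) (x :: real ^ 'm)) \<partial>lborel) =
     ennreal (pi powr ((m - 1) / 2) * Gamma (lam + 1/2) / Gamma (lam + m / 2)) *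
     (\<integral>\<^sup>+s. F s * ennreal (ball_weight (lam + m / 2 - 1) s) \<partial>lborel)"
proof -
  define X where "X = (0::real, axis i 1 :: real ^ 'm)"
  have X: "norm X = 1" by (simp add: X_def norm_Pair)
  have B: "ball_mass 1 (lam - 1) > 0" using lam by (intro ball_mass_pos) auto
  have "ennreal (ball_mass 1 (lam - 1)) * (\<integral>\<^sup>+x. F (x $ i) * ennreal (ball_weight (lam - 1/2) (x :: real ^ 'm)) \<partial>lborel) =
     (\<integral>\<^sup>+Y. F (snd Y $ i) * ennreal (ball_weight (lam - 1) (Y :: real \<times> (real ^ 'm))) \<partial>lborel)"
    using nn_integral_ball_weight_snd[of "lam - 1" "\<lambda>y::real^'m. F (y $ i)", where 'a=real] lam by simp
  also have "\<dots> = (\<integral>\<^sup>+Y. F (X \<bullet> Y) * ennreal (ball_weight (lam - 1) (Y :: real \<times> (real ^ 'm))) \<partial>lborel)"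
    by (simp add: X_def inner_Pair_0 inner_axis' cart_eq_inner_axis inner_commute)
  also have "\<dots> = ennreal (ball_mass m (lam - 1)) * (\<integral>\<^sup>+s. F s * ennreal (ball_weight (lam + m / 2 - 1) s) \<partial>lborel)"
    using nn_integral_zonal[of "lam - 1" X F] X lam by (simp add: m_def algebra_simps)
  also have "\<dots> = ennreal (ball_mass 1 (lam - 1)) *
    (ennreal (pi powr ((m - 1) / 2) * Gamma (lam + 1/2) / Gamma (lam + m / 2)) *
     (\<integral>\<^sup>+s. F s * ennreal (ball_weight (lam + m / 2 - 1) s) \<partial>lborel))"
    unfolding ball_mass_ratio[OF lam, of m, unfolded m_def, OF of_nat_0_le_iff] m_def
    using B by (subst ennreal_mult') (auto simp: mult.assoc)
  finally show ?thesis using B by (simp add: ennreal_mult_cancel_left)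
qed

text \<open>
  The norm of the extremal polynomial. For \<open>lam = 0\<close> the kernel is fixed and the weights vary, so Fatou's
  lemma gives the inequality that is needed.
\<close>
lemma nn_integral_zonal_coordinate:
  fixes i :: "'m::finite"
  assumes lam: "lam \<ge> 0"
  defines "m \<equiv> real CARD('m)"
  shows "(\<integral>\<^sup>+x. ennreal ((zonal (lam + m / 2) n (x $ i))\<^sup>2) * ennreal (ball_weight (lam - 1/2) (x :: real ^ 'm)) \<partial>lborel)
     \<le> ennreal (gegenbauer_mass m lam n)"
proof (cases "lam = 0")
  case False
  then have lam: "lam > 0" using lam by simp
  have "m > 0" by (simp add: m_def)
  have "0 \<le> pi powr ((m - 1) / 2) * Gamma (lam + 1/2) / Gamma (lam + m / 2)"
    using lam \<open>m > 0\<close> by (intro divide_nonneg_nonneg mult_nonneg_nonneg less_imp_le[OF Gamma_real_pos]) auto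
  from ennreal_mult'[OF this, of "zonal_mass (lam + m / 2) n"] show ?thesis
    using nn_integral_coordinate_ball_weight[OF lam, of "\<lambda>s. ennreal ((zonal (lam + m / 2) n s)\<^sup>2)" i] lam \<open>m > 0\<close>
    unfolding gegenbauer_mass_def by (simp add: m_def zonal_mass_nn_integral)
next
  case True
  have m: "m > 0" by (simp add: m_def)
  let ?F = "\<lambda>s. ennreal ((zonal (m / 2) n s)\<^sup>2)"
  let ?mu = "\<lambda>k. inverse (real (Suc k))"
  let ?c = "\<lambda>mu. pi powr ((m - 1) / 2) * Gamma (mu + 1/2) / Gamma (mu + m / 2)"
  have l: "?mu \<longlonglongrightarrow> 0" by (rule LIMSEQ_inverse_real_of_nat)
  have le: "(\<integral>\<^sup>+x. ?F (x $ i) * ennreal (ball_weight (?mu k - 1/2) (x :: real ^ 'm)) \<partial>lborel) \<le> ennreal (?c (?mu k) * zonal_mass (m / 2) n)" for k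
  proof -
    have "(\<integral>\<^sup>+x. ?F (x $ i) * ennreal (ball_weight (?mu k - 1/2) (x :: real ^ 'm)) \<partial>lborel) =
      ennreal (?c (?mu k)) * (\<integral>\<^sup>+s. ?F s * ennreal (ball_weight (?mu k + m / 2 - 1) s) \<partial>lborel)"
      unfolding m_def by (rule nn_integral_coordinate_ball_weight) auto
    also have "\<dots> \<le> ennreal (?c (?mu k)) * (\<integral>\<^sup>+s. ?F s * ennreal (ball_weight (m / 2 - 1) s) \<partial>lborel)"
      by (intro nn_integral_mono mult_left_mono ennreal_leI ball_weight_antimono) auto
    also have "\<dots> = ennreal (?c (?mu k)) * ennreal (zonal_mass (m / 2) n)"
      using m by (simp add: zonal_mass_nn_integral)
    also have "\<dots> = ennreal (?c (?mu k) * zonal_mass (m / 2) n)"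
      using zonal_mass_pos[of "m / 2" n] m by (intro ennreal_mult''[symmetric] less_imp_le) simp
    finally show ?thesis .
  qed
  have "(\<integral>\<^sup>+x. ?F (x $ i) * ennreal (ball_weight (0 - 1/2) (x :: real ^ 'm)) \<partial>lborel) =
     (\<integral>\<^sup>+x. liminf (\<lambda>k. ?F (x $ i) * ennreal (ball_weight (?mu k - 1/2) (x :: real ^ 'm))) \<partial>lborel)"
  proof (rule nn_integral_cong)
    fix x :: "real ^ 'm"
    have "(\<lambda>k. ball_weight (?mu k - 1/2) x) \<longlonglongrightarrow> ball_weight (0 - 1/2) x"
    proof (cases "norm x < 1")
      case True
      then show ?thesis unfolding ball_weight_def
        using norm_ge_zero[of x]
        by (intro tendsto_intros l) (auto simp: power2_eq_1_iff simp del: norm_ge_zero)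
    qed (simp add: ball_weight_def)
    then have "(\<lambda>k. ?F (x $ i) * ennreal (ball_weight (?mu k - 1/2) x)) \<longlonglongrightarrow> ?F (x $ i) * ennreal (ball_weight (0 - 1/2) x)"
      by (intro ennreal_tendsto_cmult tendsto_ennrealI) auto
    then show "?F (x $ i) * ennreal (ball_weight (0 - 1/2) x) = liminf (\<lambda>k. ?F (x $ i) * ennreal (ball_weight (?mu k - 1/2) x))"
      by (intro lim_imp_Liminf[symmetric]) auto
  qed
  also have "\<dots> \<le> liminf (\<lambda>k. \<integral>\<^sup>+x. ?F (x $ i) * ennreal (ball_weight (?mu k - 1/2) (x :: real ^ 'm)) \<partial>lborel)"
    by (rule nn_integral_liminf) measurable
  also have "\<dots> \<le> liminf (\<lambda>k. ennreal (?c (?mu k) * zonal_mass (m / 2) n))"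
    by (intro Liminf_mono always_eventually allI le)
  also have "\<dots> = ennreal (?c 0 * zonal_mass (m / 2) n)"
  proof (rule lim_imp_Liminf)
    show "(\<lambda>k. ennreal (?c (?mu k) * zonal_mass (m / 2) n)) \<longlonglongrightarrow> ennreal (?c 0 * zonal_mass (m / 2) n)"
      using m by (intro tendsto_intros tendsto_ennrealI l) (auto elim!: nonpos_Ints_cases simp: Gamma_eq_zero_iff)
  qed simp
  finally show ?thesis unfolding True by (simp add: gegenbauer_mass_def)
qed

lemma gegenbauer_mass_pos: "m > 0 \<Longrightarrow> lam \<ge> 0 \<Longrightarrow> gegenbauer_mass m lam n > 0"
  unfolding gegenbauer_mass_def by (intro mult_pos_pos divide_pos_pos zonal_mass_pos Gamma_real_pos) auto

lemma inverse_gegenbauer_mass: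
  assumes m: "m > 0" and lam: "lam \<ge> 0"
  shows "1 / gegenbauer_mass m lam n =
       (2 * lam + 2 * real n + m) * Gamma (2 * lam + real n + m) /
           (2 powr (2 * lam + m - 1) * pi powr ((m - 1) / 2) * (2 * lam + m) *
            Gamma (lam + 1/2) * Gamma (lam + m / 2) * fact n)"
proof -
  define p where "p = lam + m / 2"
  have p: "p > 0" using assms by (simp add: p_def add_nonneg_pos)
  have g1: "Gamma (p + real n + 1) = (p + n) * Gamma (p + n)" using p by (intro Gamma_real_plus1) simp
  have g2: "Gamma (p + 1) = p * Gamma p" using p by (intro Gamma_real_plus1) simp
  have two: "2 * 4 powr (p - 1) = 2 powr (2 * lam + m - 1)"
  proof -
    have "(4::real) powr (p - 1) = (2 powr 2) powr (p - 1)" by simp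
    also have "\<dots> = 2 powr (2 * (p - 1))" by (rule powr_powr)
    also have "2 * \<dots> = 2 powr (1 + 2 * (p - 1))" unfolding powr_add by simp
    also have "1 + 2 * (p - 1) = 2 * lam + m - 1" by (simp add: p_def)
    finally show ?thesis .
  qed
  have e: "2 * lam + 2 * real n + m = 2 * (p + n)" "2 * lam + m = 2 * p" "2 * lam + real n + m = n + p + p"
    by (simp_all add: p_def)
  have pos: "Gamma (p + n) \<noteq> 0" "Gamma p \<noteq> 0" "Gamma (n + p + p) \<noteq> 0" "Gamma (lam + 1/2) \<noteq> 0"
    using p lam by (auto intro!: less_imp_neq[THEN not_sym] Gamma_real_pos)
  show ?thesis
    unfolding gegenbauer_mass_def zonal_mass_def two p_def[symmetric] jacobi_mass_def g1 g2 e(1,3)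
    using pos p by (simp add: e(2) divide_simps)
qed

section \<open>The Nikolskii constant for polynomials\<close>

text \<open>
  On the unit sphere the weight vanishes by the convention \<open>0 powr a = 0\<close>, so the two integrands agree
  everywhere.
\<close>
lemma nn_integral_lebesgue_on_cball:
  fixes F :: "real ^ 'm \<Rightarrow> complex"
  assumes [measurable]: "F \<in> borel_measurable borel"
  shows "(\<integral>\<^sup>+x. ennreal (cmod (F x) powr 2) * gegenbauer_weight lam x \<partial>lebesgue_on (cball 0 1)) =
     (\<integral>\<^sup>+x. ennreal ((cmod (F x))\<^sup>2) * ennreal (ball_weight (lam - 1/2) x) \<partial>lborel)"
proof -
  have "(\<integral>\<^sup>+x. ennreal (cmod (F x) powr 2) * gegenbauer_weight lam x \<partial>lebesgue_on (cball 0 1)) =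
     (\<integral>\<^sup>+x. ennreal (cmod (F x) powr 2) * gegenbauer_weight lam x * indicator (cball 0 1) x \<partial>lebesgue)"
    by (rule nn_integral_restrict_space) simp
  also have "\<dots> = (\<integral>\<^sup>+x. ennreal ((cmod (F x))\<^sup>2) * ennreal (ball_weight (lam - 1/2) x) \<partial>lebesgue)"
  proof (rule nn_integral_cong)
    fix x :: "real ^ 'm"
    have "norm x = 1 \<Longrightarrow> gegenbauer_weight lam x = 0" by (simp add: gegenbauer_weight_def)
    then show "ennreal (cmod (F x) powr 2) * gegenbauer_weight lam x * indicator (cball 0 1) x =
       ennreal ((cmod (F x))\<^sup>2) * ennreal (ball_weight (lam - 1/2) x)"
      by (cases "norm x = 1") (auto simp: gegenbauer_weight_def ball_weight_def indicator_def)
  qed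
  also have "\<dots> = (\<integral>\<^sup>+x. ennreal ((cmod (F x))\<^sup>2) * ennreal (ball_weight (lam - 1/2) x) \<partial>lborel)"
    by (rule nn_integral_completion) measurable
  finally show ?thesis .
qed

lemma wnorm_two:
  "wnorm 2 W \<Omega> F = (let I = (\<integral>\<^sup>+x. ennreal (cmod (F x) powr 2) * W x \<partial>lebesgue_on \<Omega>)
     in if I = \<infinity> then \<infinity> else ennreal (sqrt (enn2real I)))"
  by (simp add: wnorm_def Let_def powr_half_sqrt)

lemma ennreal_le_wnorm_two:
  assumes "ennreal (g * b\<^sup>2) \<le> (\<integral>\<^sup>+x. ennreal (cmod (F x) powr 2) * W x \<partial>lebesgue_on \<Omega>)" "b \<ge> 0" "g > 0"
  shows "ennreal b \<le> ennreal (sqrt (1 / g)) * wnorm 2 W \<Omega> F"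
proof -
  let ?I = "\<integral>\<^sup>+x. ennreal (cmod (F x) powr 2) * W x \<partial>lebesgue_on \<Omega>"
  show ?thesis
  proof (cases "?I = \<infinity>")
    case True
    then show ?thesis using assms by (simp add: wnorm_two ennreal_mult_top)
  next
    case False
    then obtain r where r: "?I = ennreal r" "r \<ge> 0" by (cases ?I) auto
    with assms have "g * b\<^sup>2 \<le> r" by simp
    then have "b\<^sup>2 \<le> 1 / g * r" using assms by (simp add: field_simps)
    then have "b \<le> sqrt (1 / g * r)" by (rule real_le_rsqrt)
    then have "b \<le> sqrt (1 / g) * sqrt r" by (simp only: real_sqrt_mult)
    then have "ennreal b \<le> ennreal (sqrt (1 / g) * sqrt r)" by (rule ennreal_leI)
    also have "\<dots> = ennreal (sqrt (1 / g)) * wnorm 2 W \<Omega> F"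
      using False r assms by (simp add: wnorm_two ennreal_mult)
    finally show ?thesis .
  qed
qed

lemma wnorm_two_le:
  assumes "(\<integral>\<^sup>+x. ennreal (cmod (F x) powr 2) * W x \<partial>lebesgue_on \<Omega>) \<le> ennreal g" "g \<ge> 0"
  shows "wnorm 2 W \<Omega> F \<le> ennreal (sqrt g)"
proof -
  let ?I = "\<integral>\<^sup>+x. ennreal (cmod (F x) powr 2) * W x \<partial>lebesgue_on \<Omega>"
  have fin: "?I \<noteq> \<infinity>" using assms(1) by (auto simp: top_unique)
  then obtain r where r: "?I = ennreal r" "r \<ge> 0" by (cases ?I) auto
  then have "r \<le> g" using assms by simp
  then show ?thesis using fin r by (simp add: wnorm_two ennreal_leI)
qed

lemma ennreal_divide_le:
  fixes a w :: ennreal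
  assumes "a \<le> ennreal c * w" "c \<ge> 0"
  shows "a / w \<le> ennreal c"
proof (cases "w = 0 \<or> w = \<infinity>")
  case True
  then show ?thesis using assms by (auto simp: ennreal_divide_top)
next
  case False
  have "a / w \<le> ennreal c * w / w" using assms by (intro divide_right_mono_ennreal)
  also have "\<dots> = ennreal c" using False by (simp add: ennreal_mult_divide_eq top.not_eq_extremum)
  finally show ?thesis .
qed

lemma ennreal_inverse_antimono:
  fixes x y :: ennreal
  assumes "x \<le> y" shows "inverse y \<le> inverse x"
proof (cases "x = 0 \<or> y = top")
  case False
  then obtain r s where "x = ennreal r" "r > 0" "y = ennreal s" "s \<ge> 0"
    by (cases x; cases y) (use assms in \<open>auto simp: less_le top_unique\<close>)
  with assms show ?thesis
    by (auto simp: inverse_ennreal intro!: ennreal_leI le_imp_inverse_le)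
qed auto

lemma ennreal_le_divide:
  fixes a w :: ennreal
  assumes "1 \<le> a" "w \<le> ennreal (sqrt g)" "g > 0"
  shows "ennreal (sqrt (1 / g)) \<le> a / w"
proof -
  have "ennreal (sqrt (1 / g)) = 1 / ennreal (sqrt g)"
    using assms(3) by (simp add: real_sqrt_divide divide_ennreal[symmetric])
  also have "\<dots> \<le> a / w"
  proof -
    have "inverse (ennreal (sqrt g)) \<le> inverse w"
      using assms(2) by (rule ennreal_inverse_antimono)
    then show ?thesis unfolding divide_ennreal_def using assms(1) by (intro mult_mono) auto
  qed
  finally show ?thesis .
qed

text \<open>
  Every point of the closed ball is a limit of interior points, so a continuous function that exceeds a bound there
  exceeds it on a set of positive measure.
\<close>
lemma esssup_lebesgue_on_cball_ge:
  fixes h :: "'a::euclidean_space \<Rightarrow> complex"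
  assumes h: "continuous_on UNIV h" and e: "norm e \<le> 1"
  shows "ennreal (cmod (h e)) \<le> linf_norm (cball 0 1) h"
proof (rule ccontr)
  assume "\<not> ?thesis"
  then have lt: "linf_norm (cball 0 1) h < ennreal (cmod (h e))" by simp
  then obtain c where c: "linf_norm (cball 0 1) h = ennreal c" "c \<ge> 0"
    by (cases "linf_norm (cball 0 1) h") auto
  with lt have ce: "c < cmod (h e)" by (simp add: ennreal_less_iff)
  have [measurable]: "h \<in> borel_measurable borel"
    using h by (rule borel_measurable_continuous_onI)
  have "AE x in lebesgue_on (cball 0 1). ennreal (cmod (h x)) \<le> linf_norm (cball 0 1) h"
    unfolding linf_norm_def by (rule esssup_AE)
  then have "AE x in lebesgue. x \<in> cball 0 1 \<longrightarrow> cmod (h x) \<le> c"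
    unfolding c(1) by (subst (asm) AE_restrict_space_iff) (auto simp: c(2))
  then have AE: "AE x in lborel. x \<in> cball 0 1 \<longrightarrow> cmod (h x) \<le> c"
    by (subst (asm) AE_completion_iff) auto
  define U where "U = {x. cmod (h x) > c} \<inter> ball 0 1"
  have opn: "open {x. cmod (h x) > c}"
    using h by (intro open_Collect_less continuous_intros)
  then have "open U" by (simp add: U_def open_Int)
  moreover have "U \<noteq> {}"
  proof -
    have "e \<in> closure (ball 0 1)" using e by (subst closure_ball) auto
    then have "{x. cmod (h x) > c} \<inter> ball 0 1 \<noteq> {}"
      using open_Int_closure_eq_empty[OF opn, of "ball 0 1"] ce by blast
    then show ?thesis by (simp add: U_def)
  qed
  ultimately have "\<not> negligible U" by (rule open_not_negligible)
  moreover have "negligible U"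
  proof -
    have "AE x in lborel. x \<notin> U" using AE by eventually_elim (auto simp: U_def)
    then have "U \<in> null_sets lborel" using \<open>open U\<close> AE_iff_null_sets[of U lborel] by auto
    then show ?thesis by (simp add: negligible_iff_null_sets null_sets_completionI)
  qed
  ultimately show False by simp
qed

lemma coordinate_poly_in_polys:
  fixes i :: "'m::finite"
  assumes q: "degree q \<le> n"
  shows "(\<lambda>x :: real ^ 'm. complex_of_real (poly q (x $ i))) \<in> polys n"
proof -
  define e where "e k = (\<lambda>j::'m. if j = i then k else 0 :: nat)" for k
  define c where "c \<alpha> = (if \<alpha> \<in> e ` {..n} then complex_of_real (coeff q (\<alpha> i)) else 0)" for \<alpha>
  have inj: "inj_on e {..n}"
    by (rule inj_onI) (metis e_def)
  have sub: "e ` {..n} \<subseteq> multiindices n"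
    by (auto simp: multiindices_def e_def)
  have "complex_of_real (poly q (x $ i)) =
      (\<Sum>\<alpha>\<in>multiindices n. c \<alpha> * (\<Prod>j\<in>UNIV. complex_of_real (x $ j) ^ \<alpha> j))" for x :: "real ^ 'm"
  proof -
    have "(\<Sum>\<alpha>\<in>multiindices n. c \<alpha> * (\<Prod>j\<in>UNIV. complex_of_real (x $ j) ^ \<alpha> j)) =
       (\<Sum>\<alpha>\<in>e ` {..n}. c \<alpha> * (\<Prod>j\<in>UNIV. complex_of_real (x $ j) ^ \<alpha> j))"
      by (rule sum.mono_neutral_right[OF finite_multiindices sub]) (auto simp: c_def)
    also have "\<dots> = (\<Sum>k\<le>n. c (e k) * (\<Prod>j\<in>UNIV. complex_of_real (x $ j) ^ e k j))"
      by (simp add: sum.reindex[OF inj])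
    also have "\<dots> = (\<Sum>k\<le>n. complex_of_real (coeff q k) * complex_of_real (x $ i) ^ k)"
    proof (rule sum.cong)
      fix k assume k: "k \<in> {..n}"
      have "(\<Prod>j\<in>UNIV. complex_of_real (x $ j) ^ e k j) = (\<Prod>j\<in>UNIV. if j = i then complex_of_real (x $ i) ^ k else 1)"
        by (rule prod.cong) (auto simp: e_def)
      also have "\<dots> = complex_of_real (x $ i) ^ k" by simp
      finally show "c (e k) * (\<Prod>j\<in>UNIV. complex_of_real (x $ j) ^ e k j) = complex_of_real (coeff q k) * complex_of_real (x $ i) ^ k"
        using k by (simp add: c_def) (simp add: e_def)
    qed simp
    finally show ?thesis by (simp add: poly_eq_sum_coeff[OF q])
  qed
  then show ?thesis by (auto simp: polys_def)
qed

lemma borel_measurable_lebesgue_on: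
  "f \<in> borel_measurable borel \<Longrightarrow> f \<in> borel_measurable (lebesgue_on S)"
  by (intro measurable_restrict_space1 measurable_completion) simp

text \<open>
  The supremum is attained by the zonal kernel in one coordinate, at the corresponding basis vector.
\<close>
theorem nikolskii_polys:
  fixes lam :: real
  assumes lam: "lam \<ge> 0"
  shows "nikolskii (polys n :: (real ^ 'm \<Rightarrow> complex) set) 2 (gegenbauer_weight lam) (cball 0 1) =
     ennreal (sqrt (1 / gegenbauer_mass (real CARD('m)) lam n))"
proof (rule antisym)
  let ?g = "gegenbauer_mass (real CARD('m)) lam n"
  have g: "?g > 0" using lam by (intro gegenbauer_mass_pos) auto
  show "nikolskii (polys n :: (real ^ 'm \<Rightarrow> complex) set) 2 (gegenbauer_weight lam) (cball 0 1) \<le> ennreal (sqrt (1 / ?g))"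
    unfolding nikolskii_def
  proof (rule SUP_least)
    fix h :: "real ^ 'm \<Rightarrow> complex"
    assume "h \<in> {h \<in> polys n. \<exists>x\<in>cball 0 1. h x \<noteq> 0}"
    then have P: "h \<in> polys n" by simp
    have m[measurable]: "h \<in> borel_measurable borel"
      using polyfun_continuous[OF polyfun_polys[OF P]] by (rule borel_measurable_continuous_onI)
    have le: "ennreal (cmod (h x)) \<le> ennreal (sqrt (1 / ?g)) * wnorm 2 (gegenbauer_weight lam) (cball 0 1) h"
      if "norm x \<le> 1" for x
      by (rule ennreal_le_wnorm_two)
         (use polys_ball_bound[OF P lam that] g nn_integral_lebesgue_on_cball[OF m] in auto)
    have "linf_norm (cball 0 1) h \<le> ennreal (sqrt (1 / ?g)) * wnorm 2 (gegenbauer_weight lam) (cball 0 1) h"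
      unfolding linf_norm_def
    proof (rule esssup_I)
      have [measurable]: "h \<in> borel_measurable (lebesgue_on (cball 0 1))"
        by (rule borel_measurable_lebesgue_on[OF m])
      show "(\<lambda>x. ennreal (cmod (h x))) \<in> borel_measurable (lebesgue_on (cball 0 1))" by measurable
    qed (auto intro!: AE_I2 le)
    then show "linf_norm (cball 0 1) h / wnorm 2 (gegenbauer_weight lam) (cball 0 1) h \<le> ennreal (sqrt (1 / ?g))"
      using g by (intro ennreal_divide_le) auto
  qed
  obtain i :: 'm where True by simp
  define p where "p = lam + real CARD('m) / 2"
  define h where "h = (\<lambda>x :: real ^ 'm. complex_of_real (zonal p n (x $ i)))"
  have P: "h \<in> polys n"
    using coordinate_poly_in_polys[OF degree_zonal_poly, of p n i] by (simp add: h_def poly_zonal_poly)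
  have cont: "continuous_on UNIV h" by (rule polyfun_continuous[OF polyfun_polys[OF P]])
  then have m: "h \<in> borel_measurable borel" by (rule borel_measurable_continuous_onI)
  have h1: "h (axis i 1) = 1" by (simp add: h_def zonal_1)
  have "ennreal (sqrt (1 / ?g)) \<le> linf_norm (cball 0 1) h / wnorm 2 (gegenbauer_weight lam) (cball 0 1) h"
  proof (rule ennreal_le_divide)
    show "1 \<le> linf_norm (cball 0 1) h"
      using esssup_lebesgue_on_cball_ge[OF cont, of "axis i 1"] by (simp add: h1)
    show "wnorm 2 (gegenbauer_weight lam) (cball 0 1) h \<le> ennreal (sqrt ?g)"
      by (rule wnorm_two_le)
         (use nn_integral_zonal_coordinate[OF lam, of n i] g nn_integral_lebesgue_on_cball[OF m]
          in \<open>auto simp: h_def p_def\<close>)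
  qed (rule g)
  also have "\<dots> \<le> nikolskii (polys n :: (real ^ 'm \<Rightarrow> complex) set) 2 (gegenbauer_weight lam) (cball 0 1)"
    unfolding nikolskii_def
    by (rule SUP_upper2[of h]) (use P h1 in \<open>auto intro!: bexI[of _ "axis i 1"]\<close>)
  finally show "ennreal (sqrt (1 / ?g)) \<le> nikolskii (polys n :: (real ^ 'm \<Rightarrow> complex) set) 2 (gegenbauer_weight lam) (cball 0 1)" .
qed

section \<open>A radial extremal function of exponential type\<close>

text \<open>
  The Taylor coefficients in \<open>r\<^sup>2\<close> of \<open>\<Gamma> (\<nu> + 1) * (2 / r) powr \<nu> * J\<^sub>\<nu> r\<close>.
\<close>
definition bessel_coeff :: "real \<Rightarrow> nat \<Rightarrow> real"
  where "bessel_coeff nu k = (-1) ^ k / (4 ^ k * pochhammer (nu + 1) k * fact k)"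

definition bessel_entire :: "real \<Rightarrow> complex \<Rightarrow> complex"
  where "bessel_entire nu w = (\<Sum>k. of_real (bessel_coeff nu k) * w ^ k)"

text \<open>
  Comparison with the case \<open>nu = - 1/2\<close>, where the series is that of the cosine.
\<close>
lemma norm_bessel_coeff_le:
  assumes "nu \<ge> 0"
  shows "\<bar>bessel_coeff nu k\<bar> \<le> 1 / fact (2 * k)"
proof -
  have "fact (2 * k) = 4 ^ k * pochhammer (1 / 2) k * (fact k :: real)"
    by (simp add: fact_double power_mult)
  also have "\<dots> \<le> 4 ^ k * pochhammer (nu + 1) k * fact k"
    unfolding pochhammer_prod using assms
    by (intro mult_right_mono mult_left_mono prod_mono) auto
  finally have le: "fact (2 * k) \<le> 4 ^ k * pochhammer (nu + 1) k * (fact k :: real)" .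
  moreover have "pochhammer (nu + 1) k > 0" using assms by (intro pochhammer_pos) simp
  ultimately show ?thesis
    unfolding bessel_coeff_def by (simp add: abs_mult frac_le)
qed

lemma sum_even_le_exp:
  assumes "r \<ge> 0"
  shows "(\<Sum>k<N. r ^ (2 * k) / fact (2 * k)) \<le> exp (r :: real)"
proof -
  have "(\<Sum>k<N. r ^ (2 * k) / fact (2 * k)) \<le> (\<Sum>i<2 * N. r ^ i / fact i)"
    using assms by (induction N) (auto intro!: add_mono_thms_linordered_semiring(1) add_increasing2 divide_nonneg_nonneg)
  also have "\<dots> \<le> (\<Sum>i. r ^ i / fact i)"
    using assms summable_exp[of r] by (intro sum_le_suminf) (auto simp: field_simps)
  also have "\<dots> = exp r" by (simp add: exp_def divide_inverse mult.commute scaleR_conv_of_real)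
  finally show ?thesis .
qed

lemma bessel_entire_norm_summable:
  fixes w :: complex
  assumes "nu \<ge> 0"
  shows "summable (\<lambda>k. norm (of_real (bessel_coeff nu k) * w ^ k))"
    and "(\<Sum>k. norm (of_real (bessel_coeff nu k) * w ^ k)) \<le> exp (sqrt (norm w))"
proof -
  let ?f = "\<lambda>k. norm (of_real (bessel_coeff nu k) * w ^ k)"
  have le: "?f k \<le> sqrt (norm w) ^ (2 * k) / fact (2 * k)" for k
  proof -
    have "?f k = \<bar>bessel_coeff nu k\<bar> * norm w ^ k" by (simp add: norm_mult norm_power)
    also have "\<dots> \<le> 1 / fact (2 * k) * norm w ^ k"
      by (intro mult_right_mono norm_bessel_coeff_le assms) simp
    also have "norm w ^ k = sqrt (norm w) ^ (2 * k)" by (simp add: power_mult)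
    finally show ?thesis by simp
  qed
  have b: "(\<Sum>k<N. ?f k) \<le> exp (sqrt (norm w))" for N
    by (rule order_trans[OF sum_mono[OF le] sum_even_le_exp]) simp
  show s: "summable ?f" by (rule summableI_nonneg_bounded[OF _ b]) simp
  show "(\<Sum>k. ?f k) \<le> exp (sqrt (norm w))" by (rule suminf_le_const[OF s b])
qed

lemma norm_bessel_entire_le:
  "nu \<ge> 0 \<Longrightarrow> norm (bessel_entire nu w) \<le> exp (sqrt (norm w))"
  unfolding bessel_entire_def
  by (rule order_trans[OF summable_norm bessel_entire_norm_summable(2)])
     (auto intro: bessel_entire_norm_summable)

lemma bessel_entire_has_derivative:
  assumes "nu \<ge> 0"
  obtains D where "(bessel_entire nu has_field_derivative D) (at w)"
proof -
  have "summable (\<lambda>k. of_real (bessel_coeff nu k) * y ^ k)" for y :: complex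
    by (rule summable_norm_cancel[OF bessel_entire_norm_summable(1)[OF assms]])
  from termdiffs_strong_converges_everywhere[OF this, of w] that show thesis
    unfolding bessel_entire_def[abs_def] by blast
qed

lemma bessel_entire_0: "bessel_entire nu 0 = 1"
proof -
  have "bessel_entire nu 0 = (\<Sum>k\<in>{0}. of_real (bessel_coeff nu k) * 0 ^ k)"
    unfolding bessel_entire_def by (rule suminf_finite) auto
  then show ?thesis by (simp add: bessel_coeff_def)
qed

definition bessel_radial :: "real \<Rightarrow> complex ^ 'm \<Rightarrow> complex"
  where "bessel_radial nu z = bessel_entire nu (\<Sum>j\<in>UNIV. z $ j * z $ j)"

lemma bdd_above_dual_norm:
  "bdd_above ((\<lambda>t. cmod (\<Sum>j\<in>UNIV. complex_of_real (t $ j) * z $ j)) ` cball (0 :: real ^ 'm) 1)"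
proof (rule bdd_aboveI2)
  fix t :: "real ^ 'm" assume t: "t \<in> cball 0 1"
  have "cmod (\<Sum>j\<in>UNIV. complex_of_real (t $ j) * z $ j) \<le> (\<Sum>j\<in>UNIV. cmod (complex_of_real (t $ j) * z $ j))"
    by (rule norm_sum)
  also have "\<dots> \<le> (\<Sum>j\<in>UNIV. cmod (z $ j))"
  proof (rule sum_mono)
    fix j
    have "\<bar>t $ j\<bar> \<le> 1" using component_le_norm_cart[of t j] t by simp
    then show "cmod (complex_of_real (t $ j) * z $ j) \<le> cmod (z $ j)"
      by (simp add: norm_mult mult_left_le_one_le)
  qed
  finally show "cmod (\<Sum>j\<in>UNIV. complex_of_real (t $ j) * z $ j) \<le> (\<Sum>j\<in>UNIV. cmod (z $ j))" .
qed

lemma dual_norm_upper: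
  assumes "norm t \<le> 1"
  shows "cmod (\<Sum>j\<in>UNIV. complex_of_real (t $ j) * z $ j) \<le> dual_norm z"
  unfolding dual_norm_def by (rule cSUP_upper[OF _ bdd_above_dual_norm]) (use assms in simp)

text \<open>
  A unimodular factor makes \<open>\<Sum> z\<^sub>j\<^sup>2\<close> real and nonnegative. With \<open>z = a + \<i> b\<close> for real vectors \<open>a\<close> and \<open>b\<close> it is
  then \<open>\<bar>a\<bar>\<^sup>2 - \<bar>b\<bar>\<^sup>2\<close>, hence at most \<open>\<bar>a\<bar>\<^sup>2\<close>, and the direction of \<open>a\<close> shows that \<open>\<bar>a\<bar>\<close> is at most the dual norm.
\<close>
lemma sqrt_sum_squares_le_dual_norm:
  fixes z :: "complex ^ 'm"
  shows "sqrt (cmod (\<Sum>j\<in>UNIV. z $ j * z $ j)) \<le> dual_norm z"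
proof (cases "(\<Sum>j\<in>UNIV. z $ j * z $ j) = 0")
  case True
  have "0 \<le> cmod (\<Sum>j\<in>UNIV. complex_of_real ((0 :: real ^ 'm) $ j) * z $ j)" by simp
  also have "\<dots> \<le> dual_norm z" by (rule dual_norm_upper) simp
  finally show ?thesis using True by simp
next
  case False
  define s where "s = (\<Sum>j\<in>UNIV. z $ j * z $ j)"
  define u where "u = csqrt (cnj s / cmod s)"
  have s: "s \<noteq> 0" using False by (simp add: s_def)
  have u2: "u\<^sup>2 = cnj s / cmod s" by (simp add: u_def)
  have "cmod u ^ 2 = 1" using s unfolding norm_power[symmetric] u2 by (simp add: norm_divide)
  then have u1: "cmod u = 1" using power2_eq_1_iff norm_ge_zero[of u] by (metis abs_of_nonneg abs_1 power2_eq_iff one_power2 real_sqrt_abs real_sqrt_one)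
  define a :: "real ^ 'm" where "a = (\<chi> j. Re (u * z $ j))"
  define b :: "real ^ 'm" where "b = (\<chi> j. Im (u * z $ j))"
  have "(\<Sum>j\<in>UNIV. (u * z $ j) * (u * z $ j)) = u\<^sup>2 * s"
    by (simp add: s_def sum_distrib_left power2_eq_square mult_ac)
  also have "\<dots> = of_real (cmod s)"
  proof -
    have "cnj s * s = of_real ((cmod s)\<^sup>2)"
      unfolding complex_norm_square by (simp add: mult.commute)
    then show ?thesis using s unfolding u2 by (simp add: power2_eq_square)
  qed
  finally have "Re (\<Sum>j\<in>UNIV. (u * z $ j) * (u * z $ j)) = cmod s" by simp
  then have "(\<Sum>j\<in>UNIV. (a $ j)\<^sup>2) - (\<Sum>j\<in>UNIV. (b $ j)\<^sup>2) = cmod s"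
    by (simp add: a_def b_def power2_eq_square sum_subtractf)
  moreover have "(\<Sum>j\<in>UNIV. (b $ j)\<^sup>2) \<ge> 0" by (intro sum_nonneg) auto
  ultimately have A: "(\<Sum>j\<in>UNIV. (a $ j)\<^sup>2) \<ge> cmod s" by linarith
  have na: "norm a = sqrt (\<Sum>j\<in>UNIV. (a $ j)\<^sup>2)" by (simp add: norm_vec_def L2_set_def)
  then have na2: "(norm a)\<^sup>2 = (\<Sum>j\<in>UNIV. (a $ j)\<^sup>2)" by (simp add: sum_nonneg)
  have "cmod s > 0" using s by simp
  with A have "(\<Sum>j\<in>UNIV. (a $ j)\<^sup>2) > 0" by linarith
  then have apos: "norm a > 0" by (simp only: na real_sqrt_gt_0_iff)
  have "sqrt (cmod s) \<le> norm a" unfolding na using A by (rule real_sqrt_le_mono)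
  also have "norm a = Re (\<Sum>j\<in>UNIV. complex_of_real ((a /\<^sub>R norm a) $ j) * (u * z $ j))"
  proof -
    have "Re (\<Sum>j\<in>UNIV. complex_of_real ((a /\<^sub>R norm a) $ j) * (u * z $ j)) = (\<Sum>j\<in>UNIV. inverse (norm a) * (a $ j)\<^sup>2)"
    proof -
      have re: "Re (complex_of_real x * w) = x * Re w" for x w by simp
      have aj: "Re (u * z $ j) = a $ j" for j by (simp add: a_def)
      show ?thesis
        unfolding Re_sum re aj by (simp add: power2_eq_square mult.assoc)
    qed
    also have "\<dots> = inverse (norm a) * (norm a)\<^sup>2" by (simp add: na2 sum_distrib_left)
    also have "\<dots> = norm a" using apos by (simp add: power2_eq_square)
    finally show ?thesis ..
  qed
  also have "\<dots> \<le> cmod (\<Sum>j\<in>UNIV. complex_of_real ((a /\<^sub>R norm a) $ j) * (u * z $ j))"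
    by (rule complex_Re_le_cmod)
  also have "(\<Sum>j\<in>UNIV. complex_of_real ((a /\<^sub>R norm a) $ j) * (u * z $ j)) =
      u * (\<Sum>j\<in>UNIV. complex_of_real ((a /\<^sub>R norm a) $ j) * z $ j)"
    by (simp add: sum_distrib_left mult_ac)
  also have "cmod \<dots> = cmod (\<Sum>j\<in>UNIV. complex_of_real ((a /\<^sub>R norm a) $ j) * z $ j)"
    by (simp add: norm_mult u1)
  also have "\<dots> \<le> dual_norm z"
    by (rule dual_norm_upper) (use apos in simp)
  finally show ?thesis by (simp add: s_def)
qed

lemma bessel_radial_exp_type:
  assumes "nu \<ge> 0"
  shows "(bessel_radial nu :: complex ^ 'm \<Rightarrow> complex) \<in> exp_type_ball"
proof -
  have "entire (bessel_radial nu :: complex ^ 'm \<Rightarrow> complex)"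
    unfolding entire_def
  proof
    fix z :: "complex ^ 'm"
    obtain D where D: "(bessel_entire nu has_field_derivative D) (at (\<Sum>j\<in>UNIV. z $ j * z $ j))"
      using bessel_entire_has_derivative[OF assms] by blast
    have sq: "((\<lambda>z :: complex ^ 'm. \<Sum>j\<in>UNIV. z $ j * z $ j) has_derivative (\<lambda>h. \<Sum>j\<in>UNIV. z $ j * h $ j + h $ j * z $ j)) (at z)"
      by (intro has_derivative_sum has_derivative_mult bounded_linear.has_derivative[OF bounded_linear_vec_nth] has_derivative_ident)
    have "(bessel_radial nu has_derivative (\<lambda>h. D * (\<Sum>j\<in>UNIV. z $ j * h $ j + h $ j * z $ j))) (at z)"
      unfolding bessel_radial_def[abs_def]
      using has_derivative_compose[OF sq D[unfolded has_field_derivative_def]] by simp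
    also have "(\<lambda>h. D * (\<Sum>j\<in>UNIV. z $ j * h $ j + h $ j * z $ j)) = (\<lambda>h. \<Sum>j\<in>UNIV. (\<chi> j. 2 * D * z $ j) $ j * h $ j)"
      by (simp add: sum_distrib_left fun_eq_iff algebra_simps)
    finally show "\<exists>a. (bessel_radial nu has_derivative (\<lambda>h. \<Sum>j\<in>UNIV. a $ j * h $ j)) (at z)" by blast
  qed
  moreover have "\<exists>C>0. \<forall>z :: complex ^ 'm. cmod (bessel_radial nu z) \<le> C * exp ((1 + \<epsilon>) * dual_norm z)" if "\<epsilon> > 0" for \<epsilon> :: real
  proof (intro exI[of _ 1] conjI allI)
    fix z :: "complex ^ 'm"
    have le: "sqrt (cmod (\<Sum>j\<in>UNIV. z $ j * z $ j)) \<le> dual_norm z" by (rule sqrt_sum_squares_le_dual_norm)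
    have "0 \<le> sqrt (cmod (\<Sum>j\<in>UNIV. z $ j * z $ j))" by simp
    with le have dn: "0 \<le> dual_norm z" by linarith
    have "cmod (bessel_radial nu z) \<le> exp (sqrt (cmod (\<Sum>j\<in>UNIV. z $ j * z $ j)))"
      unfolding bessel_radial_def by (rule norm_bessel_entire_le[OF assms])
    also have "\<dots> \<le> exp ((1 + \<epsilon>) * dual_norm z)"
      using le dn that by (simp add: distrib_right add_increasing2)
    finally show "cmod (bessel_radial nu z) \<le> 1 * exp ((1 + \<epsilon>) * dual_norm z)" by simp
  qed simp
  ultimately show ?thesis by (simp add: exp_type_ball_def)
qed

lemma restrict_bessel_radial:
  "restrict_real (bessel_radial nu) t = bessel_entire nu (of_real ((norm t)\<^sup>2))"
proof -
  have "(norm t)\<^sup>2 = (\<Sum>j\<in>UNIV. t $ j * t $ j)"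
    by (simp add: norm_vec_def L2_set_def sum_nonneg power2_eq_square)
  then show ?thesis by (simp add: restrict_real_def bessel_radial_def)
qed

text \<open>
  Term by term, \<open>(n choose k) * pochhammer (n + nu + 1) k\<close> grows like \<open>n ^ (2 k) / k!\<close>; the passage to the limit
  under the sum is Tannery's theorem.
\<close>
lemma jacobi_kernel_tendsto_bessel:
  assumes nu: "nu \<ge> 0"
  shows "(\<lambda>n. complex_of_real (poly (jacobi_kernel nu 1 (Suc n)) (r\<^sup>2 / (2 * real (Suc n))\<^sup>2))) \<longlonglongrightarrow>
     bessel_entire nu (of_real (r\<^sup>2))"
proof -
  define a where "a k n = complex_of_real ((-1) ^ k * of_nat (Suc n choose k) *
     (pochhammer (real (Suc n) + nu + 1) k / pochhammer (nu + 1) k) * (r\<^sup>2 / (2 * real (Suc n))\<^sup>2) ^ k)" for k n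
  have sum: "complex_of_real (poly (jacobi_kernel nu 1 (Suc n)) (r\<^sup>2 / (2 * real (Suc n))\<^sup>2)) = (\<Sum>k. a k n)" for n
  proof -
    have "(\<Sum>k. a k n) = (\<Sum>k\<le>Suc n. a k n)"
      by (rule suminf_finite) (auto simp: a_def binomial_eq_0)
    then show ?thesis by (simp add: jacobi_kernel_def poly_sum poly_monom a_def)
  qed
  have ppos: "pochhammer (nu + 1) k \<ge> 1" for k
  proof -
    have "(1::real) \<le> fact k" by simp
    also have "\<dots> = pochhammer 1 k" by (rule pochhammer_fact)
    also have "\<dots> \<le> pochhammer (nu + 1) k"
      unfolding pochhammer_prod using nu by (intro prod_mono) auto
    finally show ?thesis .
  qed
  have lim: "(\<lambda>n. a k n) \<longlonglongrightarrow> of_real (bessel_coeff nu k) * of_real (r\<^sup>2) ^ k" for k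
  proof -
    define N where "N n = real (Suc n)" for n
    have Ninf: "filterlim N at_top sequentially"
      unfolding N_def by (rule filterlim_compose[OF filterlim_real_sequentially filterlim_Suc])
    have eq: "a k n = of_real ((-1) ^ k * ((\<Prod>i=0..<k. (N n - real i) / N n) / fact k) * ((\<Prod>i=0..<k. (N n + nu + 1 + real i) / N n) / pochhammer (nu + 1) k) * (r\<^sup>2 / 4) ^ k)" for n
    proof -
      have N: "N n > 0" by (simp add: N_def)
      have C: "real (Suc n choose k) = (\<Prod>i=0..<k. N n - real i) / fact k"
        unfolding N_def binomial_gbinomial gbinomial_prod_rev ..
      have P: "pochhammer (N n + nu + 1) k = (\<Prod>i=0..<k. N n + nu + 1 + real i)"
        by (rule pochhammer_prod)
      have R: "(r\<^sup>2 / (2 * N n)\<^sup>2) ^ k = (r\<^sup>2 / 4) ^ k / (N n ^ k * N n ^ k)"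
        by (simp add: power_divide power_mult_distrib power2_eq_square)
      have c: "card {0..<k} = k" by simp
      show ?thesis
        unfolding a_def N_def[symmetric] C P R prod_dividef prod_constant c
        by (rule arg_cong[where f = of_real]) simp
    qed
    have t1: "(\<lambda>n. (N n - real i) / N n) \<longlonglongrightarrow> 1" for i
      by (rule filterlim_compose[OF _ Ninf]) real_asymp
    have t2: "(\<lambda>n. (N n + nu + 1 + real i) / N n) \<longlonglongrightarrow> 1" for i
      by (rule filterlim_compose[OF _ Ninf]) real_asymp
    have "(\<lambda>n. (-1) ^ k * ((\<Prod>i=0..<k. (N n - real i) / N n) / fact k) * ((\<Prod>i=0..<k. (N n + nu + 1 + real i) / N n) / pochhammer (nu + 1) k) * (r\<^sup>2 / 4) ^ k)
       \<longlonglongrightarrow> (-1) ^ k * ((\<Prod>i=0..<k. 1) / fact k) * ((\<Prod>i=0..<k. 1) / pochhammer (nu + 1) k) * (r\<^sup>2 / 4) ^ k"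
      using ppos[of k] by (intro tendsto_intros tendsto_prod t1 t2) auto
    also have "(-1) ^ k * ((\<Prod>i=0..<k. 1) / fact k) * ((\<Prod>i=0..<k. 1) / pochhammer (nu + 1) k) * (r\<^sup>2 / 4) ^ k = bessel_coeff nu k * (r\<^sup>2) ^ k"
      by (simp add: bessel_coeff_def power_divide)
    finally show ?thesis unfolding eq by (subst of_real_power[symmetric], subst of_real_mult[symmetric]) (rule tendsto_of_real)
  qed
  have bound: "norm (a k n) \<le> inverse (fact k) * ((nu + 3) * (r\<^sup>2 / 4)) ^ k" for k n
  proof (cases "k \<le> Suc n")
    case False
    then have "a k n = 0" by (simp add: a_def binomial_eq_0)
    then show ?thesis using nu by (simp add: zero_le_mult_iff)
  next
    case True
    define N where "N = real (Suc n)"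
    have N: "N \<ge> 1" by (simp add: N_def)
    have b1: "real (Suc n choose k) \<le> N ^ k / fact k"
    proof -
      have "real (Suc n choose k) * fact k \<le> N ^ k"
        using binomial_fact_pow[of "Suc n" k] unfolding N_def
        by (metis of_nat_fact of_nat_le_iff of_nat_mult of_nat_power)
      then show ?thesis by (simp add: field_simps)
    qed
    have b2: "pochhammer (N + nu + 1) k \<le> ((nu + 3) * N) ^ k"
    proof -
      have "pochhammer (N + nu + 1) k = (\<Prod>i=0..<k. N + nu + 1 + real i)" by (rule pochhammer_prod)
      also have "\<dots> \<le> (\<Prod>i=0..<k. (nu + 3) * N)"
      proof (rule prod_mono, intro conjI)
        fix i assume i: "i \<in> {0..<k}"
        show "0 \<le> N + nu + 1 + real i" using N nu by simp
        have "real i \<le> N" using i True by (simp add: N_def)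
        moreover have "nu \<le> nu * N" using N nu by (simp add: mult_le_cancel_left1)
        ultimately show "N + nu + 1 + real i \<le> (nu + 3) * N" using N by (simp add: distrib_right)
      qed
      finally show ?thesis by simp
    qed
    have b0: "pochhammer (N + nu + 1) k \<ge> 0" using N nu by (intro pochhammer_nonneg) simp
    have "norm (a k n) = real (Suc n choose k) * (pochhammer (N + nu + 1) k / pochhammer (nu + 1) k) * (r\<^sup>2 / (2 * N)\<^sup>2) ^ k"
      unfolding a_def N_def[symmetric] norm_of_real using ppos[of k] b0 by (simp add: abs_mult power_abs)
    also have "\<dots> \<le> N ^ k / fact k * (((nu + 3) * N) ^ k / 1) * (r\<^sup>2 / (2 * N)\<^sup>2) ^ k"
      using b0 b1 b2 ppos[of k] N nu by (intro mult_right_mono mult_mono frac_le) auto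
    also have "\<dots> = inverse (fact k) * ((nu + 3) * (r\<^sup>2 / 4)) ^ k"
    proof -
      have "N ^ k * ((nu + 3) * N) ^ k * (r\<^sup>2 / (2 * N)\<^sup>2) ^ k = (N * ((nu + 3) * N) * (r\<^sup>2 / (2 * N)\<^sup>2)) ^ k"
        by (simp only: power_mult_distrib)
      also have "N * ((nu + 3) * N) * (r\<^sup>2 / (2 * N)\<^sup>2) = (nu + 3) * (r\<^sup>2 / 4)"
        using N by (simp add: field_simps power2_eq_square)
      finally show ?thesis by (simp add: field_simps)
    qed
    finally show ?thesis .
  qed
  have "(\<lambda>n. \<Sum>k. a k n) \<longlonglongrightarrow> (\<Sum>k. of_real (bessel_coeff nu k) * of_real (r\<^sup>2) ^ k)"
    by (rule tannerys_theorem[of _ _ _ "\<lambda>k. inverse (fact k) * ((nu + 3) * (r\<^sup>2 / 4)) ^ k", THEN conjunct2, THEN conjunct2])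
       (use lim bound summable_exp[of "(nu + 3) * (r\<^sup>2 / 4)"] in \<open>auto intro!: always_eventually\<close>)
  then show ?thesis unfolding sum bessel_entire_def .
qed

text \<open>
  For \<open>q = 1\<close> the mass is a multiple of a square, whose growth is given by Gauss's limit formula for
  \<open>\<Gamma> nu\<close>.
\<close>
lemma jacobi_mass_scaled_tendsto:
  assumes nu: "nu > 0"
  shows "(\<lambda>n. real n powr (2 * nu) * jacobi_mass nu 1 n) \<longlonglongrightarrow> Gamma (nu + 1) * Gamma nu"
proof -
  have G: "Gamma nu \<noteq> 0" using Gamma_real_pos[OF nu] by simp
  have "(\<lambda>n. Gamma_series nu n / Gamma nu) \<longlonglongrightarrow> Gamma nu / Gamma nu"
    by (intro tendsto_intros Gamma_series_LIMSEQ G)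
  then have "(\<lambda>n. Gamma (nu + 1) * Gamma nu * (Gamma_series nu n / Gamma nu)\<^sup>2) \<longlonglongrightarrow> Gamma (nu + 1) * Gamma nu * (Gamma nu / Gamma nu)\<^sup>2"
    by (intro tendsto_mult tendsto_power tendsto_const)
  also have "Gamma (nu + 1) * Gamma nu * (Gamma nu / Gamma nu)\<^sup>2 = Gamma (nu + 1) * Gamma nu" using G by simp
  finally have l: "(\<lambda>n. Gamma (nu + 1) * Gamma nu * (Gamma_series nu n / Gamma nu)\<^sup>2) \<longlonglongrightarrow> Gamma (nu + 1) * Gamma nu" .
  show ?thesis
  proof (rule Lim_transform_eventually[OF l])
    show "\<forall>\<^sub>F n in sequentially. Gamma (nu + 1) * Gamma nu * (Gamma_series nu n / Gamma nu)\<^sup>2 = real n powr (2 * nu) * jacobi_mass nu 1 n"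
      using eventually_gt_at_top[of 0]
    proof eventually_elim
      case (elim n)
      have p: "pochhammer nu (n + 1) = Gamma (nu + n + 1) / Gamma nu"
        using nu by (subst pochhammer_Gamma) (auto elim!: nonpos_Ints_cases simp: add_ac)
      have e: "exp (nu * ln (real n)) = real n powr nu" using elim by (simp add: powr_def)
      have g: "Gamma_series nu n / Gamma nu = real n powr nu * fact n / Gamma (nu + n + 1)"
        unfolding Gamma_series_def p using e G by simp
      have f: "Gamma (1 + real n) = fact n" using Gamma_fact[of n] by (simp add: add.commute)
      have "real n powr (2 * nu) = (real n powr nu)\<^sup>2" by (simp add: power2_eq_square powr_add[symmetric])
      then show ?case
        unfolding g jacobi_mass_def f by (simp add: power2_eq_square field_simps add_ac)
    qed
  qed
qed

lemma borel_measurable_poly_real [measurable]: "poly p \<in> borel_measurable (borel :: real measure)"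
  by (intro borel_measurable_continuous_onI continuous_intros)

lemma nn_integral_jacobi_kernel_square:
  assumes "p > 0" "q > 0"
  shows "(\<integral>\<^sup>+y. ennreal ((poly (jacobi_kernel p q n) y)\<^sup>2) * ennreal (jacobi_weight p q y) \<partial>lborel) = ennreal (jacobi_mass p q n)"
proof -
  have "has_bochner_integral lborel (\<lambda>y. (poly (jacobi_kernel p q n) y)\<^sup>2 * jacobi_weight p q y) (jacobi_mass p q n)"
    using jacobi_kernel_reproducing_real[OF assms degree_jacobi_kernel]
    by (simp add: jacobi_kernel_0 power2_eq_square mult_ac)
  then have "(\<integral>\<^sup>+y. ennreal ((poly (jacobi_kernel p q n) y)\<^sup>2 * jacobi_weight p q y) \<partial>lborel) = ennreal (jacobi_mass p q n)"
    by (simp add: has_bochner_integral_iff nn_integral_eq_integral jacobi_weight_nonneg)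
  then show ?thesis by (simp add: ennreal_mult jacobi_weight_nonneg)
qed

definition bessel_mass :: "real \<Rightarrow> real"
  where "bessel_mass nu = 2 powr (2 * nu) / 2 * (Gamma (nu + 1) * Gamma nu)"

lemma bessel_entire_measurable [measurable]:
  assumes "nu \<ge> 0" shows "bessel_entire nu \<in> borel_measurable borel"
proof (rule borel_measurable_continuous_onI)
  show "continuous_on UNIV (bessel_entire nu)"
    unfolding continuous_on_eq_continuous_at[OF open_UNIV]
    using bessel_entire_has_derivative[OF assms] DERIV_isCont by metis
qed

text \<open>
  Fatou's lemma for the rescaled Jacobi kernels, whose norms are known exactly.
\<close>
lemma nn_integral_bessel_square_le:
  assumes nu: "nu > 0"
  shows "(\<integral>\<^sup>+r. ennreal ((cmod (bessel_entire nu (of_real (r\<^sup>2))))\<^sup>2) * ennreal (indicator {0<..} r * r powr (2 * nu - 1)) \<partial>lborel) \<le> ennreal (bessel_mass nu)"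
proof -
  let ?R = "\<lambda>n. 2 * real (Suc n)"
  let ?K = "\<lambda>n y. poly (jacobi_kernel nu 1 (Suc n)) y"
  let ?w = "\<lambda>n r. indicator {0<..<?R n} r * (r powr (2 * nu - 1) * (1 - r\<^sup>2 / (?R n)\<^sup>2) powr (1 - 1))"
  have int: "(\<integral>\<^sup>+r. ennreal ((?K n (r\<^sup>2 / (?R n)\<^sup>2))\<^sup>2) * ennreal (?w n r) \<partial>lborel) =
     ennreal (?R n powr (2 * nu) / 2 * jacobi_mass nu 1 (Suc n))" for n
  proof -
    have "(\<integral>\<^sup>+r. ennreal ((?K n (r\<^sup>2 / (?R n)\<^sup>2))\<^sup>2) * ennreal (?w n r) \<partial>lborel) =
      ennreal (?R n powr (2 * nu) / 2) * (\<integral>\<^sup>+y. ennreal ((?K n y)\<^sup>2) * ennreal (jacobi_weight nu 1 y) \<partial>lborel)"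
      by (rule nn_integral_jacobi_radial) auto
    also have "\<dots> = ennreal (?R n powr (2 * nu) / 2) * ennreal (jacobi_mass nu 1 (Suc n))"
      by (simp only: nn_integral_jacobi_kernel_square[OF nu zero_less_one])
    also have "\<dots> = ennreal (?R n powr (2 * nu) / 2 * jacobi_mass nu 1 (Suc n))"
      by (rule ennreal_mult'[symmetric]) simp
    finally show ?thesis .
  qed
  have "(\<integral>\<^sup>+r. ennreal ((cmod (bessel_entire nu (of_real (r\<^sup>2))))\<^sup>2) * ennreal (indicator {0<..} r * r powr (2 * nu - 1)) \<partial>lborel)
     = (\<integral>\<^sup>+r. liminf (\<lambda>n. ennreal ((?K n (r\<^sup>2 / (?R n)\<^sup>2))\<^sup>2) * ennreal (?w n r)) \<partial>lborel)"
  proof (rule nn_integral_cong)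
    fix r :: real
    have k: "(\<lambda>n. (?K n (r\<^sup>2 / (?R n)\<^sup>2))\<^sup>2) \<longlonglongrightarrow> (cmod (bessel_entire nu (of_real (r\<^sup>2))))\<^sup>2"
    proof -
      have "(\<lambda>n. (cmod (complex_of_real (?K n (r\<^sup>2 / (?R n)\<^sup>2))))\<^sup>2) \<longlonglongrightarrow> (cmod (bessel_entire nu (of_real (r\<^sup>2))))\<^sup>2"
        using nu by (intro tendsto_intros jacobi_kernel_tendsto_bessel) simp
      then show ?thesis by simp
    qed
    have w: "(\<lambda>n. ?w n r) \<longlonglongrightarrow> indicator {0<..} r * r powr (2 * nu - 1)"
    proof (rule tendsto_eventually)
      have "\<forall>\<^sub>F n in sequentially. r < real n" using filterlim_real_sequentially by (simp only: filterlim_at_top_dense)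
      then show "\<forall>\<^sub>F n in sequentially. ?w n r = indicator {0<..} r * r powr (2 * nu - 1)"
      proof eventually_elim
        case (elim n)
        show ?case
        proof (cases "r > 0")
          case True
          have "r < ?R n" using elim True by simp
          then have "r\<^sup>2 < (?R n)\<^sup>2" using True by (intro power_strict_mono) auto
          then have "r\<^sup>2 / (?R n)\<^sup>2 < 1" by (subst divide_less_eq_1_pos) auto
          then have "1 - r\<^sup>2 / (?R n)\<^sup>2 \<noteq> 0" by linarith
          then have pw: "(1 - r\<^sup>2 / (?R n)\<^sup>2) powr (1 - 1) = 1"
            by (simp only: diff_self powr_zero_eq_one if_False)
          show ?thesis unfolding pw using \<open>r < ?R n\<close> True by simp
        qed simp
      qed
    qed
    have "(\<lambda>n. ennreal ((?K n (r\<^sup>2 / (?R n)\<^sup>2))\<^sup>2 * ?w n r)) \<longlonglongrightarrow> ennreal ((cmod (bessel_entire nu (of_real (r\<^sup>2))))\<^sup>2 * (indicator {0<..} r * r powr (2 * nu - 1)))"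
      by (intro tendsto_ennrealI tendsto_mult k w)
    then show "ennreal ((cmod (bessel_entire nu (of_real (r\<^sup>2))))\<^sup>2) * ennreal (indicator {0<..} r * r powr (2 * nu - 1)) =
      liminf (\<lambda>n. ennreal ((?K n (r\<^sup>2 / (?R n)\<^sup>2))\<^sup>2) * ennreal (?w n r))"
      unfolding ennreal_mult'[OF zero_le_power2] by (intro lim_imp_Liminf[symmetric]) auto
  qed
  also have "\<dots> \<le> liminf (\<lambda>n. \<integral>\<^sup>+r. ennreal ((?K n (r\<^sup>2 / (?R n)\<^sup>2))\<^sup>2) * ennreal (?w n r) \<partial>lborel)"
    by (rule nn_integral_liminf) measurable
  also have "\<dots> = liminf (\<lambda>n. ennreal (?R n powr (2 * nu) / 2 * jacobi_mass nu 1 (Suc n)))"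
    unfolding int ..
  also have "\<dots> = ennreal (bessel_mass nu)"
  proof (rule lim_imp_Liminf)
    have "(\<lambda>n. 2 powr (2 * nu) / 2 * (real (Suc n) powr (2 * nu) * jacobi_mass nu 1 (Suc n))) \<longlonglongrightarrow> bessel_mass nu"
      unfolding bessel_mass_def
      by (intro tendsto_intros LIMSEQ_Suc[OF jacobi_mass_scaled_tendsto[OF nu]])
    moreover have "?R n powr (2 * nu) / 2 * jacobi_mass nu 1 (Suc n) = 2 powr (2 * nu) / 2 * (real (Suc n) powr (2 * nu) * jacobi_mass nu 1 (Suc n))" for n
      by (subst powr_mult) auto
    ultimately show "(\<lambda>n. ennreal (?R n powr (2 * nu) / 2 * jacobi_mass nu 1 (Suc n))) \<longlonglongrightarrow> ennreal (bessel_mass nu)"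
      by (simp only: tendsto_ennrealI)
  qed simp
  finally show ?thesis .
qed

text \<open>
  The reciprocal of the square of the Nikolskii constant for entire functions.
\<close>
definition power_mass :: "real \<Rightarrow> real \<Rightarrow> real"
  where "power_mass m lam = 2 * pi powr (m / 2) / Gamma (m / 2) * bessel_mass (lam + m / 2)"

lemma power_mass_pos: "m > 0 \<Longrightarrow> lam \<ge> 0 \<Longrightarrow> power_mass m lam > 0"
  unfolding power_mass_def bessel_mass_def
  by (intro mult_pos_pos divide_pos_pos Gamma_real_pos) auto

lemma inverse_power_mass:
  assumes m: "m > 0" and lam: "lam \<ge> 0"
  shows "1 / power_mass m lam = Gamma (m / 2) /
         (2 powr (2 * lam + m - 1) * pi powr (m / 2) * (2 * lam + m) * (Gamma (lam + m / 2))\<^sup>2)"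
proof -
  have nu: "lam + m / 2 > 0" using assms by (simp add: add_nonneg_pos)
  have g: "Gamma (lam + m / 2 + 1) = (lam + m / 2) * Gamma (lam + m / 2)" by (rule Gamma_real_plus1[OF nu])
  have two: "2 powr (2 * (lam + m / 2)) / 2 = (2::real) powr (2 * lam + m - 1)"
    by (simp add: powr_diff)
  have pos: "Gamma (m / 2) \<noteq> 0" "Gamma (lam + m / 2) \<noteq> 0"
    using assms nu by (auto intro!: less_imp_neq[THEN not_sym] Gamma_real_pos)
  show ?thesis
    unfolding power_mass_def bessel_mass_def two g using pos nu
    by (simp add: power2_eq_square divide_simps)
qed

lemma dim_times_unit_ball_vol:
  assumes "m > 0" shows "m * unit_ball_vol m = 2 * pi powr (m / 2) / Gamma (m / 2)"
proof -
  have g: "Gamma (m / 2 + 1) = m / 2 * Gamma (m / 2)" using assms by (intro Gamma_real_plus1) simp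
  show ?thesis using assms unfolding unit_ball_vol_def g by simp
qed

lemma nn_integral_lebesgue_power_weight:
  fixes F :: "real ^ 'm \<Rightarrow> complex"
  assumes [measurable]: "F \<in> borel_measurable borel"
  shows "(\<integral>\<^sup>+x. ennreal (cmod (F x) powr 2) * power_weight lam x \<partial>lebesgue_on UNIV) =
     (\<integral>\<^sup>+x. ennreal ((cmod (F x))\<^sup>2) * ennreal (norm x powr (2 * lam)) \<partial>lborel)"
proof -
  have "(\<integral>\<^sup>+x. ennreal (cmod (F x) powr 2) * power_weight lam x \<partial>lebesgue_on UNIV) =
     (\<integral>\<^sup>+x. ennreal (cmod (F x) powr 2) * power_weight lam x * indicator UNIV x \<partial>lebesgue)"
    by (rule nn_integral_restrict_space) simp
  also have "\<dots> = (\<integral>\<^sup>+x. ennreal ((cmod (F x))\<^sup>2) * ennreal (norm x powr (2 * lam)) \<partial>lebesgue)"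
    by (simp add: power_weight_def)
  also have "\<dots> = (\<integral>\<^sup>+x. ennreal ((cmod (F x))\<^sup>2) * ennreal (norm x powr (2 * lam)) \<partial>lborel)"
    by (rule nn_integral_completion) measurable
  finally show ?thesis .
qed

lemma radial_power_weight:
  assumes "r > 0"
  shows "r ^ (CARD('m::finite) - 1) * r powr (2 * lam) = r powr (2 * (lam + real CARD('m) / 2) - 1)"
proof -
  have "r ^ (CARD('m) - 1) = r powr (real CARD('m) - 1)"
    using assms powr_realpow[of r "CARD('m) - 1"] by (simp add: of_nat_diff Suc_le_eq)
  then show ?thesis by (simp add: powr_add[symmetric] algebra_simps)
qed

lemma bessel_radial_integral_le:
  assumes lam: "lam \<ge> 0"
  defines "nu \<equiv> lam + real CARD('m::finite) / 2"
  shows "(\<integral>\<^sup>+x. ennreal ((cmod (restrict_real (bessel_radial nu) (x :: real ^ 'm)))\<^sup>2) * ennreal (norm x powr (2 * lam)) \<partial>lborel)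
     \<le> ennreal (power_mass CARD('m) lam)"
proof -
  have nu: "nu > 0" using lam by (simp add: nu_def add_nonneg_pos)
  have [measurable]: "bessel_entire nu \<in> borel_measurable borel" using nu by simp
  let ?c = "real CARD('m) * unit_ball_vol CARD('m)"
  define g where "g r = ennreal ((cmod (bessel_entire nu (of_real (r\<^sup>2))))\<^sup>2) * ennreal (r powr (2 * lam))" for r
  have [measurable]: "g \<in> borel_measurable borel" unfolding g_def[abs_def] by measurable
  have "(\<integral>\<^sup>+x. ennreal ((cmod (restrict_real (bessel_radial nu) (x :: real ^ 'm)))\<^sup>2) * ennreal (norm x powr (2 * lam)) \<partial>lborel) =
     (\<integral>\<^sup>+x. g (norm (x :: real ^ 'm)) \<partial>lborel)"
    by (simp only: restrict_bessel_radial g_def)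
  also have "\<dots> = ennreal ?c * (\<integral>\<^sup>+r. ennreal (r ^ (CARD('m) - 1)) * indicator {0<..} r * g r \<partial>lborel)"
    by (subst nn_integral_radial) simp_all
  also have "(\<integral>\<^sup>+r. ennreal (r ^ (CARD('m) - 1)) * indicator {0<..} r * g r \<partial>lborel) =
     (\<integral>\<^sup>+r. ennreal ((cmod (bessel_entire nu (of_real (r\<^sup>2))))\<^sup>2) * ennreal (indicator {0<..} r * r powr (2 * nu - 1)) \<partial>lborel)"
  proof (rule nn_integral_cong)
    fix r :: real
    show "ennreal (r ^ (CARD('m) - 1)) * indicator {0<..} r * g r =
      ennreal ((cmod (bessel_entire nu (of_real (r\<^sup>2))))\<^sup>2) * ennreal (indicator {0<..} r * r powr (2 * nu - 1))"
    proof (cases "r > 0")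
      case True
      then have "ennreal (r ^ (CARD('m) - 1)) * ennreal (r powr (2 * lam)) = ennreal (r powr (2 * nu - 1))"
        unfolding nu_def using radial_power_weight[OF True, where 'm='m, of lam]
        by (simp add: ennreal_mult[symmetric])
      then have "ennreal ((cmod (bessel_entire nu (of_real (r\<^sup>2))))\<^sup>2) * (ennreal (r ^ (CARD('m) - 1)) * ennreal (r powr (2 * lam))) =
         ennreal ((cmod (bessel_entire nu (of_real (r\<^sup>2))))\<^sup>2) * ennreal (r powr (2 * nu - 1))"
        by (rule arg_cong)
      then show ?thesis using True by (simp add: g_def mult_ac)
    qed simp
  qed
  also have "ennreal ?c * \<dots> \<le> ennreal ?c * ennreal (bessel_mass nu)"
    by (intro mult_left_mono nn_integral_bessel_square_le[OF nu]) simp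
  also have "\<dots> = ennreal (?c * bessel_mass nu)" by (rule ennreal_mult'[symmetric]) simp
  also have "?c * bessel_mass nu = power_mass CARD('m) lam"
    unfolding power_mass_def nu_def by (subst dim_times_unit_ball_vol) auto
  finally show ?thesis .
qed

lemma exp_type_ball_restrict_continuous:
  assumes "f \<in> exp_type_ball"
  shows "continuous_on UNIV (restrict_real f :: real ^ 'm \<Rightarrow> complex)"
proof -
  have "isCont f z" for z
  proof -
    obtain a where "(f has_derivative (\<lambda>h. \<Sum>j\<in>UNIV. a $ j * h $ j)) (at z)"
      using assms unfolding exp_type_ball_def entire_def by blast
    then show ?thesis by (rule has_derivative_continuous)
  qed
  then have "continuous_on UNIV f" by (simp add: continuous_at_imp_continuous_on)
  then show ?thesis
    unfolding restrict_real_def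
    by (rule continuous_on_compose2) (auto intro!: continuous_intros)
qed

theorem nikolskii0_exp_type_ge:
  fixes lam :: real
  assumes lam: "lam \<ge> 0"
  shows "ennreal (sqrt (1 / power_mass (real CARD('m)) lam)) \<le>
    nikolskii0 (restrict_real ` (exp_type_ball :: (complex ^ 'm \<Rightarrow> complex) set)
          \<inter> wspace 2 (power_weight lam) UNIV) 2 (power_weight lam) UNIV"
proof -
  let ?g = "power_mass (real CARD('m)) lam"
  have g: "?g > 0" using lam by (intro power_mass_pos) auto
  define nu where "nu = lam + real CARD('m) / 2"
  have nu: "nu \<ge> 0" using lam by (simp add: nu_def)
  define f :: "complex ^ 'm \<Rightarrow> complex" where "f = bessel_radial nu"
  have f: "f \<in> exp_type_ball" unfolding f_def by (rule bessel_radial_exp_type[OF nu])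
  have m: "restrict_real f \<in> borel_measurable borel"
    by (intro borel_measurable_continuous_onI exp_type_ball_restrict_continuous f)
  have w: "wnorm 2 (power_weight lam) UNIV (restrict_real f) \<le> ennreal (sqrt ?g)"
  proof (rule wnorm_two_le)
    show "(\<integral>\<^sup>+x. ennreal (cmod (restrict_real f x) powr 2) * power_weight lam x \<partial>lebesgue_on UNIV) \<le> ennreal ?g"
      unfolding nn_integral_lebesgue_power_weight[OF m] unfolding f_def nu_def
      by (rule bessel_radial_integral_le[OF lam])
  qed (use g in simp)
  then have "wnorm 2 (power_weight lam) UNIV (restrict_real f) < \<infinity>"
    by (rule order.strict_trans1) simp
  with m have ws: "restrict_real f \<in> wspace 2 (power_weight lam) UNIV"
    unfolding wspace_def by (auto intro: borel_measurable_lebesgue_on)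
  have f0: "restrict_real f 0 = 1"
    by (simp add: f_def restrict_bessel_radial bessel_entire_0)
  have "ennreal (sqrt (1 / ?g)) \<le> ennreal (cmod (restrict_real f 0)) / wnorm 2 (power_weight lam) UNIV (restrict_real f)"
    by (rule ennreal_le_divide[OF _ w g]) (simp add: f0)
  also have "\<dots> \<le> nikolskii0 (restrict_real ` (exp_type_ball :: (complex ^ 'm \<Rightarrow> complex) set)
          \<inter> wspace 2 (power_weight lam) UNIV) 2 (power_weight lam) UNIV"
    unfolding nikolskii0_def
    by (rule SUP_upper2[of "restrict_real f"]) (use f ws f0 in \<open>auto intro!: exI[of _ 0]\<close>)
  finally show ?thesis .
qed

section \<open>Growth of entire functions that are square integrable on the half line\<close>

lemma cos_three_eighths_bound:
  assumes "\<bar>t\<bar> \<le> pi / 4"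
  shows "cos (3 / 2 * t) \<ge> cos (3 * pi / 8)"
proof -
  have "cos (3 / 2 * t) = cos (3 / 2 * \<bar>t\<bar>)" by (cases "t \<ge> 0") auto
  also have "\<dots> \<ge> cos (3 * pi / 8)"
    using assms by (intro cos_monotone_0_pi_le) auto
  finally show ?thesis .
qed

text \<open>
  The growth of order \<open>1\<close> is beaten by \<open>exp (- \<eta> * \<zeta> powr (3/2))\<close>, which decays in the closed quadrant once
  the variable is turned by \<open>- pi / 4\<close>. The maximum principle on large sectors bounds the product, and
  \<open>\<eta>\<close> tends to \<open>0\<close>. The variable is shifted by \<open>1 + \<i>\<close> to keep the branch point out of the quadrant.
\<close>
lemma phragmen_lindelof_quadrant:
  fixes g :: "complex \<Rightarrow> complex"
  assumes hol: "g holomorphic_on {z. Re z > -1}"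
    and im: "\<And>z. Re z = 0 \<Longrightarrow> Im z \<ge> 0 \<Longrightarrow> norm (g z) \<le> A"
    and re: "\<And>z. Im z = 0 \<Longrightarrow> Re z \<ge> 0 \<Longrightarrow> norm (g z) \<le> A"
    and gr: "\<And>z. Re z \<ge> 0 \<Longrightarrow> Im z \<ge> 0 \<Longrightarrow> norm (g z) \<le> K * exp (B * norm z)"
    and A: "A > 0" and \<xi>: "Re \<xi> \<ge> 0" "Im \<xi> \<ge> 0"
  shows "norm (g \<xi>) \<le> A"
proof (cases "Re \<xi> = 0 \<or> Im \<xi> = 0")
  case True
  then show ?thesis using im re \<xi> by auto
next
  case False
  define L where "L z = 3 / 2 * (Ln (z + (1 + \<i>)) - \<i> * of_real (pi / 4))" for z
  define V where "V z = Re (exp (L z))" for z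
  define c where "c = cos (3 * pi / 8)"
  have c: "c > 0" unfolding c_def by (rule cos_gt_zero) auto
  have V: "V z \<ge> c * norm z powr (3 / 2)" if z: "Re z \<ge> 0" "Im z \<ge> 0" for z
  proof -
    let ?z = "z + (1 + \<i>)"
    have nz: "?z \<noteq> 0" using z by (auto simp: complex_eq_iff)
    have "\<bar>Im (Ln ?z)\<bar> < pi / 2" using Re_Ln_pos_lt[OF nz] z by simp
    moreover have "0 \<le> Im (Ln ?z)" using Im_Ln_pos_le[OF nz] z by simp
    ultimately have th: "\<bar>Im (Ln ?z) - pi / 4\<bar> \<le> pi / 4" by linarith
    have "V z = exp (3 / 2 * ln (norm ?z)) * cos (3 / 2 * (Im (Ln ?z) - pi / 4))"
      using nz by (simp add: V_def L_def Re_exp)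
    also have "exp (3 / 2 * ln (norm ?z)) = norm ?z powr (3 / 2)" using nz by (simp add: powr_def)
    finally have e: "V z = norm ?z powr (3 / 2) * cos (3 / 2 * (Im (Ln ?z) - pi / 4))" .
    have "norm z \<le> norm ?z"
      using z by (simp add: cmod_def add_mono power_mono)
    then have "norm z powr (3 / 2) \<le> norm ?z powr (3 / 2)" by (intro powr_mono2) auto
    then show ?thesis unfolding e c_def using c cos_three_eighths_bound[OF th]
      by (subst mult.commute) (intro mult_mono, auto simp: c_def)
  qed
  have bound: "norm (g \<xi>) * exp (- \<eta> * V \<xi>) \<le> A" if \<eta>: "\<eta> > 0" for \<eta> :: real
  proof -
    define k where "k z = g z * exp (- of_real \<eta> * exp (L z))" for z
    have nk: "norm (k z) = norm (g z) * exp (- \<eta> * V z)" for z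
      by (simp add: k_def norm_mult V_def)
    have holk: "k holomorphic_on {z. Re z > -1}"
      unfolding k_def L_def
      by (intro holomorphic_intros hol) (auto simp: complex_nonpos_Reals_iff)
    have "((\<lambda>R. K * exp (B * R - \<eta> * c * R powr (3 / 2))) \<longlongrightarrow> 0) at_top"
    proof -
      have "((\<lambda>R. exp (B * R - \<eta> * c * R powr (3 / 2))) \<longlongrightarrow> 0) at_top"
        using \<eta> c by real_asymp
      from tendsto_mult_left[OF this, of K] show ?thesis by simp
    qed
    then have "\<forall>\<^sub>F R in at_top. K * exp (B * R - \<eta> * c * R powr (3 / 2)) < A"
      using A by (rule order_tendstoD)
    then have "\<forall>\<^sub>F R in at_top. K * exp (B * R - \<eta> * c * R powr (3 / 2)) < A \<and> R > norm \<xi>"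
      using eventually_gt_at_top by (rule eventually_conj)
    then obtain R where R: "K * exp (B * R - \<eta> * c * R powr (3 / 2)) < A" "R > norm \<xi>"
      using eventually_happens[of _ "at_top :: real filter"] by auto
    define S where "S = {z. Re z > 0} \<inter> {z. Im z > 0} \<inter> ball 0 R"
    have S: "open S" unfolding S_def
      by (intro open_Int open_halfspace_Re_gt open_halfspace_Im_gt open_ball)
    have "S \<subseteq> {z. Re z \<ge> 0} \<inter> {z. Im z \<ge> 0} \<inter> cball 0 R" by (auto simp: S_def)
    moreover have "closed ({z. Re z \<ge> 0} \<inter> {z. Im z \<ge> 0} \<inter> cball 0 R)"
      by (intro closed_Int closed_halfspace_Re_ge closed_halfspace_Im_ge closed_cball)
    ultimately have clS: "closure S \<subseteq> {z. Re z \<ge> 0} \<inter> {z. Im z \<ge> 0} \<inter> cball 0 R"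
      by (rule closure_minimal)
    have "norm (k \<xi>) \<le> A"
    proof (rule maximum_modulus_frontier[of k S])
      have "S \<subseteq> {z. Re z > -1}" by (auto simp: S_def)
      then show "k holomorphic_on interior S"
        by (rule holomorphic_on_subset[OF holk order_trans[OF interior_subset]])
      show "continuous_on (closure S) k"
        using clS by (intro continuous_on_subset[OF holomorphic_on_imp_continuous_on[OF holk]]) force
      show "bounded S" by (rule bounded_subset[OF bounded_ball[of 0 R]]) (auto simp: S_def)
      show "\<xi> \<in> S" using False \<xi> R by (auto simp: S_def)
      fix z assume "z \<in> frontier S"
      then have "z \<in> closure S" "z \<notin> S" using S by (auto simp: frontier_def interior_open)
      with clS have z: "Re z \<ge> 0" "Im z \<ge> 0" "norm z \<le> R" and or: "Re z = 0 \<or> Im z = 0 \<or> norm z = R"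
        by (auto simp: S_def)
      have Vz: "V z \<ge> c * norm z powr (3 / 2)" by (rule V) (use z in auto)
      moreover have "c * norm z powr (3 / 2) \<ge> 0" using c by simp
      ultimately have "V z \<ge> 0" by linarith
      then have e1: "exp (- \<eta> * V z) \<le> 1" using \<eta> by simp
      show "norm (k z) \<le> A"
      proof (cases "norm z = R")
        case True
        have "norm (k z) \<le> (K * exp (B * norm z)) * exp (- \<eta> * (c * norm z powr (3 / 2)))"
          unfolding nk using gr[OF z(1,2)] Vz \<eta> by (intro mult_mono) (auto intro: order_trans[OF norm_ge_zero])
        also have "\<dots> = K * exp (B * R - \<eta> * c * R powr (3 / 2))"
          unfolding True by (simp add: exp_diff exp_minus field_simps)
        finally show ?thesis using R by simp
      next
        case False
        with or z im re have "norm (g z) \<le> A" by auto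
        then have "norm (g z) * exp (- \<eta> * V z) \<le> A * 1" using e1 A by (intro mult_mono) auto
        then show ?thesis by (simp add: nk)
      qed
    qed
    then show ?thesis by (simp only: nk)
  qed
  have "((\<lambda>\<eta>. norm (g \<xi>) * exp (- \<eta> * V \<xi>)) \<longlongrightarrow> norm (g \<xi>) * exp (- 0 * V \<xi>)) (at_right 0)"
    by (intro tendsto_intros)
  moreover have "\<forall>\<^sub>F \<eta> in at_right 0. norm (g \<xi>) * exp (- \<eta> * V \<xi>) \<le> A"
    using bound eventually_at_right_less[of 0] by (rule eventually_mono[rotated]) auto
  ultimately have "norm (g \<xi>) * exp (- 0 * V \<xi>) \<le> A"
    by (rule tendsto_upperbound) simp
  then show ?thesis by simp
qed

text \<open>
  Multiplying by \<open>exp (\<i> B z)\<close> compensates the growth on the imaginary axis, and division by \<open>1 + z\<close> that on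
  the real axis.
\<close>
lemma exp_type_growth_first_quadrant:
  fixes h :: "complex \<Rightarrow> complex"
  assumes hol: "h holomorphic_on UNIV"
    and gr: "\<And>z. norm (h z) \<le> A * exp (B * norm z)"
    and re: "\<And>x. norm (h (of_real x)) \<le> A * (1 + \<bar>x\<bar>)"
    and A: "A > 0" and B: "B \<ge> 0" and z: "Re z \<ge> 0" "Im z \<ge> 0"
  shows "norm (h z) \<le> A * (1 + norm z) * exp (B * \<bar>Im z\<bar>)"
proof -
  define g where "g z = h z * exp (\<i> * of_real B * z) / (1 + z)" for z
  have ng: "norm (g z) = norm (h z) * exp (- B * Im z) / norm (1 + z)" for z
    by (simp add: g_def norm_mult norm_divide)
  have ge1: "norm (1 + z) \<ge> 1" if "Re z \<ge> 0" for z
    using abs_Re_le_cmod[of "1 + z"] that by simp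
  have dl: "a / n \<le> a" if "a \<ge> 0" "n \<ge> 1" for a n :: real
    using that mult_left_mono[of 1 n a] by (simp add: divide_le_eq)
  have "norm (g z) \<le> A"
  proof (rule phragmen_lindelof_quadrant[where g = g and A = A and \<xi> = z and K = A and B = B])
    show "g holomorphic_on {z. Re z > - 1}"
      unfolding g_def
      by (intro holomorphic_intros holomorphic_on_subset[OF hol]) (auto simp: complex_eq_iff)
    show "norm (g w) \<le> A" if w: "Re w = 0" "Im w \<ge> 0" for w
    proof -
      have nw: "norm w = Im w" using w by (simp add: cmod_eq_Im)
      have "norm (g w) \<le> norm (h w) * exp (- B * Im w)"
        unfolding ng using ge1[of w] w by (intro dl) auto
      also have "\<dots> \<le> A * exp (B * norm w) * exp (- B * Im w)" by (intro mult_right_mono gr) simp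
      also have "\<dots> = A" by (simp add: nw exp_minus)
      finally show ?thesis .
    qed
    show "norm (g w) \<le> A" if w: "Im w = 0" "Re w \<ge> 0" for w
    proof -
      have we: "w = of_real (Re w)" using w by (simp add: complex_eq_iff)
      have n: "norm (1 + w) = 1 + Re w"
        using w cmod_eq_Re[of "1 + w"] by simp
      have "norm (h w) \<le> A * (1 + Re w)" using re[of "Re w"] w we by simp
      then show ?thesis unfolding ng n using w by (simp add: divide_le_eq)
    qed
    show "norm (g w) \<le> A * exp (B * norm w)" if w: "Re w \<ge> 0" "Im w \<ge> 0" for w
    proof -
      have "norm (g w) \<le> norm (h w) * exp (- B * Im w)"
        unfolding ng using ge1[of w] w by (intro dl) auto
      also have "\<dots> \<le> norm (h w) * 1" using w B by (intro mult_left_mono) auto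
      finally show ?thesis using gr[of w] by simp
    qed
  qed (use A z in auto)
  then have "norm (h z) * exp (- B * Im z) \<le> A * norm (1 + z)"
  proof -
    have "norm (1 + z) > 0" using ge1[OF z(1)] by linarith
    then show ?thesis using \<open>norm (g z) \<le> A\<close> unfolding ng by (simp only: pos_divide_le_eq)
  qed
  also have "\<dots> \<le> A * (1 + norm z)" using A norm_triangle_ineq[of 1 z] by simp
  finally show ?thesis using z by (simp add: exp_minus field_simps)
qed

text \<open>
  The other quadrants are reached by \<open>z \<mapsto> - z\<close> and by conjugation.
\<close>
lemma exp_type_growth:
  fixes h :: "complex \<Rightarrow> complex"
  assumes hol: "h holomorphic_on UNIV"
    and gr: "\<And>z. norm (h z) \<le> A * exp (B * norm z)"
    and re: "\<And>x. norm (h (of_real x)) \<le> A * (1 + \<bar>x\<bar>)"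
    and A: "A > 0" and B: "B \<ge> 0"
  shows "norm (h z) \<le> A * (1 + norm z) * exp (B * \<bar>Im z\<bar>)"
proof -
  define h' where "h' w = cnj (h (cnj w))" for w
  have hol': "h' holomorphic_on UNIV"
  proof -
    have "range cnj = UNIV" by (metis complex_cnj_cnj surjI)
    then show ?thesis
      unfolding h'_def using holomorphic_on_compose_cnj_cnj[of h UNIV] hol by (simp add: o_def)
  qed
  have gr': "norm (h' w) \<le> A * exp (B * norm w)" for w
    using gr[of "cnj w"] by (simp add: h'_def)
  have re': "norm (h' (of_real x)) \<le> A * (1 + \<bar>x\<bar>)" for x
    using re[of x] by (simp add: h'_def)
  have neg: "(\<lambda>w. k (- w)) holomorphic_on UNIV" if "k holomorphic_on UNIV" for k :: "complex \<Rightarrow> complex"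
    using holomorphic_on_compose_gen[of uminus UNIV k UNIV] that by (simp add: o_def holomorphic_on_minus)
  have up: "norm (k z) \<le> A * (1 + norm z) * exp (B * \<bar>Im z\<bar>)"
    if "Re z \<ge> 0" "k holomorphic_on UNIV" "\<And>z. norm (k z) \<le> A * exp (B * norm z)"
      "\<And>x. norm (k (of_real x)) \<le> A * (1 + \<bar>x\<bar>)" "Im z \<ge> 0" for k z
    by (rule exp_type_growth_first_quadrant) (use that A B in auto)
  consider "Re z \<ge> 0" "Im z \<ge> 0" | "Re z \<ge> 0" "Im z \<le> 0" | "Re z \<le> 0" "Im z \<ge> 0" | "Re z \<le> 0" "Im z \<le> 0"
    by linarith
  then show ?thesis
  proof cases
    case 1
    then show ?thesis using up[of z h] hol gr re by simp
  next
    case 2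
    then show ?thesis using up[of "cnj z" h'] hol' gr' re' by (simp add: h'_def)
  next
    case 3
    have "norm (h' (- of_real x)) \<le> A * (1 + \<bar>x\<bar>)" for x using re'[of "-x"] by simp
    moreover have "norm (h' (- w)) \<le> A * exp (B * norm w)" for w using gr'[of "-w"] by simp
    ultimately show ?thesis using up[of "- cnj z" "\<lambda>w. h' (- w)"] 3 neg[OF hol'] by (simp add: h'_def)
  next
    case 4
    have "norm (h (- of_real x)) \<le> A * (1 + \<bar>x\<bar>)" for x using re[of "-x"] by simp
    moreover have "norm (h (- w)) \<le> A * exp (B * norm w)" for w using gr[of "-w"] by simp
    ultimately show ?thesis using up[of "- z" "\<lambda>w. h (- w)"] 4 neg[OF hol] by simp
  qed
qed

text \<open>
  On \<open>[1, x]\<close> the weight is at least \<open>1\<close>, and \<open>\<bar>F\<bar> \<le> 1 + \<bar>F\<bar>\<^sup>2\<close>.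
\<close>
lemma primitive_linear_growth_on_reals:
  fixes F h :: "complex \<Rightarrow> complex"
  assumes F: "continuous_on UNIV F"
    and h: "\<And>z. (h has_field_derivative F z) (at z)"
    and q: "q \<ge> 0"
    and I: "(\<integral>\<^sup>+r. ennreal ((cmod (F (of_real r)))\<^sup>2) * ennreal (indicator {0<..} r * r powr q) \<partial>lborel) \<le> ennreal J"
    and J: "J \<ge> 0" and x: "x \<ge> 1"
  shows "norm (h (of_real x) - h 1) \<le> x + J"
proof -
  have cont: "continuous_on UNIV (\<lambda>t::real. F (of_real t))"
    by (rule continuous_on_compose2[OF F]) (auto intro!: continuous_intros)
  have cF: "continuous_on S (\<lambda>t::real. F (of_real t))" for S
    by (rule continuous_on_subset[OF cont]) auto
  have [measurable]: "(\<lambda>t::real. F (of_real t)) \<in> borel_measurable borel"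
    by (rule borel_measurable_continuous_onI[OF cont])
  have fund: "((\<lambda>t::real. F (of_real t)) has_integral (h (of_real x) - h (of_real 1))) {1..x}"
  proof (rule fundamental_theorem_of_calculus)
    fix t :: real assume "t \<in> {1..x}"
    show "((\<lambda>t. h (of_real t)) has_vector_derivative F (of_real t)) (at t within {1..x})"
      using h[of "of_real t"] by (rule has_vector_derivative_real_field)
  qed (rule x)
  define f where "f t = (cmod (F (of_real t)))\<^sup>2 * indicator {1..x} t" for t
  have [measurable]: "f \<in> borel_measurable borel" unfolding f_def[abs_def] by measurable
  have f0: "f t \<ge> 0" for t by (simp add: f_def)
  have fle: "(\<integral>\<^sup>+t. ennreal (f t) \<partial>lborel) \<le> ennreal J"
  proof (rule order_trans[OF nn_integral_mono I])
    fix t :: real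
    show "ennreal (f t) \<le> ennreal ((cmod (F (of_real t)))\<^sup>2) * ennreal (indicator {0<..} t * t powr q)"
    proof (cases "t \<in> {1..x}")
      case True
      then have "1 \<le> t powr q" using q by (simp add: ge_one_powr_ge_zero)
      then have "(cmod (F (of_real t)))\<^sup>2 * 1 \<le> (cmod (F (of_real t)))\<^sup>2 * t powr q"
        by (intro mult_left_mono) auto
      then show ?thesis using True by (simp add: f_def ennreal_mult[symmetric] ennreal_leI)
    qed (simp add: f_def)
  qed
  then obtain r where r: "(\<integral>\<^sup>+t. ennreal (f t) \<partial>lborel) = ennreal r" "r \<ge> 0" "r \<le> J"
    using J by (cases "\<integral>\<^sup>+t. ennreal (f t) \<partial>lborel") (auto simp: top_unique)
  have "(f has_integral r) UNIV"
    by (rule nn_integral_has_integral) (use r f0 in auto)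
  also have "f = (\<lambda>t. if t \<in> {1..x} then (cmod (F (of_real t)))\<^sup>2 else 0)"
    by (auto simp: f_def indicator_def)
  finally have sq: "((\<lambda>t. (cmod (F (of_real t)))\<^sup>2) has_integral r) {1..x}"
    by (simp only: has_integral_restrict_UNIV)
  have one: "((\<lambda>t. 1::real) has_integral (x - 1)) {1..x}"
    using has_integral_const_real[of "1::real" 1 x] x by simp
  from has_integral_add[OF one sq]
  have sum: "((\<lambda>t. 1 + (cmod (F (of_real t)))\<^sup>2) has_integral (x - 1 + r)) {1..x}" .
  have "norm (integral {1..x} (\<lambda>t. F (of_real t))) \<le> integral {1..x} (\<lambda>t. 1 + (cmod (F (of_real t)))\<^sup>2)"
  proof (rule integral_norm_bound_integral)
    fix t :: real
    have "0 \<le> (cmod (F (of_real t)) - 1 / 2)\<^sup>2" by simp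
    then show "norm (F (of_real t)) \<le> 1 + (cmod (F (of_real t)))\<^sup>2"
      by (simp add: power2_eq_square algebra_simps)
  qed (use fund sum in \<open>auto simp: has_integral_iff\<close>)
  then show ?thesis using fund sum r by (simp add: has_integral_iff)
qed

text \<open>
  The integrability of \<open>\<bar>F\<bar>\<^sup>2\<close> on the half line does not bound \<open>F\<close> pointwise, but it makes the primitive of \<open>F\<close>
  grow at most linearly there. The Phragmen-Lindelof bound for the primitive passes to \<open>F\<close> by Cauchy's inequality on
  unit circles.
\<close>
lemma paley_wiener_growth:
  fixes F :: "complex \<Rightarrow> complex"
  assumes hol: "F holomorphic_on UNIV" and even: "\<And>z. F (- z) = F z"
    and gr: "\<And>z. norm (F z) \<le> C * exp (b * norm z)" and b: "b \<ge> 0" and Bb: "B > b"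
    and q: "q \<ge> 0"
    and I: "(\<integral>\<^sup>+r. ennreal ((cmod (F (of_real r)))\<^sup>2) * ennreal (indicator {0<..} r * r powr q) \<partial>lborel) < \<infinity>"
  obtains C' where "C' > 0" "\<And>z. norm (F z) \<le> C' * (1 + norm z) * exp (B * \<bar>Im z\<bar>)"
proof -
  obtain J where J: "(\<integral>\<^sup>+r. ennreal ((cmod (F (of_real r)))\<^sup>2) * ennreal (indicator {0<..} r * r powr q) \<partial>lborel) = ennreal J" "J \<ge> 0"
    using I by (cases "\<integral>\<^sup>+r. ennreal ((cmod (F (of_real r)))\<^sup>2) * ennreal (indicator {0<..} r * r powr q) \<partial>lborel") auto
  have C: "C \<ge> 0" using gr[of 0] by (simp add: order_trans[OF norm_ge_zero])
  have cont: "continuous_on UNIV F" by (rule holomorphic_on_imp_continuous_on[OF hol])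
  obtain h0 where h0: "\<And>z. (h0 has_field_derivative F z) (at z)"
    using holomorphic_convex_primitive[of UNIV "{}" F] hol cont
    by (auto simp: holomorphic_on_def field_differentiable_def)
  define h where "h z = h0 z - h0 0" for z
  have h: "(h has_field_derivative F z) (at z)" for z
    unfolding h_def using h0[of z] by (auto intro!: derivative_eq_intros)
  have hh: "h holomorphic_on UNIV" using h by (auto simp: holomorphic_on_open)
  have hz: "norm (h z) \<le> C * exp (b * norm z) * norm z" for z
  proof -
    have "norm (h z - h 0) \<le> (C * exp (b * norm z)) * norm (z - 0)"
    proof (rule field_differentiable_bound[of "cball 0 (norm z)" h F])
      fix w :: complex assume "w \<in> cball 0 (norm z)"
      then have "C * exp (b * norm w) \<le> C * exp (b * norm z)" using b C by (intro mult_left_mono) (auto intro: mult_left_mono)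
      with gr[of w] show "norm (F w) \<le> C * exp (b * norm z)" by linarith
      show "(h has_field_derivative F w) (at w within cball 0 (norm z))"
        using h by (rule has_field_derivative_at_within)
    qed auto
    then show ?thesis by (simp add: h_def)
  qed
  define \<delta> where "\<delta> = B - b"
  have \<delta>: "\<delta> > 0" using Bb by (simp add: \<delta>_def)
  have hgr: "norm (h z) \<le> C / \<delta> * exp (B * norm z)" for z
  proof -
    have "\<delta> * norm z \<le> exp (\<delta> * norm z)" using exp_ge_add_one_self[of "\<delta> * norm z"] by linarith
    then have "norm z \<le> exp (\<delta> * norm z) / \<delta>" using \<delta> by (simp add: field_simps)
    then have "C * exp (b * norm z) * norm z \<le> C * exp (b * norm z) * (exp (\<delta> * norm z) / \<delta>)"
      using C by (intro mult_left_mono) auto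
    also have "\<dots> = C / \<delta> * exp (b * norm z + \<delta> * norm z)" by (simp add: exp_add)
    also have "b * norm z + \<delta> * norm z = B * norm z" by (simp add: \<delta>_def algebra_simps)
    finally show ?thesis using hz[of z] by linarith
  qed
  have odd: "h (- z) = - h z" for z
  proof -
    have "((\<lambda>z. h z + h (- z)) has_field_derivative 0) (at w)" for w
    proof -
      have "((\<lambda>z. h z + h (- z)) has_field_derivative (F w + F (- w) * (- 1))) (at w)"
        by (intro derivative_intros DERIV_chain2[of h] h)
      then show ?thesis by (simp add: even)
    qed
    then have "\<exists>c. \<forall>z. h z + h (- z) = c"
      using has_field_derivative_zero_constant[of UNIV "\<lambda>z. h z + h (- z)"] by auto
    then obtain c where c: "\<And>z. h z + h (- z) = c" by blast
    from c[of 0] have "c = 0" by (simp add: h_def)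
    with c[of z] show ?thesis by (simp add: eq_neg_iff_add_eq_0 add.commute)
  qed
  define A where "A = C / \<delta> + norm (h 1) + J + C * exp b + 1"
  have A: "A > 0" using C \<delta> J by (simp add: A_def add_nonneg_pos)
  have hre0: "norm (h (of_real x)) \<le> A * (1 + x)" if x: "x \<ge> 0" for x
  proof (cases "x \<ge> 1")
    case True
    have "norm (h (of_real x) - h 1) \<le> x + J"
      by (rule primitive_linear_growth_on_reals[OF cont h q]) (use J True in auto)
    then have "norm (h (of_real x)) \<le> norm (h 1) + x + J"
      using norm_triangle_ineq2[of "h (of_real x)" "h 1"] by linarith
    also have "\<dots> \<le> A + A * x"
    proof (rule add_mono[of "norm (h 1) + J" A x "A * x", THEN order_trans[rotated]])
      have "0 \<le> C / \<delta>" "0 \<le> C * exp b" using C \<delta> by auto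
      then show "norm (h 1) + J \<le> A" "x \<le> A * x"
        using x J by (auto simp: A_def mult_le_cancel_right1)
    qed simp
    finally show ?thesis by (simp add: algebra_simps)
  next
    case False
    have "norm (h (of_real x)) \<le> C * exp (b * x) * x" using hz[of "of_real x"] x by simp
    also have "\<dots> \<le> C * exp b * 1" using False x b C by (intro mult_mono) (auto simp: mult_left_le)
    also have "\<dots> \<le> A * 1" using C \<delta> J by (simp add: A_def)
    also have "\<dots> \<le> A * (1 + x)" using A x by (intro mult_left_mono) auto
    finally show ?thesis .
  qed
  have hre: "norm (h (of_real x)) \<le> A * (1 + \<bar>x\<bar>)" for x
  proof (cases "x \<ge> 0")
    case False
    have "norm (h (of_real x)) = norm (h (of_real (- x)))" using odd[of "of_real (- x)"] by simp
    with hre0[of "-x"] False show ?thesis by simp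
  qed (use hre0 in auto)
  have hgrA: "norm (h z) \<le> A * exp (B * norm z)" for z
  proof -
    have "C / \<delta> \<le> A" using C J by (simp add: A_def)
    then have "C / \<delta> * exp (B * norm z) \<le> A * exp (B * norm z)" by (intro mult_right_mono) auto
    with hgr[of z] show ?thesis by linarith
  qed
  have B: "B \<ge> 0" using Bb b by simp
  have g: "norm (h z) \<le> A * (1 + norm z) * exp (B * \<bar>Im z\<bar>)" for z
    by (rule exp_type_growth[OF hh hgrA hre A B])
  have "norm (F z) \<le> (2 * A * exp B) * (1 + norm z) * exp (B * \<bar>Im z\<bar>)" for z
  proof -
    have "norm ((deriv ^^ 1) h z) \<le> fact 1 * (A * (2 + norm z) * exp (B * (\<bar>Im z\<bar> + 1))) / 1 ^ 1"
    proof (rule Cauchy_inequality)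
      fix w :: complex assume w: "norm (z - w) = 1"
      have "norm w \<le> norm z + 1" using norm_triangle_ineq4[of z "z - w"] w by simp
      moreover have "\<bar>Im w\<bar> \<le> \<bar>Im z\<bar> + 1" using abs_Im_le_cmod[of "z - w"] w by simp
      ultimately have "A * (1 + norm w) * exp (B * \<bar>Im w\<bar>) \<le> A * (2 + norm z) * exp (B * (\<bar>Im z\<bar> + 1))"
        using A B by (intro mult_mono) (auto intro: mult_left_mono)
      with g[of w] show "norm (h w) \<le> A * (2 + norm z) * exp (B * (\<bar>Im z\<bar> + 1))" by linarith
    qed (use hh in \<open>auto intro: holomorphic_on_subset holomorphic_on_imp_continuous_on\<close>)
    then have "norm (F z) \<le> A * (2 + norm z) * exp (B * (\<bar>Im z\<bar> + 1))"
      using DERIV_imp_deriv[OF h] by simp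
    also have "\<dots> \<le> A * (2 * (1 + norm z)) * exp (B * (\<bar>Im z\<bar> + 1))"
      using A by (intro mult_right_mono mult_left_mono) auto
    also have "\<dots> = (2 * A * exp B) * (1 + norm z) * exp (B * \<bar>Im z\<bar>)"
      by (simp add: distrib_left exp_add mult_ac)
    finally show ?thesis .
  qed
  moreover have "2 * A * exp B > 0" using A by simp
  ultimately show thesis using that by blast
qed

section \<open>Polynomial approximation on a Bernstein ellipse\<close>

text \<open>
  The polynomials with \<open>T\<^sub>j (2 + v + 1 / v) = v ^ j + (1 / v) ^ j\<close>: twice the Chebyshev polynomials, transported
  from \<open>[-1, 1]\<close> to \<open>[0, 4]\<close>.
\<close>
fun laurent_basis :: "nat \<Rightarrow> complex poly" where
  "laurent_basis 0 = [:2:]"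
| "laurent_basis (Suc 0) = [:-2, 1:]"
| "laurent_basis (Suc (Suc n)) = [:-2, 1:] * laurent_basis (Suc n) - laurent_basis n"

lemma poly_laurent_basis:
  assumes "v \<noteq> 0"
  shows "poly (laurent_basis j) (2 + v + 1 / v) = v ^ j + (1 / v) ^ j"
proof (induction j rule: laurent_basis.induct)
  case (3 n)
  have "poly (laurent_basis (Suc (Suc n))) (2 + v + 1 / v) =
     (v + 1 / v) * poly (laurent_basis (Suc n)) (2 + v + 1 / v) - poly (laurent_basis n) (2 + v + 1 / v)"
    by (simp add: algebra_simps)
  also have "\<dots> = (v + 1 / v) * (v ^ Suc n + (1 / v) ^ Suc n) - (v ^ n + (1 / v) ^ n)"
    unfolding 3 ..
  also have "(v + 1 / v) * (v ^ Suc n + (1 / v) ^ Suc n) =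
     v ^ Suc (Suc n) + (1 / v) ^ Suc (Suc n) + (v * (1 / v)) * (v ^ n + (1 / v) ^ n)"
    by (simp only: power_Suc) (simp only: algebra_simps)
  finally show ?case using assms by simp
qed auto

lemma laurent_basis_degree: "degree (laurent_basis j) \<le> j"
  and laurent_basis_coeff: "coeff (laurent_basis j) j \<noteq> 0"
proof -
  have "degree (laurent_basis j) \<le> j \<and> coeff (laurent_basis j) j = (if j = 0 then 2 else 1)"
  proof (induction j rule: laurent_basis.induct)
    case (3 n)
    have "degree ([:-2, 1:] * laurent_basis (Suc n)) \<le> Suc (Suc n)"
      using 3 by (intro order_trans[OF degree_mult_le]) simp
    then have "degree (laurent_basis (Suc (Suc n))) \<le> Suc (Suc n)"
      unfolding laurent_basis.simps using 3 by (intro degree_diff_le) auto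
    moreover have "coeff (laurent_basis (Suc (Suc n))) (Suc (Suc n)) = 1"
      using 3 by (simp add: coeff_eq_0)
    ultimately show ?case by simp
  qed auto
  then show "degree (laurent_basis j) \<le> j" "coeff (laurent_basis j) j \<noteq> 0" by (auto split: if_splits)
qed

lemma laurent_basis_span:
  assumes "degree q \<le> K"
  obtains b where "q = (\<Sum>j\<le>K. smult (b j) (laurent_basis j))"
proof -
  have "\<exists>b. q = (\<Sum>j\<le>K. smult (b j) (laurent_basis j))"
    using assms
  proof (induction K arbitrary: q)
    case 0
    then obtain c where "q = [:c:]" by (auto elim: degree_eq_zeroE)
    then show ?case by (intro exI[of _ "\<lambda>_. c / 2"]) simp
  next
    case (Suc K)
    define c where "c = coeff q (Suc K) / coeff (laurent_basis (Suc K)) (Suc K)"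
    define r where "r = q - smult c (laurent_basis (Suc K))"
    have "degree r \<le> Suc K"
      unfolding r_def using Suc.prems laurent_basis_degree[of "Suc K"]
      by (intro degree_diff_le order_trans[OF degree_smult_le])
    moreover have "coeff r (Suc K) = 0"
      using laurent_basis_coeff[of "Suc K"] by (simp add: r_def c_def)
    ultimately have "degree r \<le> K"
      by (metis le_Suc_eq leading_coeff_0_iff degree_0 le0)
    from Suc.IH[OF this] obtain b where b: "r = (\<Sum>j\<le>K. smult (b j) (laurent_basis j))" by blast
    have "q = r + smult c (laurent_basis (Suc K))" by (simp add: r_def)
    also have "\<dots> = (\<Sum>j\<le>Suc K. smult ((b(Suc K := c)) j) (laurent_basis j))"
      unfolding b by simp
    finally show ?case by blast
  qed
  then show thesis using that by blast
qed

lemma roots_of_unity_power_sum: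
  fixes n :: int
  assumes n: "n \<noteq> 0" "\<bar>n\<bar> < int L"
  shows "(\<Sum>l<L. (exp (2 * of_real pi * \<i> * of_nat l / of_nat L)) powi n) = 0"
proof -
  define x where "x = exp (2 * of_real pi * \<i> * of_int n / of_nat L)"
  have L: "L > 0" using n by auto
  have term_eq: "(exp (2 * of_real pi * \<i> * of_nat l / of_nat L)) powi n = x ^ l" for l
    unfolding x_def exp_of_nat_mult[symmetric] exp_power_int
    by (simp add: mult_ac)
  have "x \<noteq> 1"
  proof
    assume "x = 1"
    then obtain k :: int where "Im (2 * of_real pi * \<i> * of_int n / of_nat L) = of_int (2 * k) * pi"
      unfolding x_def exp_eq_1 by blast
    then have "(2 * pi) * (of_int n / real L) = (2 * pi) * of_int k" by (simp add: mult_ac)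
    then have "of_int n / real L = of_int k" by (subst (asm) mult_cancel_left) simp
    then have "of_int n = (of_int (k * int L) :: real)" using L by (simp add: field_simps)
    then have "n = k * int L" by (simp only: of_int_eq_iff)
    then show False using n by (auto simp: abs_mult zabs_less_one_iff)
  qed
  moreover have "x ^ L = 1"
  proof -
    have "x ^ L = exp (2 * of_real pi * \<i> * of_int n)"
      unfolding x_def exp_of_nat_mult[symmetric] using L by simp
    also have "\<dots> = 1" unfolding exp_eq_1 by (auto intro!: exI[of _ n])
    finally show ?thesis .
  qed
  ultimately show ?thesis unfolding term_eq by (simp add: sum_gp_strict)
qed

text \<open>
  Cauchy's estimate for a Laurent polynomial. Averaging over \<open>2 K + 1\<close> equidistant points of the circle
  isolates one coefficient exactly, as no other exponent that occurs is a multiple of \<open>2 K + 1\<close> away.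
\<close>
lemma laurent_coefficient_bound:
  fixes b :: "nat \<Rightarrow> complex" and \<sigma> :: real
  assumes s: "\<sigma> > 0" and j: "1 \<le> j" "j \<le> K"
    and M: "\<And>v. norm v = \<sigma> \<Longrightarrow> norm (\<Sum>i\<le>K. b i * (v ^ i + (1 / v) ^ i)) \<le> M"
  shows "norm (b j) \<le> M / \<sigma> ^ j"
proof -
  define L where "L = 2 * K + 1"
  define u where "u l = exp (2 * of_real pi * \<i> * of_nat l / of_nat L)" for l :: nat
  define v where "v l = of_real \<sigma> * u l" for l
  have u0: "u l \<noteq> 0" for l by (simp add: u_def)
  have nu: "norm (u l) = 1" for l by (simp add: u_def)
  have nv: "norm (v l) = \<sigma>" for l using s by (simp add: v_def norm_mult nu)
  have v0: "v l \<noteq> 0" for l using s u0 by (simp add: v_def)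
  have S0: "(\<Sum>l<L. v l powi n) = 0" if "n \<noteq> 0" "\<bar>n\<bar> < int L" for n
  proof -
    have "(\<Sum>l<L. v l powi n) = of_real \<sigma> powi n * (\<Sum>l<L. u l powi n)"
      by (simp add: v_def power_int_mult_distrib sum_distrib_left)
    then show ?thesis using roots_of_unity_power_sum[OF that] by (simp add: u_def)
  qed
  have eq: "(\<Sum>l<L. (\<Sum>i\<le>K. b i * (v l ^ i + (1 / v l) ^ i)) * v l powi (- int j)) = of_nat L * b j"
  proof -
    have t: "b i * (v l ^ i + (1 / v l) ^ i) * v l powi (- int j) =
        b i * (v l powi (int i - int j) + v l powi (- int i - int j))" for i l
    proof -
      have "v l ^ i * v l powi (- int j) = v l powi (int i - int j)"
        using v0[of l] by (simp add: power_int_diff power_int_minus divide_inverse)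
      moreover have "(1 / v l) ^ i * v l powi (- int j) = v l powi (- int i - int j)"
        using v0[of l] by (simp add: power_int_diff power_int_minus divide_inverse power_inverse)
      ultimately show ?thesis by (simp add: distrib_right distrib_left mult.assoc)
    qed
    have "(\<Sum>l<L. (\<Sum>i\<le>K. b i * (v l ^ i + (1 / v l) ^ i)) * v l powi (- int j)) =
       (\<Sum>i\<le>K. b i * ((\<Sum>l<L. v l powi (int i - int j)) + (\<Sum>l<L. v l powi (- int i - int j))))"
      unfolding sum_distrib_right t
      by (subst sum.swap) (simp add: sum_distrib_left sum.distrib distrib_left)
    also have "\<dots> = (\<Sum>i\<le>K. if i = j then of_nat L * b j else 0)"
    proof (rule sum.cong)
      fix i assume i: "i \<in> {..K}"
      have "(\<Sum>l<L. v l powi (- int i - int j)) = 0"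
        using i j by (intro S0) (auto simp: L_def)
      moreover have "(\<Sum>l<L. v l powi (int i - int j)) = (if i = j then of_nat L else 0)"
        using i j S0[of "int i - int j"] by (auto simp: L_def)
      ultimately show "b i * ((\<Sum>l<L. v l powi (int i - int j)) + (\<Sum>l<L. v l powi (- int i - int j))) =
         (if i = j then of_nat L * b j else 0)" by simp
    qed simp
    also have "\<dots> = of_nat L * b j" using j by simp
    finally show ?thesis .
  qed
  have "real L * norm (b j) = norm (of_nat L * b j)" by (simp add: norm_mult)
  also have "\<dots> \<le> (\<Sum>l<L. norm ((\<Sum>i\<le>K. b i * (v l ^ i + (1 / v l) ^ i)) * v l powi (- int j)))"
    unfolding eq[symmetric] by (rule norm_sum)
  also have "\<dots> \<le> (\<Sum>l<L. M / \<sigma> ^ j)"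
  proof (rule sum_mono)
    fix l
    have "norm (v l powi (- int j)) = 1 / \<sigma> ^ j"
      by (simp add: power_int_minus norm_inverse norm_power nv divide_inverse)
    then show "norm ((\<Sum>i\<le>K. b i * (v l ^ i + (1 / v l) ^ i)) * v l powi (- int j)) \<le> M / \<sigma> ^ j"
      unfolding norm_mult using M[OF nv] s by (simp add: divide_right_mono)
  qed
  finally have "real L * norm (b j) \<le> real L * (M / \<sigma> ^ j)" by simp
  moreover have "real L > 0" by (simp add: L_def)
  ultimately show ?thesis by (simp only: mult_le_cancel_left_pos)
qed

text \<open>
  Truncation of the expansion in the basis above. Since \<open>q\<close> is a polynomial all sums are finite, and the
  bound does not depend on its degree.
\<close>
lemma bernstein_polynomial_approximation:
  fixes q :: "complex poly" and \<sigma> :: real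
  assumes s: "\<sigma> > 1"
    and M: "\<And>v. norm v = \<sigma> \<Longrightarrow> norm (poly q (2 + v + 1 / v)) \<le> M"
  obtains p where "degree p \<le> n"
    "\<And>y. 0 \<le> y \<Longrightarrow> y \<le> 4 \<Longrightarrow> norm (poly q (of_real y) - poly p (of_real y)) \<le> 2 * M / (\<sigma> ^ n * (\<sigma> - 1))"
proof -
  define K where "K = max (degree q) n"
  have "degree q \<le> K" by (simp add: K_def)
  then obtain b where b: "q = (\<Sum>j\<le>K. smult (b j) (laurent_basis j))"
    by (rule laurent_basis_span)
  have pq: "poly q (2 + v + 1 / v) = (\<Sum>i\<le>K. b i * (v ^ i + (1 / v) ^ i))" if "v \<noteq> 0" for v
    using that by (subst b) (simp add: poly_sum poly_laurent_basis)
  have M0: "M \<ge> 0" using M[of "of_real \<sigma>"] s by (simp add: order_trans[OF norm_ge_zero])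
  have bj: "norm (b j) \<le> M / \<sigma> ^ j" if "1 \<le> j" "j \<le> K" for j
  proof (rule laurent_coefficient_bound[OF _ that])
    fix v :: complex assume v: "norm v = \<sigma>"
    then have "v \<noteq> 0" using s by auto
    then show "norm (\<Sum>i\<le>K. b i * (v ^ i + (1 / v) ^ i)) \<le> M" using M[OF v] pq by simp
  qed (use s in simp)
  define p where "p = (\<Sum>j\<le>n. smult (b j) (laurent_basis j))"
  have "degree p \<le> n"
    unfolding p_def
    by (intro degree_sum_le order_trans[OF degree_smult_le] order_trans[OF laurent_basis_degree]) auto
  moreover have "norm (poly q (of_real y) - poly p (of_real y)) \<le> 2 * M / (\<sigma> ^ n * (\<sigma> - 1))" if y: "0 \<le> y" "y \<le> 4" for y
  proof -
    define v where "v = cis (arccos (y / 2 - 1))"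
    have nv: "norm v = 1" by (simp add: v_def)
    then have v0: "v \<noteq> 0" by auto
    have "v * cnj v = 1" using complex_norm_square[of v] nv by simp
    then have "1 / v = cnj v" using v0 by (metis nonzero_mult_div_cancel_left)
    then have "v + 1 / v = of_real (2 * Re v)" by (simp only: complex_add_cnj)
    also have "Re v = cos (arccos (y / 2 - 1))" by (simp add: v_def)
    also have "cos (arccos (y / 2 - 1)) = y / 2 - 1" using y by (intro cos_arccos) auto
    finally have yv: "complex_of_real y = 2 + v + 1 / v" by (simp add: add.assoc)
    have split: "(\<Sum>j\<le>K. g j) = (\<Sum>j\<le>n. g j) + (\<Sum>j\<in>{n<..K}. g j)" for g :: "nat \<Rightarrow> complex"
    proof -
      have "{..K} = {..n} \<union> {n<..K}" by (auto simp: K_def)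
      then show ?thesis by (simp only:) (rule sum.union_disjoint, auto)
    qed
    have "poly q (of_real y) - poly p (of_real y) = (\<Sum>j\<in>{n<..K}. b j * (v ^ j + (1 / v) ^ j))"
      unfolding yv pq[OF v0] p_def split by (simp add: poly_sum poly_laurent_basis[OF v0])
    also have "norm \<dots> \<le> (\<Sum>j\<in>{n<..K}. norm (b j * (v ^ j + (1 / v) ^ j)))" by (rule norm_sum)
    also have "\<dots> \<le> (\<Sum>j\<in>{n<..K}. 2 * M / \<sigma> ^ j)"
    proof (rule sum_mono)
      fix j assume j: "j \<in> {n<..K}"
      have "norm (v ^ j + (1 / v) ^ j) \<le> norm (v ^ j) + norm ((1 / v) ^ j)" by (rule norm_triangle_ineq)
      also have "\<dots> = 2" by (simp add: norm_power norm_divide nv)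
      finally have "norm (b j) * norm (v ^ j + (1 / v) ^ j) \<le> M / \<sigma> ^ j * 2"
        using bj[of j] j s M0 by (intro mult_mono) auto
      then show "norm (b j * (v ^ j + (1 / v) ^ j)) \<le> 2 * M / \<sigma> ^ j" by (simp add: norm_mult mult.commute)
    qed
    also have "\<dots> = 2 * M * (\<Sum>j\<in>{n<..K}. (1 / \<sigma>) ^ j)" by (simp add: sum_distrib_left power_divide)
    also have "\<dots> \<le> 2 * M * (1 / (\<sigma> ^ n * (\<sigma> - 1)))"
    proof (rule mult_left_mono)
      have tele: "(\<Sum>j\<in>{n<..n + d}. (1 / \<sigma>) ^ j) = (1 / \<sigma> ^ n - 1 / \<sigma> ^ (n + d)) / (\<sigma> - 1)" for d
      proof (induction d)
        case (Suc d)
        have "{n<..n + Suc d} = insert (n + Suc d) {n<..n + d}" by auto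
        then have "(\<Sum>j\<in>{n<..n + Suc d}. (1 / \<sigma>) ^ j) = (1 / \<sigma>) ^ (n + Suc d) + (1 / \<sigma> ^ n - 1 / \<sigma> ^ (n + d)) / (\<sigma> - 1)"
          by (simp add: Suc)
        also have "(1 / \<sigma>) ^ (n + Suc d) = (1 / \<sigma> ^ (n + d) - 1 / \<sigma> ^ (n + Suc d)) / (\<sigma> - 1)"
          using s by (simp add: power_divide divide_simps)
        finally show ?case using s by (simp add: diff_divide_distrib)
      qed simp
      obtain d where d: "K = n + d" using le_Suc_ex[of n K] by (auto simp: K_def)
      have "(\<Sum>j\<in>{n<..K}. (1 / \<sigma>) ^ j) \<le> (1 / \<sigma> ^ n) / (\<sigma> - 1)"
        unfolding d tele using s by (intro divide_right_mono) auto
      then show "(\<Sum>j\<in>{n<..K}. (1 / \<sigma>) ^ j) \<le> 1 / (\<sigma> ^ n * (\<sigma> - 1))" by simp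
    qed (use M0 in simp)
    finally show ?thesis by simp
  qed
  ultimately show thesis by (rule that)
qed

section \<open>Even entire functions as near polynomials\<close>

lemma entire_even_taylor_approximation:
  fixes F :: "complex \<Rightarrow> complex"
  assumes hol: "F holomorphic_on UNIV" and even: "\<And>z. F (- z) = F z" and d: "d > 0"
  obtains q :: "complex poly" where "\<And>z. norm z \<le> r \<Longrightarrow> norm (F z - poly q (z\<^sup>2)) \<le> d"
proof -
  define a where "a k = (deriv ^^ k) F 0 / fact k" for k
  have sums: "(\<lambda>k. a k * z ^ k) sums F z" for z
    using holomorphic_power_series[of F 0 "norm z + 1" z] hol
    by (simp add: a_def holomorphic_on_subset)
  define c where "c k = (if even k then a k else 0)" for k
  have csums: "(\<lambda>k. c k * z ^ k) sums F z" for z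
  proof -
    have "(\<lambda>k. (a k * z ^ k + a k * (- z) ^ k) / 2) sums ((F z + F (- z)) / 2)"
      by (intro sums_divide sums_add sums)
    also have "(\<lambda>k. (a k * z ^ k + a k * (- z) ^ k) / 2) = (\<lambda>k. c k * z ^ k)"
      by (auto simp: c_def fun_eq_iff)
    finally show ?thesis by (simp add: even)
  qed
  define r' where "r' = \<bar>r\<bar> + 1"
  have "summable (\<lambda>k. norm (c k * of_real \<bar>r\<bar> ^ k))"
    by (rule powser_insidea[OF sums_summable[OF csums[of "of_real r'"]]]) (simp add: r'_def)
  then have summ: "summable (\<lambda>k. norm (c k) * \<bar>r\<bar> ^ k)" by (simp add: norm_mult norm_power)
  have "uniform_limit (cball 0 \<bar>r\<bar>) (\<lambda>n z. \<Sum>k<n. c k * z ^ k) (\<lambda>z. \<Sum>k. c k * z ^ k) sequentially"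
    by (rule Weierstrass_m_test[OF _ summ])
       (auto simp: norm_mult norm_power intro!: mult_left_mono power_mono)
  then have "\<forall>\<^sub>F n in sequentially. \<forall>z\<in>cball 0 \<bar>r\<bar>. dist (\<Sum>k<n. c k * z ^ k) (\<Sum>k. c k * z ^ k) < d"
    using d by (rule uniform_limitD)
  then obtain N where "\<And>n z. N \<le> n \<Longrightarrow> z \<in> cball 0 \<bar>r\<bar> \<Longrightarrow> dist (\<Sum>k<n. c k * z ^ k) (F z) < d"
    unfolding eventually_sequentially sums_unique[OF csums, symmetric] by blast
  then have N: "dist (\<Sum>k<2 * N. c k * z ^ k) (F z) < d" if "z \<in> cball 0 \<bar>r\<bar>" for z
    using that by simp
  define q where "q = (\<Sum>k<N. monom (c (2 * k)) k)"
  have q: "poly q (z\<^sup>2) = (\<Sum>k<2 * N. c k * z ^ k)" for z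
  proof -
    have "(\<Sum>k<2 * N. c k * z ^ k) = (\<Sum>k<N. c (2 * k) * z ^ (2 * k))"
      by (induction N) (auto simp: c_def)
    then show ?thesis by (simp add: q_def poly_sum poly_monom power_mult)
  qed
  show thesis
  proof (rule that)
    fix z :: complex assume "norm z \<le> r"
    then have "z \<in> cball 0 \<bar>r\<bar>" by simp
    from N[OF this] show "norm (F z - poly q (z\<^sup>2)) \<le> d"
      unfolding q by (simp add: dist_norm norm_minus_commute)
  qed
qed

text \<open>
  With \<open>v = w\<^sup>2\<close> the point \<open>z = R (w + 1 / w) / 2\<close> satisfies \<open>4 z\<^sup>2 / R\<^sup>2 = 2 + v + 1 / v\<close>. So the circle of radius
  \<open>\<rho>\<^sup>2\<close> corresponds to the ellipse with \<open>norm w = \<rho>\<close>, where \<open>\<bar>Im z\<bar> \<le> R (\<rho> - 1 / \<rho>) / 2\<close>. The function is first replaced by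
  a Taylor polynomial, with an error that is negligible on the ellipse.
\<close>
lemma even_entire_polynomial_approximation:
  fixes F :: "complex \<Rightarrow> complex"
  assumes hol: "F holomorphic_on UNIV" and even: "\<And>z. F (- z) = F z"
    and gr: "\<And>z. norm (F z) \<le> C * (1 + norm z) * exp (B * \<bar>Im z\<bar>)"
    and C: "C > 0" and B: "B \<ge> 0" and R: "R > 0" and rho: "\<rho> > 1"
  obtains p where "degree p \<le> n"
    "\<And>x. 0 \<le> x \<Longrightarrow> x \<le> R \<Longrightarrow> norm (F (of_real x) - poly p (of_real (x\<^sup>2 / R\<^sup>2))) \<le>
       4 * (C * (1 + R * \<rho>) * exp (B * (R * (\<rho> - 1 / \<rho>) / 2))) / (\<rho> ^ (2 * n) * (\<rho>\<^sup>2 - 1))"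
proof -
  define M where "M = C * (1 + R * \<rho>) * exp (B * (R * (\<rho> - 1 / \<rho>) / 2))"
  define D where "D = \<rho> ^ (2 * n) * (\<rho>\<^sup>2 - 1)"
  have s1: "\<rho>\<^sup>2 > 1" using rho by (simp add: one_less_power)
  have M: "M > 0" unfolding M_def using C R rho by (intro mult_pos_pos add_pos_pos) auto
  have D: "D > 0" unfolding D_def using rho s1 by simp
  \<comment> \<open>Chosen so that the Taylor error and its effect on the truncation add up to at most \<open>2 * M / D\<close>.\<close>
  define d where "d = 2 * M / D / (1 + 2 / D)"
  have d: "d > 0" unfolding d_def using M D by (simp add: add_pos_pos)
  have dD: "d + 2 * d / D = 2 * M / D"
  proof -
    have "d + 2 * d / D = d * (1 + 2 / D)" by (simp add: distrib_left)
    also have "\<dots> = 2 * M / D" using D by (simp add: d_def add_pos_pos less_imp_neq[THEN not_sym])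
    finally show ?thesis .
  qed
  obtain q :: "complex poly" where q: "\<And>z. norm z \<le> R * \<rho> \<Longrightarrow> norm (F z - poly q (z\<^sup>2)) \<le> d"
    using entire_even_taylor_approximation[OF hol even d, of "R * \<rho>"] by blast
  define Q where "Q = pcompose q [:0, of_real (R\<^sup>2 / 4):]"
  have Q: "poly Q y = poly q (of_real (R\<^sup>2 / 4) * y)" for y
    by (simp add: Q_def poly_pcompose mult.commute)
  have QM: "norm (poly Q (2 + v + 1 / v)) \<le> M + d" if v: "norm v = \<rho>\<^sup>2" for v
  proof -
    define w where "w = csqrt v"
    have w2: "w\<^sup>2 = v" by (simp add: w_def)
    have "(norm w)\<^sup>2 = \<rho>\<^sup>2" using v w2 by (metis norm_power)
    then have nw: "norm w = \<rho>" using rho by (simp add: power2_eq_iff_nonneg)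
    then have w0: "w \<noteq> 0" using rho by auto
    define z where "z = of_real (R / 2) * (w + 1 / w)"
    have z2: "of_real (R\<^sup>2 / 4) * (2 + v + 1 / v) = z\<^sup>2"
      using w0 unfolding w2[symmetric] z_def by (simp add: power2_eq_square field_simps)
    have "norm (w + 1 / w) \<le> \<rho> + 1 / \<rho>"
      using norm_triangle_ineq[of w "1 / w"] by (simp add: norm_divide nw)
    also have "\<dots> \<le> \<rho> + \<rho>"
    proof -
      have "1 / \<rho> \<le> 1" using rho by simp
      then show ?thesis using rho by linarith
    qed
    finally have "norm z \<le> R / 2 * (2 * \<rho>)"
      unfolding z_def norm_mult using R by (intro mult_mono) auto
    then have nz: "norm z \<le> R * \<rho>" by simp
    have "1 / w = cnj w / of_real (\<rho>\<^sup>2)"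
      using w0 complex_norm_square[of w] by (simp add: nw field_simps)
    then have "Im (w + 1 / w) = Im w * (1 - 1 / \<rho>\<^sup>2)"
      by (simp add: right_diff_distrib Im_divide_of_real)
    then have "\<bar>Im (w + 1 / w)\<bar> = \<bar>Im w\<bar> * (1 - 1 / \<rho>\<^sup>2)"
    proof -
      have "1 - 1 / \<rho>\<^sup>2 \<ge> 0" using s1 by (auto simp: divide_le_eq)
      with \<open>Im (w + 1 / w) = _\<close> show ?thesis by (simp only: abs_mult abs_of_nonneg)
    qed
    also have "\<dots> \<le> \<rho> * (1 - 1 / \<rho>\<^sup>2)"
      using abs_Im_le_cmod[of w] s1 by (intro mult_right_mono) (auto simp: nw divide_le_eq)
    also have "\<dots> = \<rho> - 1 / \<rho>" using rho by (simp add: power2_eq_square field_simps)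
    finally have "R / 2 * \<bar>Im (w + 1 / w)\<bar> \<le> R / 2 * (\<rho> - 1 / \<rho>)" using R by (intro mult_left_mono) auto
    moreover have "\<bar>Im z\<bar> = R / 2 * \<bar>Im (w + 1 / w)\<bar>"
      using R by (simp add: z_def abs_mult Im_complex_of_real)
    ultimately have "B * \<bar>Im z\<bar> \<le> B * (R * (\<rho> - 1 / \<rho>) / 2)" using B by (intro mult_left_mono) auto
    then have "C * (1 + norm z) * exp (B * \<bar>Im z\<bar>) \<le> M"
      unfolding M_def using nz C R rho by (intro mult_mono) auto
    with gr[of z] have "norm (F z) \<le> M" by linarith
    moreover have "norm (poly q (z\<^sup>2)) \<le> norm (F z) + norm (F z - poly q (z\<^sup>2))"
      using norm_triangle_ineq4[of "F z" "F z - poly q (z\<^sup>2)"] by simp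
    ultimately have "norm (poly q (z\<^sup>2)) \<le> M + d" using q[OF nz] by linarith
    then show ?thesis unfolding Q z2 .
  qed
  obtain p where p: "degree p \<le> n"
    "\<And>y. 0 \<le> y \<Longrightarrow> y \<le> 4 \<Longrightarrow> norm (poly Q (of_real y) - poly p (of_real y)) \<le> 2 * (M + d) / ((\<rho>\<^sup>2) ^ n * (\<rho>\<^sup>2 - 1))"
    using bernstein_polynomial_approximation[OF s1 QM] by blast
  define P where "P = pcompose p [:0, 4:]"
  show thesis
  proof (rule that)
    show "degree P \<le> n" using p(1) by (simp add: P_def degree_pcompose)
    fix x :: real assume x: "0 \<le> x" "x \<le> R"
    have "x \<le> R * \<rho>" using x R rho by (simp add: mult_le_cancel_left1 order_trans[OF x(2)])
    then have "norm (F (of_real x) - poly q ((of_real x)\<^sup>2)) \<le> d" using x by (intro q) simp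
    moreover have "(of_real x)\<^sup>2 = of_real (R\<^sup>2 / 4) * complex_of_real (4 * (x\<^sup>2 / R\<^sup>2))"
      using R by simp
    ultimately have e1: "norm (F (of_real x) - poly Q (of_real (4 * (x\<^sup>2 / R\<^sup>2)))) \<le> d" unfolding Q by (simp only:)
    have "x\<^sup>2 \<le> R\<^sup>2" using x by (intro power_mono) auto
    then have "x\<^sup>2 / R\<^sup>2 \<le> 1" using R by simp
    then have "norm (poly Q (of_real (4 * (x\<^sup>2 / R\<^sup>2))) - poly p (of_real (4 * (x\<^sup>2 / R\<^sup>2)))) \<le> 2 * (M + d) / ((\<rho>\<^sup>2) ^ n * (\<rho>\<^sup>2 - 1))"
      by (intro p(2)) auto
    also have "(\<rho>\<^sup>2) ^ n * (\<rho>\<^sup>2 - 1) = D" by (simp add: D_def power_mult)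
    finally have e2: "norm (poly Q (of_real (4 * (x\<^sup>2 / R\<^sup>2))) - poly P (of_real (x\<^sup>2 / R\<^sup>2))) \<le> 2 * (M + d) / D"
      by (simp add: P_def poly_pcompose mult.commute)
    have "norm (F (of_real x) - poly P (of_real (x\<^sup>2 / R\<^sup>2))) \<le> d + 2 * (M + d) / D"
      using norm_triangle_ineq[of "F (of_real x) - poly Q (of_real (4 * (x\<^sup>2 / R\<^sup>2)))" "poly Q (of_real (4 * (x\<^sup>2 / R\<^sup>2))) - poly P (of_real (x\<^sup>2 / R\<^sup>2))"] e1 e2
      by simp
    also have "d + 2 * (M + d) / D = d + 2 * d / D + 2 * M / D" by (simp add: add_divide_distrib distrib_left)
    also have "\<dots> = 4 * M / D" unfolding dD by simp
    finally show "norm (F (of_real x) - poly P (of_real (x\<^sup>2 / R\<^sup>2))) \<le>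
       4 * (C * (1 + R * \<rho>) * exp (B * (R * (\<rho> - 1 / \<rho>) / 2))) / (\<rho> ^ (2 * n) * (\<rho>\<^sup>2 - 1))"
      unfolding M_def D_def .
  qed
qed

section \<open>The sharp inequality on the half line\<close>

lemma jacobi_poly_bound_radial:
  fixes p :: "complex poly"
  assumes nu: "nu > 0" and R: "R > 0" and deg: "degree p \<le> n"
  shows "ennreal (R powr (2 * nu) / 2 * jacobi_mass nu 1 n * (cmod (poly p 0))\<^sup>2) \<le>
    (\<integral>\<^sup>+r. ennreal ((cmod (poly p (of_real (r\<^sup>2 / R\<^sup>2))))\<^sup>2) *
       ennreal (indicator {0<..<R} r * (r powr (2 * nu - 1) * (1 - r\<^sup>2 / R\<^sup>2) powr (1 - 1))) \<partial>lborel)"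
proof -
  have c: "continuous_on UNIV (\<lambda>y::real. poly p (complex_of_real y))"
    by (intro continuous_intros)
  then have [measurable]: "(\<lambda>y::real. poly p (complex_of_real y)) \<in> borel_measurable borel"
    by (rule borel_measurable_continuous_onI)
  have "ennreal (jacobi_mass nu 1 n * (cmod (poly p 0))\<^sup>2) \<le>
     (\<integral>\<^sup>+y. ennreal ((cmod (poly p (of_real y)))\<^sup>2 * jacobi_weight nu 1 y) \<partial>lborel)"
  proof (rule bessel_inequality_one_vector)
    show "has_bochner_integral lborel (\<lambda>y. poly (jacobi_kernel nu 1 n) y * jacobi_weight nu 1 y * poly (jacobi_kernel nu 1 n) y) (jacobi_mass nu 1 n)"
      using jacobi_kernel_reproducing_real[OF nu zero_less_one degree_jacobi_kernel[of nu 1 n]] by (simp add: jacobi_kernel_0)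
    show "has_bochner_integral lborel (\<lambda>y. of_real (poly (jacobi_kernel nu 1 n) y * jacobi_weight nu 1 y) * poly p (of_real y)) (of_real (jacobi_mass nu 1 n) * poly p 0)"
      by (rule jacobi_kernel_reproducing[OF nu zero_less_one deg])
  qed (auto simp: jacobi_weight_nonneg)
  then have "ennreal (R powr (2 * nu) / 2) * ennreal (jacobi_mass nu 1 n * (cmod (poly p 0))\<^sup>2) \<le>
     ennreal (R powr (2 * nu) / 2) * (\<integral>\<^sup>+y. ennreal ((cmod (poly p (of_real y)))\<^sup>2 * jacobi_weight nu 1 y) \<partial>lborel)"
    by (intro mult_left_mono) auto
  also have "ennreal (R powr (2 * nu) / 2) * ennreal (jacobi_mass nu 1 n * (cmod (poly p 0))\<^sup>2) =
      ennreal (R powr (2 * nu) / 2 * jacobi_mass nu 1 n * (cmod (poly p 0))\<^sup>2)"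
    by (subst ennreal_mult'[symmetric]) (auto simp: mult.assoc)
  also have "(\<integral>\<^sup>+y. ennreal ((cmod (poly p (of_real y)))\<^sup>2 * jacobi_weight nu 1 y) \<partial>lborel) =
     (\<integral>\<^sup>+y. ennreal ((cmod (poly p (of_real y)))\<^sup>2) * ennreal (jacobi_weight nu 1 y) \<partial>lborel)"
    by (simp add: ennreal_mult jacobi_weight_nonneg)
  also have "ennreal (R powr (2 * nu) / 2) * \<dots> = (\<integral>\<^sup>+r. ennreal ((cmod (poly p (of_real (r\<^sup>2 / R\<^sup>2))))\<^sup>2) *
       ennreal (indicator {0<..<R} r * (r powr (2 * nu - 1) * (1 - r\<^sup>2 / R\<^sup>2) powr (1 - 1))) \<partial>lborel)"
    by (rule nn_integral_jacobi_radial[symmetric]) (use R in auto)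
  finally show ?thesis .
qed

text \<open>
  Minkowski's inequality for squares, with the weight of the cross term equal to the error.
\<close>
lemma square_perturbation:
  fixes a b e :: real
  assumes "a \<ge> 0" "b \<ge> 0" "e \<ge> 0" "a \<le> b + e"
  shows "a\<^sup>2 \<le> (1 + e) * b\<^sup>2 + (e + e\<^sup>2)"
proof -
  have "a\<^sup>2 \<le> (b + e)\<^sup>2" using assms by (intro power_mono) auto
  moreover have "0 \<le> e * (b - 1)\<^sup>2" using assms by simp
  ultimately show ?thesis by (simp add: power2_eq_square algebra_simps)
qed

text \<open>
  The polynomial \<open>p\<close> stands in for \<open>F\<close> both under the integral and at \<open>0\<close>; each exchange costs a factor
  \<open>1 + E\<close> and a summand of order \<open>E\<close>.
\<close>
lemma half_line_bound_perturbed: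
  fixes F :: "complex \<Rightarrow> complex" and p :: "complex poly"
  assumes F: "continuous_on UNIV F" and nu: "nu > 0" and R: "R > 0" and deg: "degree p \<le> n" and E: "E \<ge> 0"
    and approx: "\<And>x. 0 \<le> x \<Longrightarrow> x \<le> R \<Longrightarrow> norm (F (of_real x) - poly p (of_real (x\<^sup>2 / R\<^sup>2))) \<le> E"
    and J: "(\<integral>\<^sup>+r. ennreal ((cmod (F (of_real r)))\<^sup>2) * ennreal (indicator {0<..} r * r powr (2 * nu - 1)) \<partial>lborel) = ennreal J" "J \<ge> 0"
  defines "s \<equiv> R powr (2 * nu) / 2 * jacobi_mass nu 1 n"
  shows "s * (cmod (F 0))\<^sup>2 \<le> (1 + E) * ((1 + E) * J + (E + E\<^sup>2) * (R powr (2 * nu) / 2 * Beta nu 1)) + s * (E + E\<^sup>2)"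
proof -
  have s: "s \<ge> 0" unfolding s_def using jacobi_mass_pos[OF nu zero_less_one, of n] by simp
  have Bp: "Beta nu 1 \<ge> 0" using nu by (simp add: Beta_def less_imp_le Gamma_real_pos)
  let ?w = "\<lambda>r. indicator {0<..<R} r * (r powr (2 * nu - 1) * (1 - r\<^sup>2 / R\<^sup>2) powr (1 - 1))"
  let ?w' = "\<lambda>r. indicator {0<..} r * r powr (2 * nu - 1)"
  have [measurable]: "(\<lambda>r::real. F (of_real r)) \<in> borel_measurable borel"
    by (intro borel_measurable_continuous_onI continuous_on_compose2[OF F]) (auto intro!: continuous_intros)
  have one: "(\<integral>\<^sup>+r. ennreal (?w r) \<partial>lborel) = ennreal (R powr (2 * nu) / 2 * Beta nu 1)"
  proof -
    have "(\<integral>\<^sup>+r. 1 * ennreal (?w r) \<partial>lborel) = ennreal (R powr (2 * nu) / 2) * (\<integral>\<^sup>+y. 1 * ennreal (jacobi_weight nu 1 y) \<partial>lborel)"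
      by (rule nn_integral_jacobi_radial) (use R in auto)
    then show ?thesis
      unfolding mult_1 nn_integral_jacobi_weight[OF nu zero_less_one] by (simp only: ennreal_mult'[OF divide_nonneg_nonneg[OF powr_ge_zero zero_le_numeral]])
  qed
  have "ennreal (s * (cmod (poly p 0))\<^sup>2) \<le>
    (\<integral>\<^sup>+r. ennreal ((cmod (poly p (of_real (r\<^sup>2 / R\<^sup>2))))\<^sup>2) * ennreal (?w r) \<partial>lborel)"
    unfolding s_def by (rule jacobi_poly_bound_radial[OF nu R deg])
  also have "\<dots> \<le> (\<integral>\<^sup>+r. ennreal (1 + E) * (ennreal ((cmod (F (of_real r)))\<^sup>2) * ennreal (?w' r)) + ennreal (E + E\<^sup>2) * ennreal (?w r) \<partial>lborel)"
  proof (rule nn_integral_mono)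
    fix r :: real
    show "ennreal ((cmod (poly p (of_real (r\<^sup>2 / R\<^sup>2))))\<^sup>2) * ennreal (?w r) \<le>
      ennreal (1 + E) * (ennreal ((cmod (F (of_real r)))\<^sup>2) * ennreal (?w' r)) + ennreal (E + E\<^sup>2) * ennreal (?w r)"
    proof (cases "0 < r \<and> r < R")
      case True
      have n: "norm (poly p (of_real (r\<^sup>2 / R\<^sup>2))) \<le> norm (F (of_real r)) + E"
        using approx[of r] True norm_triangle_ineq3[of "F (of_real r)" "poly p (of_real (r\<^sup>2 / R\<^sup>2))"] by simp
      have w: "?w r \<le> ?w' r" "0 \<le> ?w r" using True by auto
      have "(cmod (poly p (of_real (r\<^sup>2 / R\<^sup>2))))\<^sup>2 * ?w r \<le> ((1 + E) * (cmod (F (of_real r)))\<^sup>2 + (E + E\<^sup>2)) * ?w r"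
        using square_perturbation[OF _ _ E n] w by (intro mult_right_mono) auto
      also have "\<dots> = (1 + E) * ((cmod (F (of_real r)))\<^sup>2 * ?w r) + (E + E\<^sup>2) * ?w r" by (simp add: algebra_simps)
      also have "\<dots> \<le> (1 + E) * ((cmod (F (of_real r)))\<^sup>2 * ?w' r) + (E + E\<^sup>2) * ?w r"
        using w E by (intro add_right_mono mult_left_mono) auto
      finally have "ennreal ((cmod (poly p (of_real (r\<^sup>2 / R\<^sup>2))))\<^sup>2 * ?w r) \<le>
         ennreal ((1 + E) * ((cmod (F (of_real r)))\<^sup>2 * ?w' r) + (E + E\<^sup>2) * ?w r)" by (rule ennreal_leI)
      then show ?thesis using E by (simp only: ennreal_plus ennreal_mult' zero_le_power2 add_nonneg_nonneg mult_nonneg_nonneg zero_le_one indicator_pos_le powr_ge_zero)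
    qed simp
  qed
  also have "\<dots> = ennreal (1 + E) * ennreal J + ennreal (E + E\<^sup>2) * ennreal (R powr (2 * nu) / 2 * Beta nu 1)"
    unfolding one[symmetric] J(1)[symmetric]
    by (subst nn_integral_add) (measurable, simp add: nn_integral_cmult)
  also have "\<dots> = ennreal ((1 + E) * J + (E + E\<^sup>2) * (R powr (2 * nu) / 2 * Beta nu 1))"
    using E J(2) Bp by (simp add: ennreal_mult'[symmetric] ennreal_plus[symmetric] del: ennreal_plus)
  finally have p0: "s * (cmod (poly p 0))\<^sup>2 \<le> (1 + E) * J + (E + E\<^sup>2) * (R powr (2 * nu) / 2 * Beta nu 1)"
    using E J(2) Bp by (subst (asm) ennreal_le_iff) (auto intro!: add_nonneg_nonneg mult_nonneg_nonneg)
  have "norm (F 0) \<le> norm (poly p 0) + E"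
    using approx[of 0] R norm_triangle_ineq2[of "F 0" "poly p 0"] by simp
  from square_perturbation[OF _ _ E this]
  have "s * (cmod (F 0))\<^sup>2 \<le> s * ((1 + E) * (cmod (poly p 0))\<^sup>2 + (E + E\<^sup>2))"
    using s by (intro mult_left_mono) auto
  also have "\<dots> = (1 + E) * (s * (cmod (poly p 0))\<^sup>2) + s * (E + E\<^sup>2)" by (simp add: algebra_simps)
  also have "\<dots> \<le> (1 + E) * ((1 + E) * J + (E + E\<^sup>2) * (R powr (2 * nu) / 2 * Beta nu 1)) + s * (E + E\<^sup>2)"
    using p0 E by (intro add_right_mono mult_left_mono) auto
  finally show ?thesis .
qed

text \<open>
  With \<open>R = \<kappa> n\<close> and degree \<open>n\<close>, the approximation error is, up to a factor linear in \<open>n\<close>,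
  \<open>exp (n (B \<kappa> (\<rho> - 1 / \<rho>) / 2 - 2 ln \<rho>))\<close>. For \<open>\<rho>\<close> near \<open>1\<close>
  the exponent is about \<open>n (B \<kappa> - 2) (\<rho> - 1)\<close>, which is negative for some \<open>B > 1\<close> exactly because \<open>\<kappa> < 2\<close>.
\<close>
lemma half_line_bound_kappa:
  fixes F :: "complex \<Rightarrow> complex"
  assumes hol: "F holomorphic_on UNIV" and even: "\<And>z. F (- z) = F z"
    and type: "\<And>b. b > 1 \<Longrightarrow> \<exists>C. \<forall>z. norm (F z) \<le> C * exp (b * norm z)"
    and nu: "nu \<ge> 1 / 2" and k: "0 < \<kappa>" "\<kappa> < 2"
    and J: "(\<integral>\<^sup>+r. ennreal ((cmod (F (of_real r)))\<^sup>2) * ennreal (indicator {0<..} r * r powr (2 * nu - 1)) \<partial>lborel) = ennreal J" "J \<ge> 0"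
  shows "\<kappa> powr (2 * nu) / 2 * (Gamma (nu + 1) * Gamma nu) * (cmod (F 0))\<^sup>2 \<le> J"
proof -
  have nu0: "nu > 0" using nu by simp
  \<comment> \<open>Halfway between \<open>1\<close> and \<open>2 / \<kappa>\<close>; the next choice makes \<open>\<rho>\<close> greater than \<open>1\<close> and \<open>B * \<kappa> * \<rho> = 2\<close>.\<close>
  define B where "B = (1 + 2 / \<kappa>) / 2"
  have B: "B > 1" using k by (simp add: B_def)
  define \<rho> where "\<rho> = 2 / (B * \<kappa>)"
  have Bk: "B * \<kappa> = (\<kappa> + 2) / 2" using k by (simp add: B_def field_simps)
  have rho: "\<rho> > 1" unfolding \<rho>_def Bk using k by (simp add: field_simps)
  have Brho: "B * \<kappa> = 2 / \<rho>" using k B by (simp add: \<rho>_def)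
  define c where "c = 2 * ln \<rho> - (1 - 1 / \<rho>\<^sup>2)"
  have c: "c > 0"
  proof -
    have "ln (1 / \<rho>) \<le> 1 / \<rho> - 1" using rho by (intro ln_le_minus_one) simp
    then have "ln \<rho> \<ge> 1 - 1 / \<rho>" using rho by (simp add: ln_div)
    moreover have "(1 - 1 / \<rho>)\<^sup>2 > 0" using rho by simp
    then have "2 * (1 - 1 / \<rho>) > 1 - 1 / \<rho>\<^sup>2" by (simp add: power2_eq_square algebra_simps)
    ultimately show ?thesis by (simp add: c_def)
  qed
  obtain C0 where C0: "\<And>z. norm (F z) \<le> C0 * exp ((1 + B) / 2 * norm z)"
    using type[of "(1 + B) / 2"] B by auto
  obtain C where C: "C > 0" "\<And>z. norm (F z) \<le> C * (1 + norm z) * exp (B * \<bar>Im z\<bar>)"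
    by (rule paley_wiener_growth[OF hol even C0, of B "2 * nu - 1"]) (use B nu J in auto)
  define D where "D = 4 * C / (\<rho>\<^sup>2 - 1)"
  have r2: "\<rho>\<^sup>2 > 1" using rho by (simp add: one_less_power)
  have D: "D > 0" using C r2 by (simp add: D_def)
  define E where "E n = D * (1 + \<kappa> * real n * \<rho>) * exp (- c * real n)" for n
  have E0: "E n \<ge> 0" for n using D k rho by (simp add: E_def)
  have Eeq: "4 * (C * (1 + \<kappa> * real n * \<rho>) * exp (B * (\<kappa> * real n * (\<rho> - 1 / \<rho>) / 2))) / (\<rho> ^ (2 * n) * (\<rho>\<^sup>2 - 1)) = E n" for n
  proof -
    have p: "\<rho> ^ (2 * n) = exp (real n * (2 * ln \<rho>))"
      using rho by (simp add: exp_of_nat_mult exp_double power_mult)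
    have "B * (\<kappa> * real n * (\<rho> - 1 / \<rho>) / 2) = (B * \<kappa>) * (real n * (\<rho> - 1 / \<rho>) / 2)" by simp
    also have "\<dots> = real n * (1 - 1 / \<rho>\<^sup>2)"
      unfolding Brho using rho by (simp add: field_simps power2_eq_square)
    finally have e: "B * (\<kappa> * real n * (\<rho> - 1 / \<rho>) / 2) = real n * (1 - 1 / \<rho>\<^sup>2)" .
    have q: "exp (- c * real n) = exp (real n * (1 - 1 / \<rho>\<^sup>2)) / exp (real n * (2 * ln \<rho>))"
      unfolding exp_diff[symmetric] c_def by (simp add: algebra_simps)
    show ?thesis
      unfolding E_def D_def e p q by (simp add: mult_ac)
  qed
  define s where "s n = (\<kappa> * real n) powr (2 * nu) / 2 * jacobi_mass nu 1 n" for n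
  define R2 where "R2 n = (\<kappa> * real n) powr (2 * nu) / 2 * Beta nu 1" for n
  have ineq: "s n * (cmod (F 0))\<^sup>2 \<le> (1 + E n) * ((1 + E n) * J + (E n + (E n)\<^sup>2) * R2 n) + s n * (E n + (E n)\<^sup>2)"
    if n: "n > 0" for n
  proof -
    have R: "\<kappa> * real n > 0" using k n by simp
    obtain p where p: "degree p \<le> n"
      "\<And>x. 0 \<le> x \<Longrightarrow> x \<le> \<kappa> * real n \<Longrightarrow> norm (F (of_real x) - poly p (of_real (x\<^sup>2 / (\<kappa> * real n)\<^sup>2))) \<le> E n"
      using even_entire_polynomial_approximation[OF hol even C(2) C(1) _ R rho, of n] B unfolding Eeq by auto
    show ?thesis
      unfolding s_def R2_def
      by (rule half_line_bound_perturbed[OF holomorphic_on_imp_continuous_on[OF hol] nu0 R p(1) E0 p(2) J])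
  qed
  have lE: "E \<longlonglongrightarrow> 0"
  proof -
    have "(\<lambda>n. (1 + \<kappa> * real n * \<rho>) * exp (- c * real n)) \<longlonglongrightarrow> 0"
      using c k rho by real_asymp
    from tendsto_mult_left[OF this, of D] show ?thesis unfolding E_def[abs_def] by (simp add: mult.assoc)
  qed
  have lER: "(\<lambda>n. E n * R2 n) \<longlonglongrightarrow> 0"
  proof -
    have "(\<lambda>n. (1 + \<kappa> * real n * \<rho>) * exp (- c * real n) * (\<kappa> * real n) powr (2 * nu)) \<longlonglongrightarrow> 0"
      using c k rho nu0 by real_asymp
    from tendsto_mult_left[OF this, of "D * (1 / 2 * Beta nu 1)"] show ?thesis
      unfolding E_def[abs_def] R2_def[abs_def] by (simp add: mult_ac)
  qed
  define s0 where "s0 = \<kappa> powr (2 * nu) / 2 * (Gamma (nu + 1) * Gamma nu)"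
  have ls: "s \<longlonglongrightarrow> s0"
  proof -
    have "(\<lambda>n. \<kappa> powr (2 * nu) / 2 * (real n powr (2 * nu) * jacobi_mass nu 1 n)) \<longlonglongrightarrow> s0"
      unfolding s0_def by (intro tendsto_intros jacobi_mass_scaled_tendsto[OF nu0])
    moreover have "s = (\<lambda>n. \<kappa> powr (2 * nu) / 2 * (real n powr (2 * nu) * jacobi_mass nu 1 n))"
      unfolding s_def using k by (auto simp: powr_mult)
    ultimately show ?thesis by (simp only:)
  qed
  have "(\<lambda>n. (1 + E n) * ((1 + E n) * J + (1 + E n) * (E n * R2 n)) + s n * (E n + (E n)\<^sup>2)) \<longlonglongrightarrow>
     (1 + 0) * ((1 + 0) * J + (1 + 0) * 0) + s0 * (0 + 0\<^sup>2)"
    by (intro tendsto_intros lE lER ls)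
  then have lim: "(\<lambda>n. (1 + E n) * ((1 + E n) * J + (1 + E n) * (E n * R2 n)) + s n * (E n + (E n)\<^sup>2)) \<longlonglongrightarrow> J"
    by simp
  have "s0 * (cmod (F 0))\<^sup>2 \<le> J"
  proof (rule tendsto_le[OF _ lim tendsto_mult_right[OF ls]])
    show "\<forall>\<^sub>F n in sequentially. s n * (cmod (F 0))\<^sup>2 \<le> (1 + E n) * ((1 + E n) * J + (1 + E n) * (E n * R2 n)) + s n * (E n + (E n)\<^sup>2)"
      using eventually_gt_at_top[of 0]
    proof eventually_elim
      case (elim n)
      have "(E n + (E n)\<^sup>2) * R2 n = (1 + E n) * (E n * R2 n)" by (simp add: power2_eq_square algebra_simps)
      with ineq[OF elim] show ?case by simp
    qed
  qed simp
  then show ?thesis unfolding s0_def .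
qed

theorem half_line_bound:
  fixes F :: "complex \<Rightarrow> complex"
  assumes hol: "F holomorphic_on UNIV" and even: "\<And>z. F (- z) = F z"
    and type: "\<And>b. b > 1 \<Longrightarrow> \<exists>C. \<forall>z. norm (F z) \<le> C * exp (b * norm z)"
    and nu: "nu \<ge> 1 / 2"
  shows "ennreal (bessel_mass nu * (cmod (F 0))\<^sup>2) \<le>
    (\<integral>\<^sup>+r. ennreal ((cmod (F (of_real r)))\<^sup>2) * ennreal (indicator {0<..} r * r powr (2 * nu - 1)) \<partial>lborel)"
    (is "_ \<le> ?I")
proof (cases "?I = \<infinity>")
  case False
  then obtain J where J: "?I = ennreal J" "J \<ge> 0" by (cases ?I) auto
  have "bessel_mass nu * (cmod (F 0))\<^sup>2 \<le> J"
    unfolding bessel_mass_def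
  proof (rule tendsto_upperbound)
    show "((\<lambda>\<kappa>. \<kappa> powr (2 * nu) / 2 * (Gamma (nu + 1) * Gamma nu) * (cmod (F 0))\<^sup>2) \<longlongrightarrow>
       2 powr (2 * nu) / 2 * (Gamma (nu + 1) * Gamma nu) * (cmod (F 0))\<^sup>2) (at_left 2)"
      by (intro tendsto_intros) auto
    have "\<forall>\<^sub>F \<kappa> in at_left (2::real). \<kappa> \<in> {0<..<2}" by (rule eventually_at_leftI[of 0]) auto
    then show "\<forall>\<^sub>F \<kappa> in at_left 2. \<kappa> powr (2 * nu) / 2 * (Gamma (nu + 1) * Gamma nu) * (cmod (F 0))\<^sup>2 \<le> J"
    proof eventually_elim
      case (elim \<kappa>)
      then show ?case using half_line_bound_kappa[OF hol even type nu _ _ J] by auto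
    qed
  qed simp
  then show ?thesis unfolding J(1) by (rule ennreal_leI)
qed simp

section \<open>From directions to the whole space\<close>

definition complex_line :: "real ^ 'm \<Rightarrow> complex \<Rightarrow> complex ^ 'm"
  where "complex_line x w = (\<chi> j. w * of_real (x $ j))"

lemma exp_type_ball_line_holomorphic:
  assumes "f \<in> exp_type_ball"
  shows "(\<lambda>w. f (complex_line x w)) holomorphic_on UNIV"
proof -
  have "((\<lambda>w. f (complex_line x w)) has_field_derivative D) (at w) \<Longrightarrow> (\<lambda>w. f (complex_line x w)) field_differentiable (at w)" for D w
    by (auto simp: field_differentiable_def)
  moreover have "\<exists>D. ((\<lambda>w. f (complex_line x w)) has_field_derivative D) (at w)" for w
  proof -
    obtain a where a: "(f has_derivative (\<lambda>h. \<Sum>j\<in>UNIV. a $ j * h $ j)) (at (complex_line x w))"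
      using assms unfolding exp_type_ball_def entire_def by blast
    have "((\<lambda>w. complex_line x w) has_derivative (\<lambda>h. complex_line x h)) (at w)"
    proof (rule bounded_linear_imp_has_derivative)
      have "linear (complex_line x)"
        by (intro linearI) (simp_all add: complex_line_def vec_eq_iff distrib_right)
      then show "bounded_linear (complex_line x)" by (simp add: linear_conv_bounded_linear)
    qed
    from has_derivative_compose[OF this a]
    have "((\<lambda>w. f (complex_line x w)) has_derivative (\<lambda>h. \<Sum>j\<in>UNIV. a $ j * complex_line x h $ j)) (at w)" .
    also have "(\<lambda>h. \<Sum>j\<in>UNIV. a $ j * complex_line x h $ j) = (*) (\<Sum>j\<in>UNIV. a $ j * of_real (x $ j))"
      by (simp add: complex_line_def fun_eq_iff sum_distrib_left mult_ac)
    finally show ?thesis unfolding has_field_derivative_def by blast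
  qed
  ultimately show ?thesis unfolding holomorphic_on_def by (metis field_differentiable_at_within)
qed

lemma dual_norm_complex_line_le:
  fixes x :: "real ^ 'm"
  assumes "norm x \<le> 1"
  shows "dual_norm (complex_line x w) \<le> norm w"
  unfolding dual_norm_def
proof (rule cSUP_least)
  fix t :: "real ^ 'm" assume t: "t \<in> cball 0 1"
  have "(\<Sum>j\<in>UNIV. complex_of_real (t $ j) * complex_line x w $ j) = w * of_real (t \<bullet> x)"
    by (simp add: complex_line_def inner_vec_def sum_distrib_left mult_ac)
  moreover have "\<bar>t \<bullet> x\<bar> \<le> norm t * norm x" by (rule Cauchy_Schwarz_ineq2)
  moreover have "norm t * norm x \<le> 1 * 1" using t assms by (intro mult_mono) auto
  ultimately show "cmod (\<Sum>j\<in>UNIV. complex_of_real (t $ j) * complex_line x w $ j) \<le> norm w"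
    by (simp add: norm_mult mult_left_le)
qed simp

lemma restrict_real_eq_line: "restrict_real f (r *\<^sub>R x) = f (complex_line x (of_real r))"
  by (simp add: restrict_real_def complex_line_def)

text \<open>
  The one-variable inequality for the even part of \<open>f\<close> along \<open>x\<close>. The right-hand side
  may be infinite in single directions even if \<open>f\<close> is square integrable on the whole space.
\<close>
lemma exp_type_ball_direction_bound:
  fixes f :: "complex ^ 'm \<Rightarrow> complex"
  assumes f: "f \<in> exp_type_ball" and x: "norm x \<le> 1" and nu: "nu \<ge> 1 / 2"
  shows "ennreal (bessel_mass nu * (cmod (restrict_real f 0))\<^sup>2) \<le>
    (\<integral>\<^sup>+r. ennreal (((cmod (restrict_real f (r *\<^sub>R x)))\<^sup>2 + (cmod (restrict_real f (- (r *\<^sub>R x))))\<^sup>2) / 2) *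
       ennreal (indicator {0<..} r * r powr (2 * nu - 1)) \<partial>lborel)"
proof -
  define F where "F w = (f (complex_line x w) + f (complex_line x (- w))) / 2" for w
  have hol1: "(\<lambda>w. f (complex_line x w)) holomorphic_on UNIV"
    by (rule exp_type_ball_line_holomorphic[OF f])
  have "(\<lambda>w. f (complex_line x (- w))) holomorphic_on UNIV"
    using holomorphic_on_compose_gen[OF _ hol1, of uminus UNIV] by (simp add: o_def holomorphic_on_minus)
  with hol1 have hol: "F holomorphic_on UNIV"
    unfolding F_def by (intro holomorphic_intros) auto
  have even: "F (- z) = F z" for z by (simp add: F_def add.commute)
  have type: "\<exists>C. \<forall>z. norm (F z) \<le> C * exp (b * norm z)" if "b > 1" for b
  proof -
    have "b - 1 > 0" using that by simp
    then obtain C where C: "C > 0" "\<And>z. cmod (f z) \<le> C * exp ((1 + (b - 1)) * dual_norm z)"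
      using f unfolding exp_type_ball_def by blast
    have line: "norm (f (complex_line x w)) \<le> C * exp (b * norm w)" for w
    proof -
      have "b * dual_norm (complex_line x w) \<le> b * norm w"
        using that dual_norm_complex_line_le[OF x] by (intro mult_left_mono) auto
      then have "C * exp (b * dual_norm (complex_line x w)) \<le> C * exp (b * norm w)" using C by simp
      with C(2)[of "complex_line x w"] show ?thesis by simp
    qed
    have "norm (F z) \<le> C * exp (b * norm z)" for z
    proof -
      have "norm (F z) \<le> (norm (f (complex_line x z)) + norm (f (complex_line x (- z)))) / 2"
        unfolding F_def by (simp add: norm_divide norm_triangle_ineq)
      then show ?thesis using line[of z] line[of "- z"] by simp
    qed
    then show ?thesis by blast
  qed
  have "ennreal (bessel_mass nu * (cmod (F 0))\<^sup>2) \<le>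
     (\<integral>\<^sup>+r. ennreal ((cmod (F (of_real r)))\<^sup>2) * ennreal (indicator {0<..} r * r powr (2 * nu - 1)) \<partial>lborel)"
    by (rule half_line_bound[OF hol even type nu])
  also have "\<dots> \<le> (\<integral>\<^sup>+r. ennreal (((cmod (restrict_real f (r *\<^sub>R x)))\<^sup>2 + (cmod (restrict_real f (- (r *\<^sub>R x))))\<^sup>2) / 2) *
       ennreal (indicator {0<..} r * r powr (2 * nu - 1)) \<partial>lborel)"
  proof (intro nn_integral_mono mult_right_mono ennreal_leI)
    fix r :: real
    define a b where "a = restrict_real f (r *\<^sub>R x)" and "b = restrict_real f ((- r) *\<^sub>R x)"
    have Fr: "F (of_real r) = (a + b) / 2"
      unfolding F_def a_def b_def restrict_real_eq_line by simp
    have "(cmod (a + b))\<^sup>2 \<le> (cmod a + cmod b)\<^sup>2" by (intro power_mono norm_triangle_ineq) auto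
    moreover have "0 \<le> (cmod a - cmod b)\<^sup>2" by simp
    ultimately have "(cmod (a + b))\<^sup>2 \<le> 2 * ((cmod a)\<^sup>2 + (cmod b)\<^sup>2)"
      by (simp add: power2_eq_square algebra_simps)
    then have "(cmod (F (of_real r)))\<^sup>2 \<le> ((cmod a)\<^sup>2 + (cmod b)\<^sup>2) / 2"
      unfolding Fr by (simp add: norm_divide power_divide)
    then show "(cmod (F (of_real r)))\<^sup>2 \<le> ((cmod (restrict_real f (r *\<^sub>R x)))\<^sup>2 + (cmod (restrict_real f (- (r *\<^sub>R x))))\<^sup>2) / 2"
      by (simp add: a_def b_def)
  qed simp
  also have "F 0 = restrict_real f 0"
    using restrict_real_eq_line[of f 0 x] by (simp add: F_def)
  finally show ?thesis .
qed

text \<open>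
  The inequality for the direction of \<open>u\<close> is integrated over \<open>u\<close> in the unit ball. Polar coordinates turn
  the result into an integral over the space, where \<open>f x\<close> and \<open>f (- x)\<close> contribute equally.
\<close>
lemma exp_type_ball_power_weight_bound:
  fixes f :: "complex ^ 'm \<Rightarrow> complex"
  assumes f: "f \<in> exp_type_ball" and lam: "lam \<ge> 0"
  shows "ennreal (power_mass CARD('m) lam * (cmod (restrict_real f 0))\<^sup>2) \<le>
    (\<integral>\<^sup>+x. ennreal ((cmod (restrict_real f x))\<^sup>2) * ennreal (norm x powr (2 * lam)) \<partial>lborel)"
proof -
  define m where "m = CARD('m)"
  define nu where "nu = lam + real m / 2"
  have "real m \<ge> 1" using zero_less_card_finite[where 'a='m] by (simp add: m_def Suc_le_eq)
  then have nu: "nu \<ge> 1 / 2" using lam by (simp add: nu_def)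
  let ?h = "restrict_real f"
  let ?B = "ball (0 :: real ^ 'm) 1"
  have [measurable]: "?h \<in> borel_measurable borel"
    by (intro borel_measurable_continuous_onI exp_type_ball_restrict_continuous f)
  have [measurable]: "?B \<in> sets borel" by simp
  define S where "S x = ((cmod (?h x))\<^sup>2 + (cmod (?h (- x)))\<^sup>2) / 2" for x
  have [measurable]: "S \<in> borel_measurable borel" unfolding S_def[abs_def] by measurable
  have S0: "S x \<ge> 0" for x by (simp add: S_def)
  define c where "c = bessel_mass nu * (cmod (?h 0))\<^sup>2"
  let ?G = "\<lambda>x :: real ^ 'm. ennreal (S x) * ennreal (norm x powr (2 * lam))"
  let ?w = "\<lambda>r :: real. ennreal (indicator {0<..} r * r powr (2 * nu - 1))"
  have "ennreal (unit_ball_vol m) * ennreal c = (\<integral>\<^sup>+u. indicator ?B u * ennreal c \<partial>lborel)"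
    by (subst nn_integral_multc) (auto simp: emeasure_ball m_def)
  also have "\<dots> \<le> (\<integral>\<^sup>+u. indicator ?B u * (\<integral>\<^sup>+r. ennreal (S ((r / norm u) *\<^sub>R u)) * ?w r \<partial>lborel) \<partial>lborel)"
  proof (intro nn_integral_mono mult_left_mono)
    fix u :: "real ^ 'm"
    have "norm (u /\<^sub>R norm u) \<le> 1" by (cases "u = 0") auto
    have e: "r *\<^sub>R (u /\<^sub>R norm u) = (r / norm u) *\<^sub>R u" for r
      by (simp add: divide_inverse)
    from exp_type_ball_direction_bound[OF f \<open>norm (u /\<^sub>R norm u) \<le> 1\<close> nu, unfolded e]
    show "ennreal c \<le> (\<integral>\<^sup>+r. ennreal (S ((r / norm u) *\<^sub>R u)) * ?w r \<partial>lborel)"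
      unfolding c_def S_def e .
  qed simp
  also have "\<dots> = (\<integral>\<^sup>+u. (\<integral>\<^sup>+r. indicator ?B u * (ennreal (S ((r / norm u) *\<^sub>R u)) * ?w r) \<partial>lborel) \<partial>lborel)"
    by (intro nn_integral_cong nn_integral_cmult[symmetric]) measurable
  also have "\<dots> = (\<integral>\<^sup>+r. (\<integral>\<^sup>+u. indicator ?B u * (ennreal (S ((r / norm u) *\<^sub>R u)) * ?w r) \<partial>lborel) \<partial>lborel)"
    by (rule lborel_pair.Fubini'[symmetric]) measurable
  also have "\<dots> = (\<integral>\<^sup>+r. ennreal (r ^ (m - 1)) * indicator {0<..} r *
        (\<integral>\<^sup>+u. indicator ?B u * ?G ((r / norm u) *\<^sub>R u) \<partial>lborel) \<partial>lborel)"
  proof (rule nn_integral_cong)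
    fix r :: real
    show "(\<integral>\<^sup>+u. indicator ?B u * (ennreal (S ((r / norm u) *\<^sub>R u)) * ?w r) \<partial>lborel) =
       ennreal (r ^ (m - 1)) * indicator {0<..} r * (\<integral>\<^sup>+u. indicator ?B u * ?G ((r / norm u) *\<^sub>R u) \<partial>lborel)"
    proof (cases "r > 0")
      case True
      have "ennreal (r ^ (m - 1)) * indicator {0<..} r * (\<integral>\<^sup>+u. indicator ?B u * ?G ((r / norm u) *\<^sub>R u) \<partial>lborel) =
         (\<integral>\<^sup>+u. ennreal (r ^ (m - 1)) * indicator {0<..} r * (indicator ?B u * ?G ((r / norm u) *\<^sub>R u)) \<partial>lborel)"
        by (rule nn_integral_cmult[symmetric]) measurable
      also have "\<dots> = (\<integral>\<^sup>+u. indicator ?B u * (ennreal (S ((r / norm u) *\<^sub>R u)) * ?w r) \<partial>lborel)"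
      proof (rule nn_integral_cong_AE)
        have w: "ennreal (r ^ (m - 1)) * ennreal (r powr (2 * lam)) = ennreal (r powr (2 * nu - 1))"
          using radial_power_weight[OF True, where 'm='m, of lam] True
          by (subst ennreal_mult[symmetric]) (auto simp: nu_def m_def)
        have "AE u in lborel. (u :: real ^ 'm) \<noteq> 0" by (rule AE_lborel_singleton)
        then show "AE u in lborel. ennreal (r ^ (m - 1)) * indicator {0<..} r * (indicator ?B u * ?G ((r / norm u) *\<^sub>R u)) =
           indicator ?B u * (ennreal (S ((r / norm u) *\<^sub>R u)) * ?w r)"
        proof eventually_elim
          case (elim u)
          have n: "norm ((r / norm u) *\<^sub>R u) = r" using elim True by simp
          have "ennreal (r ^ (m - 1)) * indicator {0<..} r * (indicator ?B u * ?G ((r / norm u) *\<^sub>R u)) =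
            indicator ?B u * (ennreal (S ((r / norm u) *\<^sub>R u)) * (ennreal (r ^ (m - 1)) * ennreal (r powr (2 * lam))))"
            unfolding n using True by (simp add: mult_ac)
          then show ?case unfolding w using True by simp
        qed
      qed
      finally show ?thesis ..
    qed simp
  qed
  finally have "of_nat m * (ennreal (unit_ball_vol m) * ennreal c) \<le> of_nat m * (\<integral>\<^sup>+r. ennreal (r ^ (m - 1)) * indicator {0<..} r *
        (\<integral>\<^sup>+u. indicator ?B u * ?G ((r / norm u) *\<^sub>R u) \<partial>lborel) \<partial>lborel)"
    by (rule mult_left_mono) simp
  also have "\<dots> = (\<integral>\<^sup>+x. ?G x \<partial>lborel)"
    using nn_integral_polar[of ?G] by (simp add: m_def)
  also have "\<dots> = (\<integral>\<^sup>+x. ennreal ((cmod (?h x))\<^sup>2) * ennreal (norm x powr (2 * lam)) \<partial>lborel)"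
  proof -
    let ?g = "\<lambda>x :: real ^ 'm. ennreal ((cmod (?h x))\<^sup>2) * ennreal (norm x powr (2 * lam))"
    have refl: "(\<integral>\<^sup>+x. ?g (- x) \<partial>lborel) = (\<integral>\<^sup>+x. ?g x \<partial>lborel)"
      by (rule nn_integral_isometry) (auto intro: linearI)
    have "(\<integral>\<^sup>+x. ?G x \<partial>lborel) = (\<integral>\<^sup>+x. ennreal (1 / 2) * (?g x + ?g (- x)) \<partial>lborel)"
    proof (rule nn_integral_cong)
      fix x :: "real ^ 'm"
      have "ennreal (S x) = ennreal (1 / 2) * (ennreal ((cmod (?h x))\<^sup>2) + ennreal ((cmod (?h (- x)))\<^sup>2))"
      proof -
        have "S x = 1 / 2 * ((cmod (?h x))\<^sup>2 + (cmod (?h (- x)))\<^sup>2)" by (simp add: S_def)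
        then have "ennreal (S x) = ennreal (1 / 2) * ennreal ((cmod (?h x))\<^sup>2 + (cmod (?h (- x)))\<^sup>2)"
          by (simp only:) (rule ennreal_mult', simp)
        then show ?thesis by (simp only: ennreal_plus[OF zero_le_power2 zero_le_power2])
      qed
      then show "?G x = ennreal (1 / 2) * (?g x + ?g (- x))"
        by (simp add: distrib_left distrib_right mult.assoc)
    qed
    also have "\<dots> = ennreal (1 / 2) * (\<integral>\<^sup>+x. ?g x + ?g (- x) \<partial>lborel)"
      by (rule nn_integral_cmult) measurable
    also have "(\<integral>\<^sup>+x. ?g x + ?g (- x) \<partial>lborel) = (\<integral>\<^sup>+x. ?g x \<partial>lborel) + (\<integral>\<^sup>+x. ?g (- x) \<partial>lborel)"
      by (rule nn_integral_add) measurable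
    also have "ennreal (1 / 2) * \<dots> = (ennreal (1 / 2) + ennreal (1 / 2)) * (\<integral>\<^sup>+x. ?g x \<partial>lborel)"
      unfolding refl by (simp only: distrib_left distrib_right)
    also have "ennreal (1 / 2) + ennreal (1 / 2) = 1"
      by (subst ennreal_plus[symmetric]) auto
    finally show ?thesis by simp
  qed
  also have "of_nat m * (ennreal (unit_ball_vol m) * ennreal c) = ennreal (real m * unit_ball_vol m * c)"
    unfolding ennreal_of_nat_eq_real_of_nat by (simp add: ennreal_mult' mult.assoc)
  also have "real m * unit_ball_vol m * c = power_mass CARD('m) lam * (cmod (?h 0))\<^sup>2"
    using dim_times_unit_ball_vol[of "real m"] by (simp add: c_def power_mass_def nu_def m_def)
  finally show ?thesis .
qed

theorem nikolskii0_exp_type: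
  fixes lam :: real
  assumes lam: "lam \<ge> 0"
  shows "nikolskii0 (restrict_real ` (exp_type_ball :: (complex ^ 'm \<Rightarrow> complex) set)
          \<inter> wspace 2 (power_weight lam) UNIV) 2 (power_weight lam) UNIV =
      ennreal (sqrt (1 / power_mass (real CARD('m)) lam))"
proof (rule antisym)
  let ?g = "power_mass (real CARD('m)) lam"
  have g: "?g > 0" using lam by (intro power_mass_pos) auto
  show "nikolskii0 (restrict_real ` (exp_type_ball :: (complex ^ 'm \<Rightarrow> complex) set)
          \<inter> wspace 2 (power_weight lam) UNIV) 2 (power_weight lam) UNIV \<le> ennreal (sqrt (1 / ?g))"
    unfolding nikolskii0_def
  proof (rule SUP_least)
    fix h :: "real ^ 'm \<Rightarrow> complex"
    assume "h \<in> {h \<in> restrict_real ` exp_type_ball \<inter> wspace 2 (power_weight lam) UNIV. \<exists>x\<in>UNIV. h x \<noteq> 0}"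
    then obtain f :: "complex ^ 'm \<Rightarrow> complex" where f: "f \<in> exp_type_ball" "h = restrict_real f" by auto
    have m: "h \<in> borel_measurable borel"
      unfolding f(2) by (intro borel_measurable_continuous_onI exp_type_ball_restrict_continuous f)
    have "ennreal (?g * (cmod (h 0))\<^sup>2) \<le> (\<integral>\<^sup>+x. ennreal (cmod (h x) powr 2) * power_weight lam x \<partial>lebesgue_on UNIV)"
      unfolding nn_integral_lebesgue_power_weight[OF m] unfolding f(2)
      by (rule exp_type_ball_power_weight_bound[OF f(1) lam])
    then have "ennreal (cmod (h 0)) \<le> ennreal (sqrt (1 / ?g)) * wnorm 2 (power_weight lam) UNIV h"
      by (rule ennreal_le_wnorm_two) (use g in auto)
    then show "ennreal (cmod (h 0)) / wnorm 2 (power_weight lam) UNIV h \<le> ennreal (sqrt (1 / ?g))"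
      by (rule ennreal_divide_le) (use g in simp)
  qed
qed (rule nikolskii0_exp_type_ge[OF lam])

theorem theorem1p6:
  fixes lam m :: real
  assumes "lam \<ge> 0"
    and "m = real CARD('m::finite)"
  shows "(\<forall>n::nat.
      nikolskii (polys n :: (real ^ 'm \<Rightarrow> complex) set) 2 (gegenbauer_weight lam) (cball 0 1) =
        ennreal (sqrt
          ((2 * lam + 2 * real n + m) * Gamma (2 * lam + real n + m) /
           (2 powr (2 * lam + m - 1) * pi powr ((m - 1) / 2) * (2 * lam + m) *
            Gamma (lam + 1/2) * Gamma (lam + m / 2) * fact n)))) \<and>
    nikolskii0 (restrict_real ` (exp_type_ball :: (complex ^ 'm \<Rightarrow> complex) set)
          \<inter> wspace 2 (power_weight lam) UNIV) 2 (power_weight lam) UNIV =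
      ennreal (sqrt
        (Gamma (m / 2) /
         (2 powr (2 * lam + m - 1) * pi powr (m / 2) * (2 * lam + m) *
          (Gamma (lam + m / 2))\<^sup>2)))"
proof -
  have m: "m > 0" using assms(2) by simp
  have "nikolskii (polys n :: (real ^ 'm \<Rightarrow> complex) set) 2 (gegenbauer_weight lam) (cball 0 1) =
     ennreal (sqrt (1 / gegenbauer_mass m lam n))" for n
    unfolding assms(2) by (rule nikolskii_polys[OF assms(1)])
  moreover have "nikolskii0 (restrict_real ` (exp_type_ball :: (complex ^ 'm \<Rightarrow> complex) set)
          \<inter> wspace 2 (power_weight lam) UNIV) 2 (power_weight lam) UNIV =
      ennreal (sqrt (1 / power_mass m lam))"
    unfolding assms(2) by (rule nikolskii0_exp_type[OF assms(1)])
  ultimately show ?thesis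
    unfolding inverse_gegenbauer_mass[OF m assms(1)] inverse_power_mass[OF m assms(1)] by blast
qed

end
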